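(* Let $g\in\{1,\ldots,2^{n_-}\}$ and let $h,i,j\in\mathbb{E}$ with $i\subseteq(h\cap j)^+$. Then $(h,(h\triangle j)\cup i,j)\in\mathbb{P}$, and the Jacobson radical $\mathrm{Rad}(\mathbb{T}D_g)$ of the block algebra $\mathbb{T}D_g$ of $\mathbb{T}$ has as an $\mathbb{F}$-basis the set of all matrices $B_{a,(a\triangle c)\cup b,c}D_g$ where $a,b,c\in\mathbb{E}$, $b\subseteq(a\cap c)^+$, there exists $d\in\mathbb{E}$ with $(c,d,c)\in\mathbb{C}_g$ and $n_{c,a\cup d,c}=0$, and $p\mid k_{(a\triangle c)\cup b}$. Moreover, the nilpotent index of $\mathrm{Rad}(\mathbb{T}D_g)$ is $2n_++1$. Further, let $(k,l,k)\in\mathbb{C}_g$. Then $n_{k,l,k}$ is independent of the choice of $(k,l,k)\in\mathbb{C}_g$, and there is an $\mathbb{F}$-algebra isomorphism from $\mathbb{T}D_g/\mathrm{Rad}(\mathbb{T}D_g)$ to the direct sum of $2^{n_+}$ copies of the full matrix algebra $\mathrm{M}_{2^{\,n-n_+-n_{k,l,k}}}(\mathbb{F})$. In particular, the $\mathbb{F}$-dimension of $\mathrm{Rad}(\mathbb{T}D_g)$ is $4^{\,n-n_+-n_{k,l,k}}5^{\,n_+}-2^{\,2n-n_+-2n_{k,l,k}}$.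
   Context: Setting. Let $\mathbb{F}$ be a field of characteristic $p$ (possibly $p=0$; $0\mid m$ iff $m=0$). For an integer $m$, $\overline{m}$ is its image in $\mathbb{F}$. Let $n\ge 1$, let $\mathbb{U}_1,\ldots,\mathbb{U}_n$ be finite sets with $|\mathbb{U}_a|\ge 2$, let $\mathbb{X}=\prod_{a=1}^n\mathbb{U}_a$, and fix $\mathbf{x}\in\mathbb{X}$. Let $\mathbb{E}$ be the set of all subsets of $[n]=\{1,\ldots,n\}$ (the paper uses tuples in $\{0,1\}^n$; here a tuple is identified with its support). For $h\in\mathbb{E}$ let $R_h=\{(y,z)\in\mathbb{X}\times\mathbb{X}: y_a\neq z_a \text{ iff } a\in h\}$; $(\mathbb{X},\{R_h\}_{h\in\mathbb{E}})$ is the factorial association scheme. In the full matrix algebra $\mathrm{M}_\mathbb{X}(\mathbb{F})$, $A_h$ is the adjacency matrix of $R_h$, and $E_h^*$ is the diagonal matrix whose $(y,y)$-entry is $1$ if $(\mathbf{x},y)\in R_h$ and $0$ otherwise. The Terwilliger $\mathbb{F}$-algebra $\mathbb{T}$ is the $\mathbb{F}$-subalgebra of $\mathrm{M}_\mathbb{X}(\mathbb{F})$ generated by all $A_h$ and $E_h^*$, $h\in\mathbb{E}$. Notation. $k_h=\prod_{a\in h}(|\mathbb{U}_a|-1)$ (with $k_\varnothing=1$). For $V\subseteq[n]$: $V^\circ=\{a\in V: |\mathbb{U}_a|\neq 2\}$, $V^+=\{a\in V: p\mid |\mathbb{U}_a|-1\}$, $V^-=\{a\in V: |\mathbb{U}_a|\ne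 2,\ p\nmid|\mathbb{U}_a|-1\}$; $n_\pm=|[n]^\pm|$. For $a,b,c\in\mathbb{E}$, $n_{a,b,c}=|(a\cap c)^-\setminus b|$. $\triangle$ is symmetric difference. $\mathbb{P}=\{(a,b,c)\in\mathbb{E}^3: a\triangle c\subseteq b\subseteq (a\triangle c)\cup(a\cap c)^\circ\}$, and for $(a,b,c)\in\mathbb{P}$, $B_{a,b,c}=\sum_{a\triangle c\subseteq j\subseteq b}E_a^*A_jE_c^*$. For $(a,b,c)\in\mathbb{P}$ with $p\nmid k_b$, $$D_{a,b,c}=\sum_{q}(\overline{-1})^{|q\setminus b|}\,\overline{k_{c\cap q}}^{\,-1}B_{a,q,c},$$ the sum over all $q\in\mathbb{E}$ with $b\subseteq q\subseteq (a\triangle c)\cup(a\cap c)^\circ$ and $p\nmid k_q$. On $\{(a,b,a)\in\mathbb{P}: p\nmid k_b\}$ put $(a,b,a)\approx(a',b',a')$ iff $a^-\setminus b=a'^-\setminus b'$. This is an equivalence relation with exactly $2^{n_-}$ classes; enumerate them as $\mathbb{C}_1,\ldots,\mathbb{C}_{2^{n_-}}$. For $m\in\{1,\ldots,2^{n_-}\}$ let $D_m=\sum_{(a,b,a)\in\mathbb{C}_m}D_{a,b,a}$. The matrices $D_1,\ldots,D_{2^{n_-}}$ are the primitive idempotents of the center of $\mathbb{T}$ (block idempotents), and $\mathbb{T}D_g$ is called a block algebra of $\mathbb{T}$; it is an algebra with identity $D_g$. The nilpotent index of a nilpotent two-sided ideal $\mathbb{I}$ is the smallest $t\ge1$ such that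 the product of any $t$ elements of $\mathbb{I}$ is zero. *)

theory Defs
  imports
    "HOL-Library.FuncSet"
    "HOL-Library.Function_Algebras"
    "HOL-Algebra.QuotRing"
    "HOL-Algebra.Subrings"
    "HOL-Algebra.Module"
begin

section \<open>Algebras over a field\<close>

text \<open>
  An algebra over the field type \<^typ>\<open>'f\<close> is a record of type \<open>('f, 'm) module\<close>, whose
  ring part is the ring structure and whose \<open>smult\<close> field is the scalar action.
\<close>

definition is_subalgebra :: "'m set \<Rightarrow> ('f, 'm) module \<Rightarrow> bool" where
  "is_subalgebra S A \<longleftrightarrow> subring S A \<and> (\<forall>c. \<forall>x\<in>S. c \<odot>\<^bsub>A\<^esub> x \<in> S)"

definition generated_subalgebra :: "('f, 'm) module \<Rightarrow> 'm set \<Rightarrow> 'm set" where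
  "generated_subalgebra A G = \<Inter>{S. is_subalgebra S A \<and> G \<subseteq> S}"

definition left_ideal :: "'m set \<Rightarrow> ('m, 'z) ring_scheme \<Rightarrow> bool" where
  "left_ideal L A \<longleftrightarrow> additive_subgroup L A \<and> (\<forall>r\<in>carrier A. \<forall>l\<in>L. r \<otimes>\<^bsub>A\<^esub> l \<in> L)"

definition maximal_left_ideal :: "'m set \<Rightarrow> ('m, 'z) ring_scheme \<Rightarrow> bool" where
  "maximal_left_ideal L A \<longleftrightarrow> left_ideal L A \<and> L \<noteq> carrier A \<and>
     (\<forall>L'. left_ideal L' A \<and> L \<subseteq> L' \<longrightarrow> L' = L \<or> L' = carrier A)"

definition jacobson_radical :: "('m, 'z) ring_scheme \<Rightarrow> 'm set" where
  "jacobson_radical A = carrier A \<inter> \<Inter>{L. maximal_left_ideal L A}"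

definition product_vanishes :: "('m, 'z) ring_scheme \<Rightarrow> 'm set \<Rightarrow> nat \<Rightarrow> bool" where
  "product_vanishes A I t \<longleftrightarrow>
     (\<forall>xs. length xs = t \<and> set xs \<subseteq> I \<longrightarrow> foldr (\<lambda>u v. u \<otimes>\<^bsub>A\<^esub> v) xs \<one>\<^bsub>A\<^esub> = \<zero>\<^bsub>A\<^esub>)"

text \<open>
  A relation instead of a function defined by \<^const>\<open>Least\<close>, so that nothing is said about
  ideals that are not nilpotent.
\<close>

definition has_nilpotent_index :: "('m, 'z) ring_scheme \<Rightarrow> 'm set \<Rightarrow> nat \<Rightarrow> bool" where
  "has_nilpotent_index A I t \<longleftrightarrow> ideal I A \<and> t \<ge> 1 \<and> product_vanishes A I t \<and>
     (\<forall>s. 1 \<le> s \<and> s < t \<longrightarrow> \<not> product_vanishes A I s)"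

text \<open>
  The scalar action on the quotient sends a coset \<open>I + x\<close> to \<open>I + c x\<close>; it is written
  as a union over representatives, as the library does for the product of cosets.
\<close>

definition quotient_algebra :: "('f, 'm) module \<Rightarrow> 'm set \<Rightarrow> ('f, 'm set) module" where
  "quotient_algebra A I = ring.extend (A Quot I)
     (module.fields (\<lambda>c K. \<Union>x\<in>K. I +>\<^bsub>A\<^esub> (c \<odot>\<^bsub>A\<^esub> x)))"

definition direct_power :: "('f, 'm) module \<Rightarrow> nat \<Rightarrow> ('f, nat \<Rightarrow> 'm) module" where
  "direct_power A N =
     \<lparr>carrier = {1..N} \<rightarrow>\<^sub>E carrier A,
      mult = (\<lambda>u v. \<lambda>r\<in>{1..N}. u r \<otimes>\<^bsub>A\<^esub> v r),
      one = (\<lambda>r\<in>{1..N}. \<one>\<^bsub>A\<^esub>),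
      zero = (\<lambda>r\<in>{1..N}. \<zero>\<^bsub>A\<^esub>),
      add = (\<lambda>u v. \<lambda>r\<in>{1..N}. u r \<oplus>\<^bsub>A\<^esub> v r),
      smult = (\<lambda>c u. \<lambda>r\<in>{1..N}. c \<odot>\<^bsub>A\<^esub> u r)\<rparr>"

definition algebra_iso :: "('f, 'm) module \<Rightarrow> ('f, 'k) module \<Rightarrow> ('m \<Rightarrow> 'k) set" where
  "algebra_iso A B = {\<phi> \<in> ring_iso A B. \<forall>c. \<forall>x\<in>carrier A. \<phi> (c \<odot>\<^bsub>A\<^esub> x) = c \<odot>\<^bsub>B\<^esub> \<phi> x}"


section \<open>Matrices indexed by a finite set\<close>

text \<open>
  A matrix with rows and columns indexed by \<open>X\<close> is a function of two arguments that is zero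
  outside \<open>X \<times> X\<close>. Sum and zero are the pointwise ones of
  \<^theory>\<open>HOL-Library.Function_Algebras\<close>; the pointwise product of that theory is not used.
\<close>

type_synonym ('i, 'f) matrix = "'i \<Rightarrow> 'i \<Rightarrow> 'f"

definition mat_scale :: "'f::field \<Rightarrow> ('i, 'f) matrix \<Rightarrow> ('i, 'f) matrix" where
  "mat_scale c M = (\<lambda>y z. c * M y z)"

definition mat_mult :: "'i set \<Rightarrow> ('i, 'f::field) matrix \<Rightarrow> ('i, 'f) matrix \<Rightarrow> ('i, 'f) matrix" where
  "mat_mult X M N = (\<lambda>y z. \<Sum>w\<in>X. M y w * N w z)"

definition matrix_algebra :: "'i set \<Rightarrow> ('f::field, ('i, 'f) matrix) module" where
  "matrix_algebra X =
     \<lparr>carrier = {M. \<forall>y z. (y, z) \<notin> X \<times> X \<longrightarrow> M y z = 0},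
      mult = mat_mult X,
      one = (\<lambda>y z. of_bool (y \<in> X \<and> y = z)),
      zero = 0,
      add = (+),
      smult = mat_scale\<rparr>"

global_interpretation mat_space: vector_space "mat_scale :: 'f::field \<Rightarrow> ('i, 'f) matrix \<Rightarrow> _"
  by unfold_locales (auto simp: mat_scale_def fun_eq_iff algebra_simps)


section \<open>The factorial scheme and its Terwilliger algebra\<close>

text \<open>
  Throughout, \<open>n\<close> is the number of factors, \<open>U\<close> the family of factors, \<open>x\<close> the base
  point and \<open>p\<close> the characteristic of the field. The condition that \<open>p\<close> divides \<open>m\<close> is
  \<^term>\<open>p dvd m\<close> on natural numbers, which for \<open>p = 0\<close> means \<open>m = 0\<close>.
\<close>

definition points :: "nat \<Rightarrow> (nat \<Rightarrow> 'u set) \<Rightarrow> (nat \<Rightarrow> 'u) set" where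
  "points n U = (\<Pi>\<^sub>E a\<in>{1..n}. U a)"

definition EE :: "nat \<Rightarrow> nat set set" where
  "EE n = Pow {1..n}"

definition rel :: "nat \<Rightarrow> (nat \<Rightarrow> 'u set) \<Rightarrow> nat set \<Rightarrow> ((nat \<Rightarrow> 'u) \<times> (nat \<Rightarrow> 'u)) set" where
  "rel n U h = {(y, z) \<in> points n U \<times> points n U. \<forall>a\<in>{1..n}. y a \<noteq> z a \<longleftrightarrow> a \<in> h}"

definition adj :: "nat \<Rightarrow> (nat \<Rightarrow> 'u set) \<Rightarrow> nat set \<Rightarrow> (nat \<Rightarrow> 'u, 'f::field) matrix" where
  "adj n U h = (\<lambda>y z. of_bool ((y, z) \<in> rel n U h))"

definition dual_idem ::
  "nat \<Rightarrow> (nat \<Rightarrow> 'u set) \<Rightarrow> (nat \<Rightarrow> 'u) \<Rightarrow> nat set \<Rightarrow> (nat \<Rightarrow> 'u, 'f::field) matrix" where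
  "dual_idem n U x h = (\<lambda>y z. of_bool (y = z \<and> (x, y) \<in> rel n U h))"

definition terwilliger_algebra ::
  "nat \<Rightarrow> (nat \<Rightarrow> 'u set) \<Rightarrow> (nat \<Rightarrow> 'u) \<Rightarrow> (nat \<Rightarrow> 'u, 'f::field) matrix set" where
  "terwilliger_algebra n U x = generated_subalgebra (matrix_algebra (points n U))
     (adj n U ` EE n \<union> dual_idem n U x ` EE n)"


section \<open>Block idempotents\<close>

definition kk :: "(nat \<Rightarrow> 'u set) \<Rightarrow> nat set \<Rightarrow> nat" where
  "kk U h = (\<Prod>a\<in>h. card (U a) - 1)"

definition circ_part :: "(nat \<Rightarrow> 'u set) \<Rightarrow> nat set \<Rightarrow> nat set" where
  "circ_part U V = {a \<in> V. card (U a) \<noteq> 2}"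

definition plus_part :: "nat \<Rightarrow> (nat \<Rightarrow> 'u set) \<Rightarrow> nat set \<Rightarrow> nat set" where
  "plus_part p U V = {a \<in> V. p dvd card (U a) - 1}"

definition minus_part :: "nat \<Rightarrow> (nat \<Rightarrow> 'u set) \<Rightarrow> nat set \<Rightarrow> nat set" where
  "minus_part p U V = {a \<in> V. card (U a) \<noteq> 2 \<and> \<not> p dvd card (U a) - 1}"

definition n_plus :: "nat \<Rightarrow> nat \<Rightarrow> (nat \<Rightarrow> 'u set) \<Rightarrow> nat" where
  "n_plus p n U = card (plus_part p U {1..n})"

definition n_minus :: "nat \<Rightarrow> nat \<Rightarrow> (nat \<Rightarrow> 'u set) \<Rightarrow> nat" where
  "n_minus p n U = card (minus_part p U {1..n})"

definition n_triple :: "nat \<Rightarrow> (nat \<Rightarrow> 'u set) \<Rightarrow> nat set \<Rightarrow> nat set \<Rightarrow> nat set \<Rightarrow> nat" where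
  "n_triple p U a b c = card (minus_part p U (a \<inter> c) - b)"

definition sdiff :: "nat set \<Rightarrow> nat set \<Rightarrow> nat set" where
  "sdiff a c = (a - c) \<union> (c - a)"

definition PP :: "nat \<Rightarrow> (nat \<Rightarrow> 'u set) \<Rightarrow> (nat set \<times> nat set \<times> nat set) set" where
  "PP n U = {(a, b, c). a \<in> EE n \<and> b \<in> EE n \<and> c \<in> EE n \<and>
     sdiff a c \<subseteq> b \<and> b \<subseteq> sdiff a c \<union> circ_part U (a \<inter> c)}"

definition BB :: "nat \<Rightarrow> (nat \<Rightarrow> 'u set) \<Rightarrow> (nat \<Rightarrow> 'u) \<Rightarrow> nat set \<Rightarrow> nat set \<Rightarrow> nat set \<Rightarrow>
    (nat \<Rightarrow> 'u, 'f::field) matrix" where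
  "BB n U x a b c = (\<Sum>j | sdiff a c \<subseteq> j \<and> j \<subseteq> b.
     mat_mult (points n U) (mat_mult (points n U) (dual_idem n U x a) (adj n U j)) (dual_idem n U x c))"

definition DD :: "nat \<Rightarrow> nat \<Rightarrow> (nat \<Rightarrow> 'u set) \<Rightarrow> (nat \<Rightarrow> 'u) \<Rightarrow> nat set \<Rightarrow> nat set \<Rightarrow> nat set \<Rightarrow>
    (nat \<Rightarrow> 'u, 'f::field) matrix" where
  "DD p n U x a b c =
     (\<Sum>q | q \<in> EE n \<and> b \<subseteq> q \<and> q \<subseteq> sdiff a c \<union> circ_part U (a \<inter> c) \<and> \<not> p dvd kk U q.
        mat_scale ((- 1) ^ card (q - b) * inverse (of_nat (kk U (c \<inter> q)))) (BB n U x a q c))"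

definition diag_triples :: "nat \<Rightarrow> nat \<Rightarrow> (nat \<Rightarrow> 'u set) \<Rightarrow> (nat set \<times> nat set \<times> nat set) set" where
  "diag_triples p n U = {(a, b, c) \<in> PP n U. a = c \<and> \<not> p dvd kk U b}"

definition approx_rel :: "nat \<Rightarrow> nat \<Rightarrow> (nat \<Rightarrow> 'u set) \<Rightarrow>
    ((nat set \<times> nat set \<times> nat set) \<times> (nat set \<times> nat set \<times> nat set)) set" where
  "approx_rel p n U = {((a, b, c), (a', b', c')).
     (a, b, c) \<in> diag_triples p n U \<and> (a', b', c') \<in> diag_triples p n U \<and>
     minus_part p U a - b = minus_part p U a' - b'}"

definition approx_classes :: "nat \<Rightarrow> nat \<Rightarrow> (nat \<Rightarrow> 'u set) \<Rightarrow> (nat set \<times> nat set \<times> nat set) set set" where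
  "approx_classes p n U = diag_triples p n U // approx_rel p n U"

definition block_idem :: "nat \<Rightarrow> nat \<Rightarrow> (nat \<Rightarrow> 'u set) \<Rightarrow> (nat \<Rightarrow> 'u) \<Rightarrow>
    (nat set \<times> nat set \<times> nat set) set \<Rightarrow> (nat \<Rightarrow> 'u, 'f::field) matrix" where
  "block_idem p n U x K = (\<Sum>(a, b, c)\<in>K. DD p n U x a b c)"

definition block_algebra :: "nat \<Rightarrow> nat \<Rightarrow> (nat \<Rightarrow> 'u set) \<Rightarrow> (nat \<Rightarrow> 'u) \<Rightarrow>
    (nat set \<times> nat set \<times> nat set) set \<Rightarrow> ('f::field, (nat \<Rightarrow> 'u, 'f) matrix) module" where
  "block_algebra p n U x K = (matrix_algebra (points n U))
     \<lparr>carrier := {mat_mult (points n U) M (block_idem p n U x K) |M. M \<in> terwilliger_algebra n U x},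
      one := block_idem p n U x K\<rparr>"

text \<open>
  The classes correspond to the subsets of \<open>minus_part p U {1..n}\<close>, so they can be
  enumerated by \<open>1, \<dots>, 2 ^ n_minus p n U\<close>.
\<close>

lemma bij_betw_approx_classes:
  assumes "p \<noteq> 1"
  shows "bij_betw (\<lambda>S. {(a, b, c). (a, b, c) \<in> diag_triples p n U \<and> minus_part p U a - b = S})
     (Pow (minus_part p U {1..n})) (approx_classes p n U)"
proof -
  define f where
    "f S = {(a, b, c). (a, b, c) \<in> diag_triples p n U \<and> minus_part p U a - b = S}" for S
  let ?M = "minus_part p U {1..n}"
  have mem: "(S, {}, S) \<in> f S" if "S \<subseteq> ?M" for S
    using that assms
    by (auto simp: f_def diag_triples_def PP_def EE_def sdiff_def kk_def minus_part_def)
  have inj: "inj_on f (Pow ?M)"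
  proof (rule inj_onI)
    fix S T assume "S \<in> Pow ?M" "T \<in> Pow ?M" "f S = f T"
    then have "(S, {}, S) \<in> f S" "(S, {}, S) \<in> f T" using mem by auto
    then show "S = T" by (auto simp: f_def)
  qed
  have cls: "approx_rel p n U `` {(a, b, c)} = f (minus_part p U a - b)"
    if "(a, b, c) \<in> diag_triples p n U" for a b c
    using that by (auto simp: approx_rel_def f_def)
  have sub: "minus_part p U a - b \<subseteq> ?M" if "(a, b, c) \<in> diag_triples p n U" for a b c
    using that by (auto simp: diag_triples_def PP_def EE_def minus_part_def)
  have "f ` Pow ?M = approx_classes p n U"
  proof (intro equalityI subsetI)
    fix K assume "K \<in> f ` Pow ?M"
    then obtain S where S: "S \<subseteq> ?M" "K = f S" by auto
    have "(S, {}, S) \<in> diag_triples p n U" "minus_part p U S - {} = S"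
      using mem[OF S(1)] by (auto simp: f_def)
    then show "K \<in> approx_classes p n U"
      using cls[of S "{}" S] S(2) unfolding approx_classes_def by (metis quotientI)
  next
    fix K assume "K \<in> approx_classes p n U"
    then obtain a b c where "(a, b, c) \<in> diag_triples p n U" "K = approx_rel p n U `` {(a, b, c)}"
      unfolding approx_classes_def by (auto elim!: quotientE)
    then show "K \<in> f ` Pow ?M" using cls sub by blast
  qed
  then show ?thesis using inj unfolding bij_betw_def f_def by simp
qed

end

theory Submission
  imports Defs
begin

text \<open>
  Fix a block and let \<open>S \<subseteq> [n]\<^sup>-\<close> be the common value of \<open>a\<^sup>- - b\<close> on its class. The
  scheme is a product of trivial schemes, and accordingly the block algebra is the tensor product over \<open>i \<in> [n]\<close>
  of local algebras of matrices on \<open>U\<^sub>i\<close>: the field, spanned by \<open>I - J / k\<close> on the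
  complement of the base point, for \<open>i \<in> S\<close>; an algebra of dimension five for
  \<open>i \<in> [n]\<^sup>+\<close>, where \<open>k = 0\<close>; and the two by two matrices for the other \<open>i\<close>. In the
  second case the idempotents \<open>E\<^sub>0\<close>, \<open>E\<^sub>1\<close> have degree 0, the two off-diagonal blocks of
  ones degree 1, and the diagonal block of ones, which is the product of these two in one order, degree 2;
  the product in the other order is \<open>k = 0\<close>. Hence the block algebra is graded with degrees from 0 to
  \<open>2 n\<^sub>+\<close>. The elements of positive degree form a nilpotent ideal, and the part of
  degree 0 is a direct sum of \<open>2 ^ n\<^sub>+\<close> full matrix algebras. A nilpotent ideal with
  such a quotient is the Jacobson radical. Linear independence and coefficients are read off from products
  of local dual functionals.
\<close>

section \<open>Jacobson radicals\<close>

text \<open>The algebra \<open>T\<close> is given by generators only, which says nothing about a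
  basis. So the block is enclosed from two sides. From above: the generators are tensor products of
  local matrices that commute with the local idempotents and are sent by them into the local
  algebras, and the corresponding global property is stable under sums and products. From below:
  multiplied by the block idempotent, suitable matrices B_{a,b,c} become nonzero multiples of the
  tensor monomials. This second computation also explains the basis of the radical, because p
  divides k of the middle index exactly when the degree is positive.

  For i in [n]^- the identity on the complement of the base point splits as J/k + (I - J/k), and a
  block chooses one summand; hence the 2^{n_-} classes. If |U_i| = 2, the second summand is 0 and
  there is no choice. If k = 0 in the field, the splitting does not exist and I and J remain as
  independent elements. To tell them apart one needs an off-diagonal entry, hence two points besides
  the base point; they exist because p cannot divide 1.\<close>

lemma ring_matrix_algebra:
  assumes fin: "finite X"
  shows "ring (matrix_algebra X :: ('f::field, ('i, 'f) matrix) module)"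
proof (intro ringI abelian_groupI monoidI)
  fix L M N :: "('i, 'f) matrix"
  show "L \<otimes>\<^bsub>matrix_algebra X\<^esub> M \<otimes>\<^bsub>matrix_algebra X\<^esub> N =
      L \<otimes>\<^bsub>matrix_algebra X\<^esub> (M \<otimes>\<^bsub>matrix_algebra X\<^esub> N)"
    unfolding matrix_algebra_def mat_mult_def
    by (auto simp: fun_eq_iff sum_distrib_left sum_distrib_right mult.assoc intro: sum.swap)
next
  fix M :: "('i, 'f) matrix"
  assume M: "M \<in> carrier (matrix_algebra X)"
  show "\<exists>N\<in>carrier (matrix_algebra X). N \<oplus>\<^bsub>matrix_algebra X\<^esub> M = \<zero>\<^bsub>matrix_algebra X\<^esub>"
    using M by (intro bexI[of _ "- M"]) (auto simp: matrix_algebra_def)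
  show "\<one>\<^bsub>matrix_algebra X\<^esub> \<otimes>\<^bsub>matrix_algebra X\<^esub> M = M"
  proof (intro ext)
    fix y z
    have "(\<Sum>w\<in>X. of_bool (y \<in> X \<and> y = w) * M w z) = (\<Sum>w\<in>X. if w = y then M w z else 0)"
      by (intro sum.cong) auto
    then show "(\<one>\<^bsub>matrix_algebra X\<^esub> \<otimes>\<^bsub>matrix_algebra X\<^esub> M) y z = M y z"
      using M fin by (auto simp: matrix_algebra_def mat_mult_def sum.delta)
  qed
  show "M \<otimes>\<^bsub>matrix_algebra X\<^esub> \<one>\<^bsub>matrix_algebra X\<^esub> = M"
  proof (intro ext)
    fix y z
    have "(\<Sum>w\<in>X. M y w * of_bool (w \<in> X \<and> w = z)) = (\<Sum>w\<in>X. if w = z then M y w else 0)"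
      by (intro sum.cong) auto
    then show "(M \<otimes>\<^bsub>matrix_algebra X\<^esub> \<one>\<^bsub>matrix_algebra X\<^esub>) y z = M y z"
      using M fin by (auto simp: matrix_algebra_def mat_mult_def sum.delta)
  qed
qed (auto simp: matrix_algebra_def mat_mult_def fun_eq_iff algebra_simps sum.distrib)

text \<open>A block algebra has its own identity \<open>e\<close>, in general different from that of
  \<open>R\<close>, so it is not a subring; the axioms are collected from closure and from
  \<open>e\<close> acting as identity on \<open>S\<close>.\<close>

lemma ring_corner:
  assumes "ring R" and S: "S \<subseteq> carrier R" and zero: "\<zero>\<^bsub>R\<^esub> \<in> S" and e: "e \<in> S"
    and add: "\<And>a b. a \<in> S \<Longrightarrow> b \<in> S \<Longrightarrow> a \<oplus>\<^bsub>R\<^esub> b \<in> S"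
    and neg: "\<And>a. a \<in> S \<Longrightarrow> \<ominus>\<^bsub>R\<^esub> a \<in> S"
    and mult: "\<And>a b. a \<in> S \<Longrightarrow> b \<in> S \<Longrightarrow> a \<otimes>\<^bsub>R\<^esub> b \<in> S"
    and id: "\<And>a. a \<in> S \<Longrightarrow> e \<otimes>\<^bsub>R\<^esub> a = a" "\<And>a. a \<in> S \<Longrightarrow> a \<otimes>\<^bsub>R\<^esub> e = a"
  shows "ring (R\<lparr>carrier := S, one := e\<rparr>)"
proof -
  interpret ring R by fact
  have S': "a \<in> carrier R" if "a \<in> S" for a using that S by auto
  show ?thesis
  proof (intro ringI abelian_groupI monoidI)
    fix a assume "a \<in> carrier (R\<lparr>carrier := S, one := e\<rparr>)"
    then show "\<exists>b\<in>carrier (R\<lparr>carrier := S, one := e\<rparr>).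
        b \<oplus>\<^bsub>R\<lparr>carrier := S, one := e\<rparr>\<^esub> a = \<zero>\<^bsub>R\<lparr>carrier := S, one := e\<rparr>\<^esub>"
      using neg by (intro bexI[of _ "\<ominus>\<^bsub>R\<^esub> a"]) (auto simp: S' l_neg)
  qed (use S' zero e add mult id in \<open>auto simp: a_ac m_assoc l_distr r_distr\<close>)
qed

lemma foldr_mult_zero:
  assumes "ring A" "set xs \<subseteq> carrier A"
  shows "foldr (\<lambda>u v. u \<otimes>\<^bsub>A\<^esub> v) xs \<zero>\<^bsub>A\<^esub> = \<zero>\<^bsub>A\<^esub>"
proof -
  interpret ring A by fact
  show ?thesis using assms(2) by (induction xs) auto
qed

text \<open>The last \<open>s\<close> factors already multiply to zero. Excluding all shorter
  lengths thus reduces to the single length just below the nilpotent index.\<close>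

lemma product_vanishes_mono:
  assumes "ring A" "I \<subseteq> carrier A" "product_vanishes A I s" "s \<le> t"
  shows "product_vanishes A I t"
  unfolding product_vanishes_def
proof (intro allI impI, elim conjE)
  fix xs assume xs: "length xs = t" "set xs \<subseteq> I"
  define k where "k = t - s"
  have "set (drop k xs) \<subseteq> I" "length (drop k xs) = s"
    using xs assms(4) set_drop_subset[of k xs] by (auto simp: k_def)
  then have "foldr (\<lambda>u v. u \<otimes>\<^bsub>A\<^esub> v) (drop k xs) \<one>\<^bsub>A\<^esub> = \<zero>\<^bsub>A\<^esub>"
    using assms(3) by (auto simp: product_vanishes_def)
  moreover have "set (take k xs) \<subseteq> carrier A"
    using xs assms(2) set_take_subset[of k xs] by auto
  ultimately have "foldr (\<lambda>u v. u \<otimes>\<^bsub>A\<^esub> v) (take k xs @ drop k xs) \<one>\<^bsub>A\<^esub> = \<zero>\<^bsub>A\<^esub>"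
    using foldr_mult_zero[OF assms(1)] by (simp only: foldr_append)
  then show "foldr (\<lambda>u v. u \<otimes>\<^bsub>A\<^esub> v) xs \<one>\<^bsub>A\<^esub> = \<zero>\<^bsub>A\<^esub>" by simp
qed

lemma left_ideal_eq_carrier:
  assumes "ring A" "left_ideal L A" "\<one>\<^bsub>A\<^esub> \<in> L"
  shows "L = carrier A"
proof -
  interpret ring A by fact
  have "L \<subseteq> carrier A"
    using assms(2) by (simp add: left_ideal_def additive_subgroup.a_subset)
  moreover have "r \<in> L" if "r \<in> carrier A" for r
    using assms(2,3) that r_one[OF that] unfolding left_ideal_def by metis
  ultimately show ?thesis by auto
qed

text \<open>Otherwise maximality gives 1 = l + u with \<open>l\<close> in \<open>L\<close> and a
  nilpotent \<open>u\<close> in \<open>I\<close>, and this forces 1 into \<open>L\<close>.\<close>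

lemma nil_ideal_subset_maximal_left_ideal:
  assumes "ring A" and I: "ideal I A" and van: "product_vanishes A I t"
    and L: "maximal_left_ideal L A"
  shows "I \<subseteq> L"
proof (rule ccontr)
  interpret ring A by fact
  interpret I: ideal I A by fact
  have Lid: "left_ideal L A" and Lne: "L \<noteq> carrier A"
    and Lmax: "\<And>L'. left_ideal L' A \<Longrightarrow> L \<subseteq> L' \<Longrightarrow> L' = L \<or> L' = carrier A"
    using L by (auto simp: maximal_left_ideal_def)
  interpret L: additive_subgroup L A using Lid by (simp add: left_ideal_def)
  have Lmult: "r \<otimes>\<^bsub>A\<^esub> l \<in> L" if "r \<in> carrier A" "l \<in> L" for r l
    using Lid that by (auto simp: left_ideal_def)
  assume nsub: "\<not> I \<subseteq> L"
  have sub: "additive_subgroup (L <+>\<^bsub>A\<^esub> I) A"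
    by (rule add_additive_subgroups) (unfold_locales)
  have "left_ideal (L <+>\<^bsub>A\<^esub> I) A"
    unfolding left_ideal_def
  proof (intro conjI ballI sub)
    fix r v assume r: "r \<in> carrier A" and "v \<in> L <+>\<^bsub>A\<^esub> I"
    then obtain l i where v: "v = l \<oplus>\<^bsub>A\<^esub> i" "l \<in> L" "i \<in> I"
      by (auto simp: set_add_def')
    then have "r \<otimes>\<^bsub>A\<^esub> v = r \<otimes>\<^bsub>A\<^esub> l \<oplus>\<^bsub>A\<^esub> r \<otimes>\<^bsub>A\<^esub> i"
      using r by (auto simp: r_distr)
    moreover have "r \<otimes>\<^bsub>A\<^esub> i \<in> I" using r v I.I_l_closed by auto
    ultimately show "r \<otimes>\<^bsub>A\<^esub> v \<in> L <+>\<^bsub>A\<^esub> I"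
      using Lmult r v by (auto simp: set_add_def')
  qed
  moreover have "l \<in> L <+>\<^bsub>A\<^esub> I" if "l \<in> L" for l
    unfolding set_add_def' using that I.zero_closed r_zero[OF L.a_Hcarr[OF that]]
    by (metis UN_iff singletonI)
  moreover have "l \<in> L <+>\<^bsub>A\<^esub> I" if "l \<in> I" for l
    unfolding set_add_def' using that L.zero_closed l_zero[OF I.a_Hcarr[OF that]]
    by (metis UN_iff singletonI)
  ultimately have "L <+>\<^bsub>A\<^esub> I = carrier A"
    using Lmax nsub by blast
  then have "\<one>\<^bsub>A\<^esub> \<in> L <+>\<^bsub>A\<^esub> I" by simp
  then obtain l u where lu: "\<one>\<^bsub>A\<^esub> = l \<oplus>\<^bsub>A\<^esub> u" "l \<in> L" "u \<in> I"
    by (auto simp: set_add_def')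
  have uc: "u \<in> carrier A" using lu(3) by auto
  have fold: "foldr (\<lambda>u v. u \<otimes>\<^bsub>A\<^esub> v) (replicate j u) \<one>\<^bsub>A\<^esub> = u [^]\<^bsub>A\<^esub> j" for j
    using uc by (induction j) (simp_all, metis nat_pow_Suc2 nat_pow_Suc)
  \<comment> \<open>Multiplying 1 = l + u by u^j gives u^j = u^j l + u^(j+1), so membership in
    \<open>L\<close> descends from u^t = 0 to u^0 = 1.\<close>
  have step: "u [^]\<^bsub>A\<^esub> j \<in> L" if "u [^]\<^bsub>A\<^esub> Suc j \<in> L" for j
  proof -
    have c: "l \<in> carrier A" "u \<in> carrier A" using lu by auto
    have "u [^]\<^bsub>A\<^esub> j = u [^]\<^bsub>A\<^esub> j \<otimes>\<^bsub>A\<^esub> (l \<oplus>\<^bsub>A\<^esub> u)"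
      using lu(1) c by (metis nat_pow_closed r_one)
    also have "\<dots> = u [^]\<^bsub>A\<^esub> j \<otimes>\<^bsub>A\<^esub> l \<oplus>\<^bsub>A\<^esub> u [^]\<^bsub>A\<^esub> Suc j"
      using c by (simp add: r_distr)
    also have "\<dots> \<in> L" using that Lmult lu(2) c by (intro L.a_closed) auto
    finally show ?thesis .
  qed
  have "u [^]\<^bsub>A\<^esub> t = \<zero>\<^bsub>A\<^esub>"
    using van lu(3) fold[of t] unfolding product_vanishes_def
    by (metis empty_subsetI insert_subset length_replicate set_replicate_conv_if)
  then have "u [^]\<^bsub>A\<^esub> t \<in> L" by simp
  then have "u [^]\<^bsub>A\<^esub> (0::nat) \<in> L"
  proof (induction t)
    case (Suc t)
    then show ?case using step by blast
  qed auto
  then show False using left_ideal_eq_carrier[OF assms(1) Lid] Lne by simp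
qed

lemma direct_power_matrix_simps:
  fixes u v :: "nat \<Rightarrow> ('i, 'f::field) matrix"
  assumes "q \<in> {1..Q}"
  shows "(u \<otimes>\<^bsub>direct_power (matrix_algebra Y) Q\<^esub> v) q = mat_mult Y (u q) (v q)"
    and "(u \<oplus>\<^bsub>direct_power (matrix_algebra Y) Q\<^esub> v) q = u q + v q"
    and "\<zero>\<^bsub>direct_power (matrix_algebra Y) Q\<^esub> q = (0 :: ('i, 'f::field) matrix)"
  using assms by (auto simp: direct_power_def matrix_algebra_def)

text \<open>Over all components \<open>q\<close> and columns \<open>j\<close> these ideals intersect in the kernel of \<open>\<phi>\<close>.\<close>

lemma maximal_left_ideal_column:
  fixes A :: "('f::field, 'm) module"
  assumes "ring A"
    and hom: "\<phi> \<in> ring_hom A (direct_power (matrix_algebra Y) Q :: ('f, nat \<Rightarrow> ('i, 'f) matrix) module)"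
    and surj: "\<phi> ` carrier A = carrier (direct_power (matrix_algebra Y) Q)"
    and zero: "\<phi> \<zero>\<^bsub>A\<^esub> = \<zero>\<^bsub>direct_power (matrix_algebra Y) Q\<^esub>"
    and Y: "finite Y" and q: "q \<in> {1..Q}" and j: "j \<in> Y"
  shows "maximal_left_ideal {a \<in> carrier A. \<forall>i\<in>Y. \<phi> a q i j = 0} A"
proof -
  interpret ring A by fact
  let ?B = "direct_power (matrix_algebra Y) Q :: ('f, nat \<Rightarrow> ('i, 'f) matrix) module"
  let ?L = "{a \<in> carrier A. \<forall>i\<in>Y. \<phi> a q i j = 0}"
  have madd: "\<phi> (a \<oplus>\<^bsub>A\<^esub> b) q i j = \<phi> a q i j + \<phi> b q i j"
    if "a \<in> carrier A" "b \<in> carrier A" for a b i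
    using ring_hom_add[OF hom that] by (simp add: direct_power_matrix_simps(2)[OF q])
  have mmult: "\<phi> (a \<otimes>\<^bsub>A\<^esub> b) q i j = (\<Sum>w\<in>Y. \<phi> a q i w * \<phi> b q w j)"
    if "a \<in> carrier A" "b \<in> carrier A" for a b i
    using ring_hom_mult[OF hom that] by (simp add: direct_power_matrix_simps(1)[OF q] mat_mult_def)
  have mzero: "\<phi> \<zero>\<^bsub>A\<^esub> q i j = 0" for i
    using zero by (simp add: direct_power_matrix_simps(3)[OF q])
  have mneg: "\<phi> (\<ominus>\<^bsub>A\<^esub> a) q i j = - \<phi> a q i j" if "a \<in> carrier A" for a i
    using madd[OF a_inv_closed[OF that] that, of i] mzero[of i] that
    by (simp add: l_neg eq_neg_iff_add_eq_0)
  have surjE: "\<exists>a\<in>carrier A. \<phi> a q = M" if "M \<in> carrier (matrix_algebra Y)" for M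
  proof -
    have "(\<lambda>r\<in>{1..Q}. if r = q then M else 0) \<in> carrier ?B"
      using that by (auto simp: direct_power_def matrix_algebra_def)
    then obtain a where "a \<in> carrier A" "\<phi> a = (\<lambda>r\<in>{1..Q}. if r = q then M else 0)"
      using surj by (metis (no_types, lifting) imageE)
    then show ?thesis using q by (intro bexI[of _ a]) auto
  qed
  have Lid: "left_ideal ?L A"
    unfolding left_ideal_def
  proof (intro conjI ballI additive_subgroup.intro add.subgroupI)
    show "?L \<noteq> {}" using mzero by auto
  qed (auto simp: madd mneg mmult simp flip: a_inv_def)
  have "(\<lambda>y z. of_bool (y = j \<and> z = j)) \<in> carrier (matrix_algebra Y)"
    using j by (auto simp: matrix_algebra_def)
  then obtain a where a: "a \<in> carrier A" "\<phi> a q = (\<lambda>y z. of_bool (y = j \<and> z = j))"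
    using surjE by blast
  then have "a \<notin> ?L" using j by auto
  then have ne: "?L \<noteq> carrier A" using a(1) by blast
  have "L' = carrier A" if L': "left_ideal L' A" "?L \<subseteq> L'" "L' \<noteq> ?L" for L'
  proof -
    interpret L': additive_subgroup L' A using L' by (simp add: left_ideal_def)
    obtain b where b: "b \<in> L'" "b \<notin> ?L" using L' by blast
    then have bc: "b \<in> carrier A" by auto
    then obtain i0 where i0: "i0 \<in> Y" "\<phi> b q i0 j \<noteq> 0" using b by auto
    have "c \<in> L'" if c: "c \<in> carrier A" for c
    proof -
      \<comment> \<open>The only nonzero column of this matrix is \<open>i0\<close>; it carries
        column \<open>j\<close> of \<open>c\<close> divided by the nonzero entry of \<open>b\<close>
        at (i0, j). A preimage \<open>a\<close> of it satisfies that ab and \<open>c\<close> have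
        the same column \<open>j\<close> in component \<open>q\<close>, so c - ab lies in the column
        ideal.\<close>
      have "(\<lambda>y z. if y \<in> Y \<and> z = i0 then \<phi> c q y j / \<phi> b q i0 j else 0) \<in> carrier (matrix_algebra Y)"
        using i0 by (auto simp: matrix_algebra_def)
      then obtain a where a: "a \<in> carrier A"
        "\<phi> a q = (\<lambda>y z. if y \<in> Y \<and> z = i0 then \<phi> c q y j / \<phi> b q i0 j else 0)"
        using surjE by blast
      have "\<phi> (a \<otimes>\<^bsub>A\<^esub> b) q i j = \<phi> c q i j" if "i \<in> Y" for i
      proof -
        have "\<phi> (a \<otimes>\<^bsub>A\<^esub> b) q i j =
            (\<Sum>w\<in>Y. if w = i0 then \<phi> c q i j / \<phi> b q i0 j * \<phi> b q w j else 0)"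
          unfolding mmult[OF a(1) bc] using that by (intro sum.cong) (auto simp: a(2))
        then show ?thesis using i0 Y by (simp add: sum.delta)
      qed
      then have "c \<ominus>\<^bsub>A\<^esub> a \<otimes>\<^bsub>A\<^esub> b \<in> ?L"
        using c a bc by (auto simp: a_minus_def madd mneg)
      then have "c \<ominus>\<^bsub>A\<^esub> a \<otimes>\<^bsub>A\<^esub> b \<in> L'" using L' by auto
      moreover have "a \<otimes>\<^bsub>A\<^esub> b \<in> L'" using L'(1) a b by (auto simp: left_ideal_def)
      ultimately have "(c \<ominus>\<^bsub>A\<^esub> a \<otimes>\<^bsub>A\<^esub> b) \<oplus>\<^bsub>A\<^esub> a \<otimes>\<^bsub>A\<^esub> b \<in> L'" by auto
      then show ?thesis using c a bc by (simp add: a_minus_def a_assoc l_neg)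
    qed
    then show ?thesis using L'.a_subset by auto
  qed
  then show ?thesis using Lid ne unfolding maximal_left_ideal_def by blast
qed

text \<open>\<open>B\<close> inherits the ring axioms as the image of \<open>A\<close>; in this way
  the direct power becomes a ring.\<close>

lemma ring_hom_ring_surj:
  assumes "ring A" "\<phi> \<in> ring_hom A B" "\<phi> ` carrier A = carrier B" "\<phi> \<zero>\<^bsub>A\<^esub> = \<zero>\<^bsub>B\<^esub>"
  shows "ring_hom_ring A B \<phi>"
proof -
  interpret ring A by fact
  have "ring B" using ring_hom_imp_img_ring[OF assms(2)] assms(3,4) by simp
  then show ?thesis using assms by (auto intro!: ring_hom_ringI2)
qed

text \<open>Two bounds meet: a nilpotent ideal lies in every maximal left ideal, and the column
  ideals are enough maximal left ideals to cut out the kernel.\<close>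

theorem jacobson_radical_eq_kernel:
  fixes A :: "('f::field, 'm) module"
  assumes "ring A"
    and hom: "\<phi> \<in> ring_hom A (direct_power (matrix_algebra Y) Q :: ('f, nat \<Rightarrow> ('i, 'f) matrix) module)"
    and surj: "\<phi> ` carrier A = carrier (direct_power (matrix_algebra Y) Q)"
    and zero: "\<phi> \<zero>\<^bsub>A\<^esub> = \<zero>\<^bsub>direct_power (matrix_algebra Y) Q\<^esub>"
    and Y: "finite Y"
    and van: "product_vanishes A (a_kernel A (direct_power (matrix_algebra Y) Q) \<phi>) t"
  shows "jacobson_radical A = a_kernel A (direct_power (matrix_algebra Y) Q) \<phi>"
proof
  let ?B = "direct_power (matrix_algebra Y) Q :: ('f, nat \<Rightarrow> ('i, 'f) matrix) module"
  have rh: "ring_hom_ring A ?B \<phi>"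
    using assms(1) hom surj zero by (rule ring_hom_ring_surj)
  interpret h: ring_hom_ring A ?B \<phi> by (rule rh)
  show "a_kernel A ?B \<phi> \<subseteq> jacobson_radical A"
    using nil_ideal_subset_maximal_left_ideal[OF assms(1) h.kernel_is_ideal van]
    unfolding jacobson_radical_def a_kernel_def' by blast
  show "jacobson_radical A \<subseteq> a_kernel A ?B \<phi>"
  proof
    fix a assume a: "a \<in> jacobson_radical A"
    then have ac: "a \<in> carrier A" by (simp add: jacobson_radical_def)
    then have \<phi>a: "\<phi> a \<in> carrier ?B" by simp
    have "\<phi> a q i j = 0" if q: "q \<in> {1..Q}" for q i j
    proof (cases "i \<in> Y \<and> j \<in> Y")
      case True
      have "a \<in> {a \<in> carrier A. \<forall>i\<in>Y. \<phi> a q i j = 0}"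
        using a maximal_left_ideal_column[where A = A and \<phi> = \<phi> and Y = Y and Q = Q, OF assms(1) hom surj zero Y q, of j] True
        unfolding jacobson_radical_def by blast
      then show ?thesis using True by auto
    next
      case False
      have "\<phi> a q \<in> carrier (matrix_algebra Y)"
        using \<phi>a q by (auto simp: direct_power_def)
      then show ?thesis using False by (auto simp: matrix_algebra_def)
    qed
    then have "\<phi> a = \<zero>\<^bsub>?B\<^esub>"
      using \<phi>a by (auto simp: direct_power_def matrix_algebra_def fun_eq_iff restrict_def
          PiE_def extensional_def)
    then show "a \<in> a_kernel A ?B \<phi>" using ac unfolding a_kernel_def' by blast
  qed
qed

text \<open>The ring part is the first isomorphism theorem. For the scalars, \<open>\<phi>\<close>
  is constant on cosets, so it maps the union over representatives in the quotient action to a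
  single element.\<close>

lemma quotient_algebra_iso:
  assumes "ring A" "\<phi> \<in> ring_hom A B" "\<phi> ` carrier A = carrier B" "\<phi> \<zero>\<^bsub>A\<^esub> = \<zero>\<^bsub>B\<^esub>"
    and smult: "\<And>c a. a \<in> carrier A \<Longrightarrow> c \<odot>\<^bsub>A\<^esub> a \<in> carrier A"
      "\<And>c a. a \<in> carrier A \<Longrightarrow> \<phi> (c \<odot>\<^bsub>A\<^esub> a) = c \<odot>\<^bsub>B\<^esub> \<phi> a"
  shows "algebra_iso (quotient_algebra A (a_kernel A B \<phi>)) B \<noteq> {}"
proof -
  have rh: "ring_hom_ring A B \<phi>"
    using assms(1-4) by (rule ring_hom_ring_surj)
  interpret h: ring_hom_ring A B \<phi> by (rule rh)
  let ?I = "a_kernel A B \<phi>"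
  interpret I: ideal ?I A by (rule h.kernel_is_ideal)
  let ?\<psi> = "\<lambda>X. the_elem (\<phi> ` X)"
  have coset: "\<phi> b = \<phi> a" if a: "a \<in> carrier A" and b: "b \<in> ?I +>\<^bsub>A\<^esub> a" for a b
  proof -
    obtain k where k: "k \<in> ?I" "b = k \<oplus>\<^bsub>A\<^esub> a"
      using b unfolding a_r_coset_def' by blast
    have kc: "k \<in> carrier A" "\<phi> k = \<zero>\<^bsub>B\<^esub>" using k(1) unfolding a_kernel_def' by blast+
    have "\<phi> b = \<phi> k \<oplus>\<^bsub>B\<^esub> \<phi> a"
      unfolding k(2) using assms(2) kc(1) a by (rule ring_hom_add)
    then show ?thesis using h.S.l_zero[OF h.hom_closed[OF a]] kc(2) by metis
  qed
  have mem: "a \<in> ?I +>\<^bsub>A\<^esub> a" if "a \<in> carrier A" for a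
    using that by (rule I.a_rcos_self)
  have img: "\<phi> ` (?I +>\<^bsub>A\<^esub> a) = {\<phi> a}" if "a \<in> carrier A" for a
    using coset[OF that] mem[OF that] by blast
  have iso: "?\<psi> \<in> ring_iso (A Quot ?I) B" using h.FactRing_iso_set[OF assms(3)] .
  have "?\<psi> (c \<odot>\<^bsub>quotient_algebra A ?I\<^esub> K) = c \<odot>\<^bsub>B\<^esub> ?\<psi> K"
    if K: "K \<in> carrier (quotient_algebra A ?I)" for c K
  proof -
    obtain a where a: "a \<in> carrier A" "K = ?I +>\<^bsub>A\<^esub> a"
      using K by (auto simp: quotient_algebra_def ring.defs FactRing_def A_RCOSETS_def'
          module.defs)
    have Kc: "K \<subseteq> carrier A" using a by (simp add: h.R.a_r_coset_subset_G I.a_subset)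
    have "\<phi> ` (\<Union>b\<in>K. ?I +>\<^bsub>A\<^esub> (c \<odot>\<^bsub>A\<^esub> b)) = (\<Union>b\<in>K. \<phi> ` (?I +>\<^bsub>A\<^esub> (c \<odot>\<^bsub>A\<^esub> b)))"
      by blast
    also have "\<dots> = (\<Union>b\<in>K. {c \<odot>\<^bsub>B\<^esub> \<phi> a})"
    proof (intro SUP_cong refl)
      fix b assume b: "b \<in> K"
      then have "b \<in> carrier A" "\<phi> b = \<phi> a" using Kc a coset by auto
      then show "\<phi> ` (?I +>\<^bsub>A\<^esub> (c \<odot>\<^bsub>A\<^esub> b)) = {c \<odot>\<^bsub>B\<^esub> \<phi> a}"
        using img[OF smult(1)] smult(2) by simp
    qed
    also have "\<dots> = {c \<odot>\<^bsub>B\<^esub> \<phi> a}" using mem a by auto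
    finally show ?thesis
      using img[OF a(1)] a(2) by (simp add: quotient_algebra_def ring.defs module.defs)
  qed
  moreover have "?\<psi> \<in> ring_iso (quotient_algebra A ?I) B"
    using iso by (simp add: quotient_algebra_def ring.defs module.defs ring_iso_def ring_hom_def)
  ultimately have "?\<psi> \<in> algebra_iso (quotient_algebra A ?I) B"
    by (simp add: algebra_iso_def)
  then show ?thesis by blast
qed

section \<open>Matrix arithmetic\<close>

lemma mat_mult_add_left: "mat_mult X (M + M') N = mat_mult X M N + mat_mult X M' N"
  by (simp add: mat_mult_def fun_eq_iff algebra_simps sum.distrib)

lemma mat_mult_add_right: "mat_mult X M (N + N') = mat_mult X M N + mat_mult X M N'"
  by (simp add: mat_mult_def fun_eq_iff algebra_simps sum.distrib)

lemma mat_mult_diff_left: "mat_mult X (M - M') N = mat_mult X M N - mat_mult X M' N"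
  by (simp add: mat_mult_def fun_eq_iff algebra_simps sum_subtractf)

lemma mat_mult_diff_right: "mat_mult X M (N - N') = mat_mult X M N - mat_mult X M N'"
  by (simp add: mat_mult_def fun_eq_iff algebra_simps sum_subtractf)

lemma mat_mult_uminus_left: "mat_mult X (- M) N = - mat_mult X M N"
  by (simp add: mat_mult_def fun_eq_iff sum_negf)

lemma mat_mult_uminus_right: "mat_mult X M (- N) = - mat_mult X M N"
  by (simp add: mat_mult_def fun_eq_iff sum_negf)

lemma mat_scale_apply: "mat_scale c M y z = c * M y z"
  by (simp add: mat_scale_def)

lemma mat_mult_zero_left [simp]: "mat_mult X 0 N = 0"
  by (simp add: mat_mult_def fun_eq_iff)

lemma mat_mult_zero_right [simp]: "mat_mult X M 0 = 0"
  by (simp add: mat_mult_def fun_eq_iff)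

lemma mat_mult_scale_left: "mat_mult X (mat_scale c M) N = mat_scale c (mat_mult X M N)"
  by (simp add: mat_mult_def mat_scale_def fun_eq_iff sum_distrib_left mult.assoc)

lemma mat_mult_scale_right: "mat_mult X M (mat_scale c N) = mat_scale c (mat_mult X M N)"
  by (simp add: mat_mult_def mat_scale_def fun_eq_iff sum_distrib_left mult.left_commute)

lemma mat_mult_assoc: "mat_mult X (mat_mult X L M) N = mat_mult X L (mat_mult X M N)"
  unfolding mat_mult_def
  by (auto simp: fun_eq_iff sum_distrib_left sum_distrib_right mult.assoc intro: sum.swap)

lemma sum_matrix_apply: "(\<Sum>i\<in>I. M i) y z = (\<Sum>i\<in>I. M i y z)" for M :: "_ \<Rightarrow> ('i, 'f::field) matrix"
  by (induction I rule: infinite_finite_induct) auto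

lemma mat_mult_sum_left: "mat_mult X (\<Sum>i\<in>I. M i) N = (\<Sum>i\<in>I. mat_mult X (M i) N)"
  by (auto simp: mat_mult_def fun_eq_iff sum_matrix_apply sum_distrib_right intro: sum.swap)

lemma mat_mult_span:
  assumes "\<And>M N. M \<in> A \<Longrightarrow> N \<in> B \<Longrightarrow> mat_mult X M N \<in> mat_space.span C"
    and "M \<in> mat_space.span A" "N \<in> mat_space.span B"
  shows "mat_mult X M N \<in> mat_space.span C"
  using assms(2)
proof (induction rule: mat_space.span_induct)
  case base
  show ?case
    by (auto simp: mat_space.subspace_def mat_mult_add_left mat_mult_scale_left
        intro: mat_space.span_add mat_space.span_scale mat_space.span_zero)
next
  case (step M)
  show ?case using assms(3)
  proof (induction rule: mat_space.span_induct)
    case base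
    show ?case
      by (auto simp: mat_space.subspace_def mat_mult_add_right mat_mult_scale_right
          intro: mat_space.span_add mat_space.span_scale mat_space.span_zero)
  next
    case (step N)
    then show ?case using assms(1) \<open>M \<in> A\<close> by simp
  qed
qed

text \<open>The family \<open>F\<close> acts as a dual basis up to nonzero factors. Injectivity of
  \<open>v\<close> comes along and later turns the size of an index set into a dimension.\<close>

lemma independent_by_functionals:
  fixes v :: "'k \<Rightarrow> ('i, 'f::field) matrix"
  assumes "finite K"
    and lin: "\<And>l c J. l \<in> K \<Longrightarrow> finite J \<Longrightarrow> J \<subseteq> K \<Longrightarrow>
      F l (\<Sum>j\<in>J. mat_scale (c j) (v j)) = (\<Sum>j\<in>J. c j * F l (v j))"
    and diag: "\<And>l. l \<in> K \<Longrightarrow> F l (v l) \<noteq> 0"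
    and off: "\<And>l m. l \<in> K \<Longrightarrow> m \<in> K \<Longrightarrow> l \<noteq> m \<Longrightarrow> F l (v m) = 0"
  shows "inj_on v K" and "mat_space.independent (v ` K)"
proof -
  show inj: "inj_on v K" using diag off by (metis inj_onI)
  show "mat_space.independent (v ` K)"
    unfolding mat_space.dependent_finite[OF finite_imageI[OF assms(1)]]
  proof (intro notI, elim exE conjE bexE)
    fix u w assume w: "w \<in> v ` K" "u w \<noteq> 0" and 0: "(\<Sum>w\<in>v ` K. mat_scale (u w) w) = 0"
    then obtain l where l: "l \<in> K" "w = v l" by auto
    have F0: "F l 0 = 0" using lin[OF l(1), of "{}"] by simp
    have "0 = F l (\<Sum>j\<in>K. mat_scale (u (v j)) (v j))"
      using 0 F0 by (simp add: sum.reindex[OF inj])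
    also have "\<dots> = (\<Sum>j\<in>K. u (v j) * F l (v j))" using lin l(1) assms(1) by simp
    also have "\<dots> = (\<Sum>j\<in>K. if j = l then u (v l) * F l (v l) else 0)"
      using off l(1) by (intro sum.cong) auto
    also have "\<dots> = u w * F l (v l)" using l assms(1) by (simp add: sum.delta)
    finally show False using diag l(1) w(2) by simp
  qed
qed

section \<open>Tensor products of matrices\<close>

definition tens :: "nat \<Rightarrow> (nat \<Rightarrow> 'u set) \<Rightarrow> (nat \<Rightarrow> ('u, 'f::field) matrix) \<Rightarrow> (nat \<Rightarrow> 'u, 'f) matrix"
  where "tens n U f = (\<lambda>y z. if y \<in> points n U \<and> z \<in> points n U
    then \<Prod>i\<in>{1..n}. f i (y i) (z i) else 0)"

lemma finite_points: "\<forall>a\<in>{1..n}. finite (U a) \<Longrightarrow> finite (points n U)"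
  unfolding points_def by (intro finite_PiE) auto

lemma tens_cong:
  assumes "\<And>i. i \<in> {1..n} \<Longrightarrow> f i = g i"
  shows "tens n U f = tens n U g"
  using assms by (auto simp: tens_def fun_eq_iff intro!: prod.cong)

lemma tens_eqI:
  assumes "\<And>y z. \<not> (y \<in> points n U \<and> z \<in> points n U) \<Longrightarrow> M y z = 0"
    and "\<And>y z. y \<in> points n U \<Longrightarrow> z \<in> points n U \<Longrightarrow> M y z = (\<Prod>i\<in>{1..n}. f i (y i) (z i))"
  shows "M = tens n U f"
  using assms by (auto simp: tens_def fun_eq_iff)

lemma tens_zero:
  assumes "i \<in> {1..n}" "f i = 0"
  shows "tens n U f = 0"
  using assms by (force simp: tens_def fun_eq_iff intro!: prod_zero bexI[of _ i])

lemma tens_mult: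
  assumes "\<forall>a\<in>{1..n}. finite (U a)"
  shows "mat_mult (points n U) (tens n U f) (tens n U g) =
    tens n U (\<lambda>i. mat_mult (U i) (f i) (g i))"
proof (rule tens_eqI)
  fix y z :: "nat \<Rightarrow> 'a" assume yz: "y \<in> points n U" "z \<in> points n U"
  have "mat_mult (points n U) (tens n U f) (tens n U g) y z =
      (\<Sum>w\<in>points n U. \<Prod>i\<in>{1..n}. f i (y i) (w i) * g i (w i) (z i))"
    unfolding mat_mult_def using yz by (intro sum.cong) (auto simp: tens_def prod.distrib)
  also have "\<dots> = (\<Prod>i\<in>{1..n}. mat_mult (U i) (f i) (g i) (y i) (z i))"
    unfolding mat_mult_def points_def using assms by (subst prod_sum_PiE) auto
  finally show "mat_mult (points n U) (tens n U f) (tens n U g) y z =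
    (\<Prod>i\<in>{1..n}. mat_mult (U i) (f i) (g i) (y i) (z i))" .
qed (auto simp: mat_mult_def tens_def)

lemma tens_scale:
  "mat_scale (\<Prod>i\<in>{1..n}. c i) (tens n U f) = tens n U (\<lambda>i. mat_scale (c i) (f i))"
  by (auto simp: tens_def mat_scale_def fun_eq_iff prod.distrib)

lemma tens_sum_PiE:
  assumes "\<And>i. i \<in> {1..n} \<Longrightarrow> finite (K i)"
  shows "tens n U (\<lambda>i. \<Sum>t\<in>K i. mat_scale (c i t) (f i t)) =
    (\<Sum>l\<in>PiE {1..n} K. mat_scale (\<Prod>i\<in>{1..n}. c i (l i)) (tens n U (\<lambda>i. f i (l i))))"
proof (rule sym, rule tens_eqI)
  fix y z assume yz: "y \<in> points n U" "z \<in> points n U"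
  have "(\<Prod>i\<in>{1..n}. (\<Sum>t\<in>K i. mat_scale (c i t) (f i t)) (y i) (z i)) =
      (\<Sum>l\<in>PiE {1..n} K. \<Prod>i\<in>{1..n}. mat_scale (c i (l i)) (f i (l i)) (y i) (z i))"
    unfolding sum_matrix_apply using assms by (subst prod_sum_PiE) auto
  also have "\<dots> = (\<Sum>l\<in>PiE {1..n} K. mat_scale (\<Prod>i\<in>{1..n}. c i (l i)) (tens n U (\<lambda>i. f i (l i)))) y z"
    unfolding sum_matrix_apply using yz
    by (intro sum.cong) (auto simp: tens_def mat_scale_def prod.distrib)
  finally show "(\<Sum>l\<in>PiE {1..n} K. mat_scale (\<Prod>i\<in>{1..n}. c i (l i)) (tens n U (\<lambda>i. f i (l i)))) y z =
    (\<Prod>i\<in>{1..n}. (\<Sum>t\<in>K i. mat_scale (c i t) (f i t)) (y i) (z i))" by simp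
qed (auto simp: sum_matrix_apply tens_def mat_scale_def)

text \<open>A sum over subsets of \<open>V\<close> is one tensor product whose factors at
  \<open>V\<close> are sums of two terms. Both the alternating sum in \<open>DD\<close> and the sum
  over a class in \<open>block_idem\<close> collapse this way.\<close>

lemma tens_add_Pow:
  assumes "V \<subseteq> {1..n}"
  shows "tens n U (\<lambda>i. if i \<in> V then f i + g i else h i) =
    (\<Sum>Q\<in>Pow V. tens n U (\<lambda>i. if i \<in> V then if i \<in> Q then f i else g i else h i))"
proof (rule sym, rule tens_eqI)
  fix y z assume yz: "y \<in> points n U" "z \<in> points n U"
  have fV: "finite V" using assms finite_subset by blast
  have split: "(\<Prod>i\<in>{1..n}. F i) = (\<Prod>i\<in>V. F i) * (\<Prod>i\<in>{1..n} - V. F i)" for F :: "nat \<Rightarrow> 'b"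
    using assms by (simp add: mult.commute prod.subset_diff)
  have "(\<Sum>Q\<in>Pow V. tens n U (\<lambda>i. if i \<in> V then if i \<in> Q then f i else g i else h i)) y z =
    (\<Sum>Q\<in>Pow V. (\<Prod>i\<in>Q. f i (y i) (z i)) * (\<Prod>i\<in>V - Q. g i (y i) (z i)) *
        (\<Prod>i\<in>{1..n} - V. h i (y i) (z i)))"
    unfolding sum_matrix_apply
  proof (intro sum.cong refl)
    fix Q assume Q: "Q \<in> Pow V"
    have "(\<Prod>i\<in>V. (if i \<in> V then if i \<in> Q then f i else g i else h i) (y i) (z i)) =
        (\<Prod>i\<in>V. if i \<in> Q then f i (y i) (z i) else g i (y i) (z i))"
      by (intro prod.cong) auto
    also have "\<dots> = (\<Prod>i\<in>Q. f i (y i) (z i)) * (\<Prod>i\<in>V - Q. g i (y i) (z i))"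
      using Q fV by (simp add: prod.If_cases Int_absorb1 Diff_eq Collect_mem_eq)
    finally show "tens n U (\<lambda>i. if i \<in> V then if i \<in> Q then f i else g i else h i) y z =
      (\<Prod>i\<in>Q. f i (y i) (z i)) * (\<Prod>i\<in>V - Q. g i (y i) (z i)) *
        (\<Prod>i\<in>{1..n} - V. h i (y i) (z i))"
      using yz split[of "\<lambda>i. (if i \<in> V then if i \<in> Q then f i else g i else h i) (y i) (z i)"]
      by (simp add: tens_def)
  qed
  also have "\<dots> = (\<Prod>i\<in>V. f i (y i) (z i) + g i (y i) (z i)) * (\<Prod>i\<in>{1..n} - V. h i (y i) (z i))"
    by (subst prod_add[OF fV]) (simp add: sum_distrib_right)
  also have "\<dots> = (\<Prod>i\<in>{1..n}. (if i \<in> V then f i + g i else h i) (y i) (z i))"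
    unfolding split by (intro arg_cong2[where f = "(*)"] prod.cong) auto
  finally show "(\<Sum>Q\<in>Pow V. tens n U (\<lambda>i. if i \<in> V then if i \<in> Q then f i else g i else h i)) y z =
    (\<Prod>i\<in>{1..n}. (if i \<in> V then f i + g i else h i) (y i) (z i))" .
qed (auto simp: sum_matrix_apply tens_def)

lemma tens_in_span:
  assumes K: "\<And>i. i \<in> {1..n} \<Longrightarrow> finite (K i)"
    and f: "\<And>i. i \<in> {1..n} \<Longrightarrow> f i \<in> mat_space.span (K i)"
    and B: "\<And>g. (\<And>i. i \<in> {1..n} \<Longrightarrow> g i \<in> K i) \<Longrightarrow> tens n U g \<in> mat_space.span B"
  shows "tens n U f \<in> mat_space.span B"
proof -
  have "\<exists>u. f i = (\<Sum>v\<in>K i. mat_scale (u v) v)" if "i \<in> {1..n}" for i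
    using f[OF that] unfolding mat_space.span_finite[OF K[OF that]] by auto
  then obtain u where u: "\<And>i. i \<in> {1..n} \<Longrightarrow> f i = (\<Sum>v\<in>K i. mat_scale (u i v) v)"
    by metis
  have "tens n U f = tens n U (\<lambda>i. \<Sum>v\<in>K i. mat_scale (u i v) v)"
    using u by (rule tens_cong)
  also have "\<dots> = (\<Sum>g\<in>PiE {1..n} K. mat_scale (\<Prod>i\<in>{1..n}. u i (g i)) (tens n U g))"
    using K by (rule tens_sum_PiE)
  also have "\<dots> \<in> mat_space.span B"
    by (intro mat_space.span_sum mat_space.span_scale B) (auto simp: PiE_def)
  finally show ?thesis .
qed

text \<open>The bilinear pairing with a pure tensor. It is defined on all matrices, which makes
  linearity immediate, and on pure tensors it factorises.\<close>

definition tens_pairing :: "nat \<Rightarrow> (nat \<Rightarrow> 'u set) \<Rightarrow> (nat \<Rightarrow> ('u, 'f::field) matrix) \<Rightarrow>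
    (nat \<Rightarrow> 'u, 'f) matrix \<Rightarrow> 'f" where
  "tens_pairing n U d M =
    (\<Sum>y\<in>points n U. \<Sum>z\<in>points n U. (\<Prod>i\<in>{1..n}. d i (y i) (z i)) * M y z)"

lemma tens_pairing_tens:
  assumes "\<forall>a\<in>{1..n}. finite (U a)"
  shows "tens_pairing n U d (tens n U f) =
    (\<Prod>i\<in>{1..n}. \<Sum>y\<in>U i. \<Sum>z\<in>U i. d i y z * f i y z)"
proof -
  have "tens_pairing n U d (tens n U f) =
      (\<Sum>y\<in>points n U. \<Sum>z\<in>points n U. \<Prod>i\<in>{1..n}. d i (y i) (z i) * f i (y i) (z i))"
    unfolding tens_pairing_def by (intro sum.cong) (auto simp: tens_def prod.distrib)
  also have "\<dots> = (\<Sum>y\<in>points n U. \<Prod>i\<in>{1..n}. \<Sum>z\<in>U i. d i (y i) z * f i (y i) z)"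
    unfolding points_def using assms by (intro sum.cong refl, subst prod_sum_PiE) auto
  also have "\<dots> = (\<Prod>i\<in>{1..n}. \<Sum>y\<in>U i. \<Sum>z\<in>U i. d i y z * f i y z)"
    unfolding points_def using assms by (subst prod_sum_PiE) auto
  finally show ?thesis .
qed

lemma tens_pairing_add: "tens_pairing n U d (M + N) = tens_pairing n U d M + tens_pairing n U d N"
  by (simp add: tens_pairing_def algebra_simps sum.distrib)

lemma tens_pairing_scale: "tens_pairing n U d (mat_scale c M) = c * tens_pairing n U d M"
  by (simp add: tens_pairing_def mat_scale_def sum_distrib_left mult.left_commute)

lemma tens_pairing_sum:
  "tens_pairing n U d (\<Sum>i\<in>I. M i) = (\<Sum>i\<in>I. tens_pairing n U d (M i))"
proof (induction I rule: infinite_finite_induct)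
  case (insert i I)
  then show ?case by (metis sum.insert tens_pairing_add)
qed (simp_all add: tens_pairing_def)

text \<open>Blocks relative to the base point \<open>e\<close>: \<open>True\<close> for
  \<open>r\<close> or \<open>s\<close> means its complement, and \<open>t\<close> separates all ones
  from the diagonal. With \<open>r\<close>, \<open>t\<close>, \<open>s\<close> as membership of i in
  a, b, c these are the local factors of B_{a,b,c}.\<close>

definition block_mat :: "'u set \<Rightarrow> 'u \<Rightarrow> bool \<Rightarrow> bool \<Rightarrow> bool \<Rightarrow> ('u, 'f::field) matrix" where
  "block_mat V e r t s = (\<lambda>y z. of_bool (y \<in> V \<and> z \<in> V \<and> (y \<noteq> e \<longleftrightarrow> r) \<and> (z \<noteq> e \<longleftrightarrow> s) \<and> (t \<or> y = z)))"

lemma block_mat_apply: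
  "block_mat V e r t s y z =
    of_bool (y \<in> V \<and> z \<in> V \<and> (y \<noteq> e \<longleftrightarrow> r) \<and> (z \<noteq> e \<longleftrightarrow> s) \<and> (t \<or> y = z))"
  by (simp add: block_mat_def)

lemma block_mat_zero: "r \<noteq> s \<Longrightarrow> block_mat V e r False s = 0"
  by (auto simp: block_mat_def fun_eq_iff)

lemma block_mat_base: "block_mat V e False t False = block_mat V e False True False"
  by (auto simp: block_mat_def fun_eq_iff)

lemma block_mat_mult_mismatch: "s \<noteq> s' \<Longrightarrow> mat_mult V (block_mat V e r t s) (block_mat V e s' t' r') = 0"
  by (auto simp: block_mat_def mat_mult_def fun_eq_iff intro!: sum.neutral)

lemma block_mat_mult_ones:
  fixes V :: "'u set"
  assumes "finite V" "e \<in> V"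
  shows "mat_mult V (block_mat V e r True s) (block_mat V e s True r') =
    mat_scale (if s then of_nat (card V - 1) else 1) (block_mat V e r True r' :: ('u, 'f::field) matrix)"
proof (intro ext)
  fix y z
  have "mat_mult V (block_mat V e r True s) (block_mat V e s True r') y z =
      (\<Sum>w\<in>V. of_bool (w \<noteq> e \<longleftrightarrow> s) * (block_mat V e r True r' y z :: 'f))"
    unfolding mat_mult_def by (intro sum.cong) (auto simp: block_mat_def)
  also have "\<dots> = of_nat (card (V \<inter> {w. w \<noteq> e \<longleftrightarrow> s})) * block_mat V e r True r' y z"
    using assms by (simp add: sum_distrib_right[symmetric] of_bool_def sum.If_cases)
  also have "V \<inter> {w. w \<noteq> e \<longleftrightarrow> s} = (if s then V - {e} else {e})" using assms by auto
  also have "(of_nat (card (if s then V - {e} else {e})) :: 'f) = (if s then of_nat (card V - 1) else 1)"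
    using assms by simp
  finally show "mat_mult V (block_mat V e r True s) (block_mat V e s True r') y z =
    mat_scale (if s then of_nat (card V - 1) else 1) (block_mat V e r True r' :: ('u, 'f) matrix) y z"
    by (cases s) (simp_all add: mat_scale_def)
qed

lemma block_mat_id_left:
  assumes "finite V"
  shows "mat_mult V (block_mat V e r False r) (block_mat V e r t s) = block_mat V e r t s"
proof (intro ext)
  fix y z
  have "mat_mult V (block_mat V e r False r) (block_mat V e r t s) y z =
      (\<Sum>w\<in>V. if w = y then block_mat V e r t s y z else 0)"
    unfolding mat_mult_def by (intro sum.cong) (auto simp: block_mat_def)
  then show "mat_mult V (block_mat V e r False r) (block_mat V e r t s) y z = block_mat V e r t s y z"
    using assms by (auto simp: sum.delta block_mat_def)
qed

lemma block_mat_id_right: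
  assumes "finite V"
  shows "mat_mult V (block_mat V e r t s) (block_mat V e s False s) = block_mat V e r t s"
proof (intro ext)
  fix y z
  have "mat_mult V (block_mat V e r t s) (block_mat V e s False s) y z =
      (\<Sum>w\<in>V. if w = z then block_mat V e r t s y z else 0)"
    unfolding mat_mult_def by (intro sum.cong) (auto simp: block_mat_def)
  then show "mat_mult V (block_mat V e r t s) (block_mat V e s False s) y z = block_mat V e r t s y z"
    using assms by (auto simp: sum.delta block_mat_def)
qed


section \<open>Local factors\<close>

type_synonym label = "bool \<times> bool \<times> bool"

text \<open>The parameter \<open>ty\<close> only fixes the field; \<open>S\<close> is the value of \<open>a\<^sup>- - b\<close> on the class.\<close>

locale factorial_block =
  fixes ty :: "'f::field itself" and p n :: nat and U :: "nat \<Rightarrow> 'u set" and x :: "nat \<Rightarrow> 'u"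
    and S :: "nat set"
  assumes p: "p = CHAR('f)"
    and U: "\<forall>a\<in>{1..n}. finite (U a) \<and> card (U a) \<ge> 2"
    and x: "x \<in> points n U"
    and S: "S \<subseteq> minus_part p U {1..n}"
begin

abbreviation X where "X \<equiv> points n U"
abbreviation P where "P \<equiv> plus_part p U {1..n}"

definition val :: "nat \<Rightarrow> 'f" where "val i = of_nat (card (U i) - 1)"

lemma val_eq_0_iff: "val i = 0 \<longleftrightarrow> p dvd card (U i) - 1"
  by (simp add: val_def p of_nat_eq_0_iff_char_dvd)

lemma P_iff: "i \<in> P \<longleftrightarrow> i \<in> {1..n} \<and> val i = 0"
  by (auto simp: plus_part_def val_eq_0_iff)

lemma S_sub: "S \<subseteq> {1..n}" and S_val: "i \<in> S \<Longrightarrow> val i \<noteq> 0" and S_card: "i \<in> S \<Longrightarrow> card (U i) \<noteq> 2"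
  using S by (auto simp: minus_part_def val_eq_0_iff)

lemma S_P: "S \<inter> P = {}"
  using S_val P_iff by auto

lemma fin: "i \<in> {1..n} \<Longrightarrow> finite (U i)"
  using U by auto

lemma finU: "\<forall>a\<in>{1..n}. finite (U a)"
  using U by auto

lemma base: "i \<in> {1..n} \<Longrightarrow> x i \<in> U i"
  using x by (auto simp: points_def)

lemma p_ne_1: "p \<noteq> 1"
  by (simp add: p)

text \<open>On \<open>S\<close> size two is excluded by definition; on \<open>P\<close> it would
  mean that \<open>p\<close> divides 1. The third point provides an off-diagonal entry on the
  complement of the base point.\<close>

lemma card_ge_3:
  assumes "i \<in> S \<or> i \<in> P"
  shows "card (U i) \<ge> 3"
proof -
  have i: "i \<in> {1..n}" and "card (U i) \<noteq> 2"
    using assms S_sub S_card p_ne_1 by (auto simp: plus_part_def)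
  moreover have "card (U i) \<ge> 2" using U i by auto
  ultimately show ?thesis by linarith
qed

lemma ex_points:
  assumes "i \<in> {1..n}"
  shows "\<exists>s s'. s \<in> U i \<and> s' \<in> U i \<and> s \<noteq> x i \<and> s' \<noteq> x i \<and> (i \<in> S \<or> i \<in> P \<longrightarrow> s \<noteq> s')"
proof (cases "i \<in> S \<or> i \<in> P")
  case True
  have "card (U i - {x i}) \<ge> 2" using card_ge_3[OF True] base[OF assms] fin[OF assms] by simp
  then obtain s s' where "s \<in> U i - {x i}" "s' \<in> U i - {x i}" "s \<noteq> s'"
    by (metis card_le_Suc0_iff_eq card.infinite not_less_eq_eq numeral_2_eq_2 zero_le)
  then show ?thesis by auto
next
  case False
  have "card (U i) \<ge> 2" using U assms by auto
  then have "card (U i - {x i}) \<ge> 1" using base[OF assms] fin[OF assms] by simp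
  then have "U i - {x i} \<noteq> {}" by (intro notI) simp
  then show ?thesis using False by auto
qed

text \<open>The choice of the first point already demands a second one, so that \<open>pt'\<close>
  can be chosen afterwards. Matrix entries at these points serve as coordinates.\<close>

definition pt :: "nat \<Rightarrow> bool \<Rightarrow> 'u" where
  "pt i r = (if r then SOME s. \<exists>s'. s \<in> U i \<and> s' \<in> U i \<and> s \<noteq> x i \<and> s' \<noteq> x i \<and> (i \<in> S \<or> i \<in> P \<longrightarrow> s \<noteq> s')
    else x i)"

definition pt' :: "nat \<Rightarrow> 'u" where
  "pt' i = (SOME s'. s' \<in> U i \<and> s' \<noteq> x i \<and> (i \<in> S \<or> i \<in> P \<longrightarrow> pt i True \<noteq> s'))"

lemma pt:
  assumes "i \<in> {1..n}"
  shows "pt i r \<in> U i" "pt i r \<noteq> x i \<longleftrightarrow> r" "pt' i \<in> U i" "pt' i \<noteq> x i"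
    "i \<in> S \<or> i \<in> P \<Longrightarrow> pt i True \<noteq> pt' i"
proof -
  have ex: "\<exists>s'. pt i True \<in> U i \<and> s' \<in> U i \<and> pt i True \<noteq> x i \<and> s' \<noteq> x i \<and> (i \<in> S \<or> i \<in> P \<longrightarrow> pt i True \<noteq> s')"
    unfolding pt_def if_True by (rule someI_ex[OF ex_points[OF assms]])
  then show "pt i r \<in> U i" "pt i r \<noteq> x i \<longleftrightarrow> r"
    using base[OF assms] by (cases r; auto simp: pt_def)+
  have "\<exists>s'. s' \<in> U i \<and> s' \<noteq> x i \<and> (i \<in> S \<or> i \<in> P \<longrightarrow> pt i True \<noteq> s')" using ex by blast
  from someI_ex[OF this] show "pt' i \<in> U i" "pt' i \<noteq> x i"
    "i \<in> S \<or> i \<in> P \<Longrightarrow> pt i True \<noteq> pt' i" unfolding pt'_def[symmetric] by auto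
qed

abbreviation G :: "nat \<Rightarrow> bool \<Rightarrow> bool \<Rightarrow> bool \<Rightarrow> ('u, 'f) matrix" where
  "G i \<equiv> block_mat (U i) (x i)"

text \<open>
  A label \<open>(r, t, s)\<close> names a basis element of a local factor: \<open>r\<close> and \<open>s\<close> say whether
  rows and columns avoid the base point, and \<open>t\<close> distinguishes the all-ones block from the
  identity in the case \<open>i \<in> P\<close>; otherwise \<open>t\<close> is \<open>False\<close>.
\<close>

definition Lab :: "nat \<Rightarrow> label set" where
  "Lab i = (if i \<in> S then {(True, False, True)}
    else if i \<in> P then {(r, t, s). t \<longrightarrow> r \<and> s} else {(r, t, s). \<not> t})"

text \<open>Outside \<open>S\<close> and \<open>P\<close> the factor 1/k on the column index makes
  the blocks of ones into matrix units: a middle sum over the complement yields a k that cancels one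
  1/k. In \<open>P\<close> an off-diagonal label has \<open>t\<close> false but means the block of
  ones, as the identity pattern is zero there.\<close>

fun loc :: "nat \<Rightarrow> label \<Rightarrow> ('u, 'f) matrix" where
  "loc i (r, t, s) =
    (if i \<in> S then G i True False True - mat_scale (inverse (val i)) (G i True True True)
     else if i \<in> P then G i r (t \<or> r \<noteq> s) s
     else mat_scale (if s then inverse (val i) else 1) (G i r True s))"

text \<open>For i in \<open>P\<close> a middle sum over the complement gives k = 0, unless one of
  the factors is the identity block (True, False, True).\<close>

fun compat :: "nat \<Rightarrow> label \<Rightarrow> label \<Rightarrow> bool" where
  "compat i (r, t, s) (r', t', s') \<longleftrightarrow> s = r' \<and> (i \<in> P \<and> s \<longrightarrow> (\<not> t \<and> r) \<or> (\<not> t' \<and> s'))"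

text \<open>For i in \<open>P\<close> the block of ones on the complement arises when a factor
  already is this block or when the product passes through the base point.\<close>

fun lcomp :: "nat \<Rightarrow> label \<Rightarrow> label \<Rightarrow> label" where
  "lcomp i (r, t, s) (r', t', s') = (r, i \<in> P \<and> r \<and> s' \<and> (t \<or> t' \<or> \<not> s), s')"

fun ldeg :: "nat \<Rightarrow> label \<Rightarrow> nat" where
  "ldeg i (r, t, s) = (if i \<in> P then if t then 2 else of_bool (r \<noteq> s) else 0)"

lemma lcomp_Lab: "l \<in> Lab i \<Longrightarrow> m \<in> Lab i \<Longrightarrow> compat i l m \<Longrightarrow> lcomp i l m \<in> Lab i"
  using S_P by (cases l; cases m) (auto simp: Lab_def split: if_splits)

lemma ldeg_lcomp:
  "l \<in> Lab i \<Longrightarrow> m \<in> Lab i \<Longrightarrow> compat i l m \<Longrightarrow> ldeg i (lcomp i l m) = ldeg i l + ldeg i m"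
  using S_P by (cases l; cases m) (auto simp: Lab_def split: if_splits)

lemma ldeg_le: "ldeg i l \<le> (if i \<in> P then 2 else 0)"
  by (cases l) auto

lemma finite_Lab: "finite (Lab i)"
  by (rule finite_subset[OF subset_UNIV]) simp

text \<open>No scalar occurs: a product of two basis elements is a basis element or zero. From here
  on multiplication is combinatorics of labels.\<close>

lemma loc_mult:
  assumes i: "i \<in> {1..n}" and "l \<in> Lab i" "m \<in> Lab i"
  shows "mat_mult (U i) (loc i l) (loc i m) = (if compat i l m then loc i (lcomp i l m) else 0)"
proof -
  note mults = block_mat_mult_ones[OF fin[OF i] base[OF i]] block_mat_id_left[OF fin[OF i]]
    block_mat_id_right[OF fin[OF i]] block_mat_mult_mismatch
  obtain r t s r' t' s' where lm: "l = (r, t, s)" "m = (r', t', s')" by (cases l; cases m)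
  consider "i \<in> S" "i \<notin> P" | "i \<notin> S" "i \<in> P" | "i \<notin> S" "i \<notin> P" using S_P by auto
  then show ?thesis
  proof cases
    case 1
    then have "val i \<noteq> 0" using S_val by auto
    then have "inverse (val i) * of_nat (card (U i) - Suc 0) = 1" by (simp add: val_def)
    moreover have "l = (True, False, True)" "m = (True, False, True)"
      using 1 assms by (auto simp: Lab_def)
    moreover have "mat_scale 1 A = A" for A :: "('u, 'f) matrix"
      by (simp add: mat_scale_def)
    ultimately show ?thesis
      using 1 by (simp add: mat_mult_diff_left mat_mult_diff_right mat_mult_scale_left
          mat_mult_scale_right mults)
  next
    case 2
    then have "val i = 0" using P_iff by auto
    then have v: "of_nat (card (U i) - Suc 0) = (0 :: 'f)" by (simp add: val_def)
    have z: "mat_scale 0 A = 0" "mat_scale 1 A = A" for A :: "('u, 'f) matrix"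
      by (simp_all add: mat_scale_def fun_eq_iff)
    have t: "t \<longrightarrow> r \<and> s" "t' \<longrightarrow> r' \<and> s'" using assms 2 by (auto simp: Lab_def lm)
    consider "s \<noteq> r'" | "s = r'" "\<not> t \<and> r = s" | "s = r'" "\<not> t' \<and> r' = s'"
      | "s = r'" "t \<or> r \<noteq> s" "t' \<or> r' \<noteq> s'" by blast
    then show ?thesis
    proof cases
      case 1
      then show ?thesis using 2 unfolding lm by (simp add: block_mat_mult_mismatch)
    next
      case a: 2
      have "G i s t' s' = G i s (s \<and> s' \<and> t') s'" if "s = s'"
        using that t a(1) block_mat_base by (cases s) auto
      then show ?thesis using 2 a t unfolding lm
        by (cases s; cases s'; simp add: block_mat_id_left[OF fin[OF i]])
    next
      case a: 3
      have "G i r t s = G i r (r \<and> s \<and> t) s" if "r = s"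
        using that t a(1) block_mat_base by (cases s) auto
      then show ?thesis using 2 a t unfolding lm
        by (cases r; cases s; simp add: block_mat_id_right[OF fin[OF i]])
    next
      case a: 4
      show ?thesis
      proof (cases s)
        case True
        then show ?thesis using 2 a t unfolding lm
          by (auto simp add: block_mat_mult_ones[OF fin[OF i] base[OF i]] v z)
      next
        case False
        then show ?thesis using 2 a t unfolding lm
          by (auto simp add: block_mat_mult_ones[OF fin[OF i] base[OF i]] v z)
      qed
    qed
  next
    case 3
    then have v: "val i \<noteq> 0" using P_iff i by auto
    have t: "\<not> t" "\<not> t'" using assms 3 by (auto simp: Lab_def lm)
    have v': "of_nat (card (U i) - Suc 0) = val i" by (simp add: val_def)
    show ?thesis
    proof (cases "s = r'")
      case True
      then show ?thesis using 3 v t unfolding lm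
        by (cases s; cases s'; simp add: block_mat_mult_ones[OF fin[OF i] base[OF i]]
            mat_mult_scale_left mat_mult_scale_right v')
    next
      case False
      then show ?thesis using 3 unfolding lm
        by (simp add: block_mat_mult_mismatch mat_mult_scale_left mat_mult_scale_right)
    qed
  qed
qed

section \<open>Dual functionals for the local bases\<close>

definition unit :: "'u \<Rightarrow> 'u \<Rightarrow> ('u, 'f) matrix" where
  "unit a b = (\<lambda>y z. of_bool (y = a \<and> z = b))"

text \<open>In \<open>P\<close> identity and block of ones agree on the diagonal of the complement
  and only the latter has off-diagonal entries, so a difference of two entries isolates the
  identity. In \<open>S\<close> the off-diagonal entry of I - J/k is -1/k. Elsewhere k undoes the
  normalisation of \<open>loc\<close>.\<close>

fun dual :: "nat \<Rightarrow> label \<Rightarrow> ('u, 'f) matrix" where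
  "dual i (r, t, s) =
    (if i \<in> S then mat_scale (- val i) (unit (pt i True) (pt' i))
     else if i \<in> P then if t then unit (pt i True) (pt' i)
       else unit (pt i r) (pt i s) - (if r \<and> s then unit (pt i True) (pt' i) else 0)
     else mat_scale (if s then val i else 1) (unit (pt i r) (pt i s)))"

definition lpair :: "nat \<Rightarrow> ('u, 'f) matrix \<Rightarrow> ('u, 'f) matrix \<Rightarrow> 'f" where
  "lpair i d f = (\<Sum>y\<in>U i. \<Sum>z\<in>U i. d y z * f y z)"

lemma lpair_unit:
  assumes "i \<in> {1..n}" "a \<in> U i" "b \<in> U i"
  shows "lpair i (unit a b) f = f a b"
proof -
  have "lpair i (unit a b) f = (\<Sum>y\<in>U i. if y = a then \<Sum>z\<in>U i. if z = b then f a b else 0 else 0)"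
    unfolding lpair_def unit_def by (auto intro!: sum.cong sum.neutral)
  then show ?thesis using assms fin by (simp add: sum.delta)
qed

lemma lpair_linear:
  "lpair i (mat_scale c d) f = c * lpair i d f"
  "lpair i (d - d') f = lpair i d f - lpair i d' f"
  "lpair i (- d) f = - lpair i d f"
  "lpair i 0 f = 0"
  by (simp_all add: lpair_def mat_scale_def algebra_simps sum_subtractf sum_negf sum_distrib_left)

lemma lpair_dual_loc:
  assumes i: "i \<in> {1..n}" and l: "l \<in> Lab i" and m: "m \<in> Lab i"
  shows "lpair i (dual i l) (loc i m) = of_bool (l = m)"
proof -
  note pts = pt[OF i]
  note lp = lpair_linear lpair_unit[OF i pts(1) pts(1)] lpair_unit[OF i pts(1) pts(3)]
  obtain r t s r' t' s' where lm: "l = (r, t, s)" "m = (r', t', s')" by (cases l; cases m)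
  consider "i \<in> S" "i \<notin> P" | "i \<notin> S" "i \<in> P" | "i \<notin> S" "i \<notin> P" using S_P by auto
  then show ?thesis
  proof cases
    case 1
    then have "val i \<noteq> 0" using S_val by auto
    moreover have "l = (True, False, True)" "m = (True, False, True)"
      using 1 assms by (auto simp: Lab_def)
    ultimately show ?thesis
      using 1 pts by (simp add: lp block_mat_apply mat_scale_apply)
  next
    case 2
    have t: "t \<longrightarrow> r \<and> s" "t' \<longrightarrow> r' \<and> s'" using assms 2 by (auto simp: Lab_def lm)
    show ?thesis
      using 2 t pts unfolding lm
      by (cases r; cases s; cases t; cases r'; cases s'; cases t'; auto simp add: lp block_mat_apply)
  next
    case 3
    then have v: "val i \<noteq> 0" using P_iff i by auto
    have t: "\<not> t" "\<not> t'" using assms 3 by (auto simp: Lab_def lm)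
    show ?thesis
      using 3 v t pts unfolding lm
      by (auto simp add: lp block_mat_apply mat_scale_apply)
  qed
qed


subsection \<open>The graded block algebra\<close>

text \<open>The local factor of the block idempotent. Away from \<open>P\<close> the identity on U_i
  is the sum of E_0 + J/k and I - J/k, with E_0 the idempotent at the base point, and the block
  selects the latter exactly on \<open>S\<close>.\<close>

definition idm :: "nat \<Rightarrow> ('u, 'f) matrix" where
  "idm i = (if i \<in> S then G i True False True - mat_scale (inverse (val i)) (G i True True True)
    else if i \<in> P then G i False True False + G i True False True
    else G i False True False + mat_scale (inverse (val i)) (G i True True True))"

text \<open>The component of a block in the local algebra, see \<open>block_idm\<close>. Outside
  \<open>P\<close> the idempotent turns I on the complement into I - J/k or J/k; the former kills
  J.\<close>

definition gblock :: "nat \<Rightarrow> bool \<Rightarrow> bool \<Rightarrow> bool \<Rightarrow> ('u, 'f) matrix" where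
  "gblock i r t s =
    (if i \<in> S then if r \<and> s \<and> \<not> t then loc i (True, False, True) else 0
     else if i \<notin> P \<and> r \<and> s \<and> \<not> t then loc i (True, False, True)
     else G i r t s)"

lemma block_idm:
  assumes i: "i \<in> {1..n}"
  shows "mat_mult (U i) (G i r t s) (idm i) = gblock i r t s" (is ?A)
    and "mat_mult (U i) (idm i) (G i r t s) = gblock i r t s" (is ?B)
proof -
  note mults = block_mat_mult_ones[OF fin[OF i] base[OF i]] block_mat_id_left[OF fin[OF i]]
    block_mat_id_right[OF fin[OF i]] block_mat_mult_mismatch mat_mult_add_left mat_mult_add_right
    mat_mult_diff_left mat_mult_diff_right mat_mult_scale_left mat_mult_scale_right
  have v: "of_nat (card (U i) - Suc 0) = val i" by (simp add: val_def)
  have nz: "i \<notin> P \<Longrightarrow> val i \<noteq> 0" using P_iff i by auto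
  have z: "mat_scale 0 A = 0" "mat_scale 1 A = A" for A :: "('u, 'f) matrix"
    by (simp_all add: mat_scale_def fun_eq_iff)
  consider "r \<noteq> s" "\<not> t" | "r \<noteq> s" "t" | "\<not> r" "\<not> s" | "r" "s" "t" | "r" "s" "\<not> t" by blast
  then have "?A \<and> ?B"
  proof cases
    case 1
    then show ?thesis by (simp add: block_mat_zero gblock_def z)
  next
    case 2
    then show ?thesis using S_P nz
      by (cases r; auto simp add: gblock_def idm_def mults v z)
  next
    case 3
    then have "G i r t s = G i False True False" using block_mat_base by (cases t) auto
    then show ?thesis using S_P 3 nz
      by (auto simp add: gblock_def idm_def mults v z)
  next
    case 4
    then show ?thesis using S_P nz
      by (auto simp add: gblock_def idm_def mults v z)
  next
    case 5
    then show ?thesis using S_P nz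
      by (auto simp add: gblock_def idm_def mults v z)
  qed
  then show ?A ?B by auto
qed

lemma gblock_span:
  assumes i: "i \<in> {1..n}"
  shows "gblock i r t s \<in> mat_space.span (loc i ` Lab i)"
proof -
  have loc: "loc i l \<in> mat_space.span (loc i ` Lab i)" if "l \<in> Lab i" for l
    using that by (intro mat_space.span_base) auto
  have zero: "0 \<in> mat_space.span (loc i ` Lab i)" by (rule mat_space.span_zero)
  consider "i \<in> S" | "i \<notin> S" "r \<noteq> s" "\<not> t" | "i \<notin> S" "i \<notin> P" "r" "s" "\<not> t"
    | "i \<notin> S" "i \<in> P" "r = s \<or> t" | "i \<notin> S" "i \<notin> P" "\<not> (r \<and> s \<and> \<not> t)" "r = s \<or> t"
    by blast
  then show ?thesis
  proof cases
    case 1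
    then show ?thesis using loc[of "(True, False, True)"] zero by (auto simp: gblock_def Lab_def)
  next
    case 2
    then show ?thesis using zero by (simp add: gblock_def block_mat_zero)
  next
    case 3
    then show ?thesis using loc[of "(True, False, True)"] by (auto simp: gblock_def Lab_def)
  next
    case 4
    then have "gblock i r t s = loc i (r, t \<and> r \<and> s, s)"
      by (cases r; cases s; cases t) (auto simp: gblock_def block_mat_base[of _ _ False])
    then show ?thesis using 4 loc[of "(r, t \<and> r \<and> s, s)"] by (auto simp: Lab_def)
  next
    case 5
    then have "val i \<noteq> 0" using P_iff i by auto
    then have e: "gblock i r t s = mat_scale (if s then val i else 1) (loc i (r, False, s))"
      using 5
      by (cases r; cases s; cases t) (auto simp: gblock_def block_mat_base[of _ _ False] mat_scale_def fun_eq_iff)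
    show ?thesis unfolding e using 5 by (intro mat_space.span_scale loc) (simp add: Lab_def)
  qed
qed

text \<open>The local form of what \<open>T_D\<close> asks of a matrix: tensor products of good
  factors commute with \<open>D\<close> and are sent by it into the span of the monomials.\<close>

definition good :: "nat \<Rightarrow> ('u, 'f) matrix \<Rightarrow> bool" where
  "good i f \<longleftrightarrow> mat_mult (U i) f (idm i) = mat_mult (U i) (idm i) f \<and>
    mat_mult (U i) f (idm i) \<in> mat_space.span (loc i ` Lab i)"

lemma good_block: "i \<in> {1..n} \<Longrightarrow> good i (G i r t s)"
  by (simp add: good_def block_idm gblock_span)

lemma good_add: "good i f \<Longrightarrow> good i f' \<Longrightarrow> good i (f + f')"
  unfolding good_def mat_mult_add_left mat_mult_add_right using mat_space.span_add by metis

lemma good_diff: "good i f \<Longrightarrow> good i f' \<Longrightarrow> good i (f - f')"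
  unfolding good_def mat_mult_diff_left mat_mult_diff_right using mat_space.span_diff by metis

section \<open>Monomials, their coefficients, and the filtration by degree\<close>

definition Labs :: "(nat \<Rightarrow> label) set" where
  "Labs = PiE {1..n} Lab"

definition mon :: "(nat \<Rightarrow> label) \<Rightarrow> (nat \<Rightarrow> 'u, 'f) matrix" where
  "mon l = tens n U (\<lambda>i. loc i (l i))"

definition coef :: "(nat \<Rightarrow> label) \<Rightarrow> (nat \<Rightarrow> 'u, 'f) matrix \<Rightarrow> 'f" where
  "coef l = tens_pairing n U (\<lambda>i. dual i (l i))"

definition gcompat :: "(nat \<Rightarrow> label) \<Rightarrow> (nat \<Rightarrow> label) \<Rightarrow> bool" where
  "gcompat l m \<longleftrightarrow> (\<forall>i\<in>{1..n}. compat i (l i) (m i))"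

definition gcomp :: "(nat \<Rightarrow> label) \<Rightarrow> (nat \<Rightarrow> label) \<Rightarrow> nat \<Rightarrow> label" where
  "gcomp l m = (\<lambda>i\<in>{1..n}. lcomp i (l i) (m i))"

definition deg :: "(nat \<Rightarrow> label) \<Rightarrow> nat" where
  "deg l = (\<Sum>i\<in>{1..n}. ldeg i (l i))"

definition filt :: "nat \<Rightarrow> (nat \<Rightarrow> 'u, 'f) matrix set" where
  "filt d = mat_space.span (mon ` {l \<in> Labs. deg l \<ge> d})"

definition D :: "(nat \<Rightarrow> 'u, 'f) matrix" where
  "D = tens n U idm"

lemma finite_Labs: "finite Labs"
  unfolding Labs_def by (intro finite_PiE finite_Lab) auto

lemma LabsD: "l \<in> Labs \<Longrightarrow> i \<in> {1..n} \<Longrightarrow> l i \<in> Lab i"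
  by (auto simp: Labs_def)

lemma Labs_eqI:
  assumes "l \<in> Labs" "m \<in> Labs" "\<And>i. i \<in> {1..n} \<Longrightarrow> l i = m i"
  shows "l = m"
  using assms unfolding Labs_def by (rule PiE_ext)

lemma filt_0: "filt 0 = mat_space.span (mon ` Labs)"
  by (simp add: filt_def)

lemma coef_mon:
  assumes "l \<in> Labs" "m \<in> Labs"
  shows "coef l (mon m) = of_bool (l = m)"
proof -
  have "coef l (mon m) = (\<Prod>i\<in>{1..n}. lpair i (dual i (l i)) (loc i (m i)))"
    unfolding coef_def mon_def tens_pairing_tens[OF finU] lpair_def ..
  also have "\<dots> = (\<Prod>i\<in>{1..n}. of_bool (l i = m i))"
    using lpair_dual_loc assms LabsD by (intro prod.cong) auto
  also have "\<dots> = of_bool (l = m)"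
  proof (cases "l = m")
    case False
    then obtain i where "i \<in> {1..n}" "l i \<noteq> m i" using assms Labs_eqI by blast
    then have "(\<Prod>i\<in>{1..n}. of_bool (l i = m i)) = (0 :: 'f)"
      by (intro prod_zero) auto
    then show ?thesis using False by simp
  qed simp
  finally show ?thesis .
qed

lemma coef_add: "coef l (Y + Z) = coef l Y + coef l Z"
  by (simp only: coef_def tens_pairing_add)

lemma coef_scale: "coef l (mat_scale c Y) = c * coef l Y"
  by (simp only: coef_def tens_pairing_scale)

lemma coef_sum: "coef l (\<Sum>i\<in>I. Y i) = (\<Sum>i\<in>I. coef l (Y i))"
  by (simp only: coef_def tens_pairing_sum)

lemma coef_zero: "coef l 0 = 0"
  using coef_sum[of l "\<lambda>_. 0" "{} :: nat set"] by simp

lemma coef_comb: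
  assumes "l \<in> Labs" "J \<subseteq> Labs"
  shows "coef l (\<Sum>m\<in>J. mat_scale (c m) (mon m)) = (if l \<in> J then c l else 0)"
proof -
  have "coef l (\<Sum>m\<in>J. mat_scale (c m) (mon m)) = (\<Sum>m\<in>J. if m = l then c l else 0)"
    unfolding coef_sum coef_scale using assms by (intro sum.cong) (auto simp: coef_mon)
  then show ?thesis using finite_subset[OF assms(2) finite_Labs] by (simp add: sum.delta)
qed

lemma expand:
  assumes "Y \<in> mat_space.span (mon ` J)" "J \<subseteq> Labs"
  shows "Y = (\<Sum>l\<in>J. mat_scale (coef l Y) (mon l))"
  using assms(1)
proof (induction rule: mat_space.span_induct)
  case base
  show ?case
  proof (rule mat_space.subspaceI)
    fix Y Z :: "(nat \<Rightarrow> 'u, 'f) matrix" and c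
    assume Y: "Y \<in> {Y. Y = (\<Sum>l\<in>J. mat_scale (coef l Y) (mon l))}"
    have "mat_scale c (\<Sum>l\<in>J. mat_scale (coef l Y) (mon l)) =
        (\<Sum>l\<in>J. mat_scale (coef l (mat_scale c Y)) (mon l))"
      by (simp add: coef_scale mat_space.scale_sum_right)
    with Y show "mat_scale c Y \<in> {Y. Y = (\<Sum>l\<in>J. mat_scale (coef l Y) (mon l))}"
      by simp
    assume Z: "Z \<in> {Y. Y = (\<Sum>l\<in>J. mat_scale (coef l Y) (mon l))}"
    have "(\<Sum>l\<in>J. mat_scale (coef l Y) (mon l)) + (\<Sum>l\<in>J. mat_scale (coef l Z) (mon l)) =
        (\<Sum>l\<in>J. mat_scale (coef l (Y + Z)) (mon l))"
      by (simp only: coef_add mat_space.scale_left_distrib sum.distrib)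
    with Y Z show "Y + Z \<in> {Y. Y = (\<Sum>l\<in>J. mat_scale (coef l Y) (mon l))}"
      by simp
  qed (simp only: mem_Collect_eq coef_zero mat_space.scale_zero_left sum.neutral_const)
next
  case (step Y)
  then obtain m where m: "m \<in> J" "Y = mon m" by auto
  have "(\<Sum>l\<in>J. mat_scale (coef l Y) (mon l)) = (\<Sum>l\<in>J. if l = m then mon m else 0)"
    using m assms(2) by (intro sum.cong) (auto simp: coef_mon subset_iff)
  then show ?case using finite_subset[OF assms(2) finite_Labs] m by (simp add: sum.delta)
qed

lemma gcomp_Labs: "l \<in> Labs \<Longrightarrow> m \<in> Labs \<Longrightarrow> gcompat l m \<Longrightarrow> gcomp l m \<in> Labs"
  unfolding Labs_def gcomp_def gcompat_def using lcomp_Lab by (auto simp: PiE_def Pi_def)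

lemma mon_mult:
  assumes "l \<in> Labs" "m \<in> Labs"
  shows "mat_mult X (mon l) (mon m) = (if gcompat l m then mon (gcomp l m) else 0)"
proof -
  have *: "mat_mult X (mon l) (mon m) = tens n U (\<lambda>i. mat_mult (U i) (loc i (l i)) (loc i (m i)))"
    unfolding mon_def tens_mult[OF finU] ..
  show ?thesis
  proof (cases "gcompat l m")
    case True
    have "tens n U (\<lambda>i. mat_mult (U i) (loc i (l i)) (loc i (m i))) = mon (gcomp l m)"
      unfolding mon_def
    proof (rule tens_cong)
      fix i assume i: "i \<in> {1..n}"
      then show "mat_mult (U i) (loc i (l i)) (loc i (m i)) = loc i (gcomp l m i)"
        using True loc_mult[OF i LabsD[OF assms(1) i] LabsD[OF assms(2) i]]
        by (simp add: gcompat_def gcomp_def)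
    qed
    then show ?thesis using * True by simp
  next
    case False
    then obtain i where i: "i \<in> {1..n}" "\<not> compat i (l i) (m i)" by (auto simp: gcompat_def)
    then have "mat_mult (U i) (loc i (l i)) (loc i (m i)) = 0"
      using loc_mult[OF i(1)] assms LabsD by simp
    with i(1) have "tens n U (\<lambda>i. mat_mult (U i) (loc i (l i)) (loc i (m i))) = 0"
      by (rule tens_zero)
    then show ?thesis using False * by simp
  qed
qed

lemma deg_gcomp:
  assumes "l \<in> Labs" "m \<in> Labs" "gcompat l m"
  shows "deg (gcomp l m) = deg l + deg m"
  unfolding deg_def sum.distrib[symmetric] using assms LabsD
  by (intro sum.cong) (auto simp: gcomp_def gcompat_def intro!: ldeg_lcomp)

lemma deg_le: "deg l \<le> 2 * n_plus p n U"
proof -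
  have "deg l \<le> (\<Sum>i\<in>{1..n}. if i \<in> P then 2 else 0)"
    unfolding deg_def by (intro sum_mono ldeg_le)
  also have "\<dots> = 2 * card ({1..n} \<inter> P)"
    by (simp add: sum.If_cases Collect_mem_eq)
  also have "{1..n} \<inter> P = P" by (auto simp: plus_part_def)
  finally show ?thesis by (simp add: n_plus_def)
qed

text \<open>On monomials the product is zero or its degree is the sum of the degrees; bilinearity
  does the rest. With the bound \<open>deg_le\<close> this makes products of 2 n_+ + 1 elements of
  \<open>filt 1\<close> vanish.\<close>

lemma filt_mult:
  assumes "Y \<in> filt d" "Z \<in> filt e"
  shows "mat_mult X Y Z \<in> filt (d + e)"
proof (rule mat_mult_span[OF _ assms[unfolded filt_def], where C = "mon ` {l \<in> Labs. deg l \<ge> d + e}",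
      folded filt_def])
  fix Y Z assume "Y \<in> mon ` {l \<in> Labs. d \<le> deg l}" "Z \<in> mon ` {l \<in> Labs. e \<le> deg l}"
  then obtain l m where lm: "Y = mon l" "Z = mon m" "l \<in> Labs" "m \<in> Labs" "d \<le> deg l" "e \<le> deg m"
    by auto
  show "mat_mult X Y Z \<in> filt (d + e)"
  proof (cases "gcompat l m")
    case True
    then have "mon (gcomp l m) \<in> filt (d + e)"
      unfolding filt_def using lm
      by (intro mat_space.span_base imageI) (simp add: gcomp_Labs deg_gcomp)
    then show ?thesis using True lm by (simp add: mon_mult)
  next
    case False
    then show ?thesis using lm by (simp add: mon_mult filt_def mat_space.span_zero)
  qed
qed

lemma filt_mono: "d \<le> e \<Longrightarrow> filt e \<subseteq> filt d"
  unfolding filt_def by (intro mat_space.span_mono) auto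

lemma filt_top: "filt (2 * n_plus p n U + 1) = {0}"
proof -
  have e: "{l \<in> Labs. deg l \<ge> 2 * n_plus p n U + 1} = {}"
    using deg_le by (auto simp: not_le less_Suc_eq_le)
  show ?thesis unfolding filt_def e by simp
qed

lemma filt_closed:
  "0 \<in> filt d" "Y \<in> filt d \<Longrightarrow> Z \<in> filt d \<Longrightarrow> Y + Z \<in> filt d" "Y \<in> filt d \<Longrightarrow> - Y \<in> filt d"
  "Y \<in> filt d \<Longrightarrow> mat_scale c Y \<in> filt d"
  unfolding filt_def
  by (simp_all add: mat_space.span_zero mat_space.span_add mat_space.span_neg mat_space.span_scale)

lemma idm_mult_loc:
  assumes i: "i \<in> {1..n}" and "l \<in> Lab i"
  shows "mat_mult (U i) (idm i) (loc i l) = loc i l" "mat_mult (U i) (loc i l) (idm i) = loc i l"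
proof -
  obtain r t s where l: "l = (r, t, s)" by (cases l)
  have nz: "i \<notin> P \<Longrightarrow> val i \<noteq> 0" using P_iff i by auto
  have z: "mat_scale 1 A = A" for A :: "('u, 'f) matrix"
    by (simp add: mat_scale_def fun_eq_iff)
  have "mat_mult (U i) (idm i) (loc i l) = loc i l \<and> mat_mult (U i) (loc i l) (idm i) = loc i l"
    using assms S_P unfolding l
    by (auto simp: Lab_def mat_mult_diff_left mat_mult_diff_right mat_mult_scale_left mat_mult_scale_right
        block_idm[OF i] gblock_def z split: if_splits)
  then show "mat_mult (U i) (idm i) (loc i l) = loc i l" "mat_mult (U i) (loc i l) (idm i) = loc i l"
    by auto
qed

lemma D_mult:
  assumes "Y \<in> filt 0"
  shows "mat_mult X D Y = Y" "mat_mult X Y D = Y"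
proof -
  have "mat_mult X D Y = Y \<and> mat_mult X Y D = Y"
    using assms unfolding filt_0
  proof (induction rule: mat_space.span_induct)
    case base
    then show ?case
      by (simp add: mat_space.subspace_def mat_mult_add_left mat_mult_add_right
          mat_mult_scale_left mat_mult_scale_right)
  next
    case (step Y)
    then obtain l where l: "l \<in> Labs" "Y = mon l" by auto
    show ?case unfolding l(2) D_def mon_def tens_mult[OF finU]
      by (intro conjI tens_cong idm_mult_loc LabsD[OF l(1)])
  qed
  then show "mat_mult X D Y = Y" "mat_mult X Y D = Y" by auto
qed

lemma good_tens:
  assumes "\<And>i. i \<in> {1..n} \<Longrightarrow> good i (f i)"
  shows "mat_mult X (tens n U f) D = mat_mult X D (tens n U f)"
    and "mat_mult X (tens n U f) D \<in> filt 0"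
proof -
  show "mat_mult X (tens n U f) D = mat_mult X D (tens n U f)"
    unfolding D_def tens_mult[OF finU] using assms by (intro tens_cong) (auto simp: good_def)
  show "mat_mult X (tens n U f) D \<in> filt 0"
    unfolding D_def tens_mult[OF finU] filt_0
  proof (rule tens_in_span)
    fix g assume "\<And>i. i \<in> {1..n} \<Longrightarrow> g i \<in> loc i ` Lab i"
    then have "\<forall>i\<in>{1..n}. \<exists>l. l \<in> Lab i \<and> g i = loc i l" by blast
    then obtain l where l: "\<forall>i\<in>{1..n}. l i \<in> Lab i \<and> g i = loc i (l i)" by metis
    then have "tens n U g = mon (restrict l {1..n})"
      unfolding mon_def by (intro tens_cong) auto
    moreover have "restrict l {1..n} \<in> Labs" using l by (auto simp: Labs_def)
    ultimately show "tens n U g \<in> mat_space.span (mon ` Labs)"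
      by (auto intro: mat_space.span_base)
  next
    show "mat_mult (U i) (f i) (idm i) \<in> mat_space.span (loc i ` Lab i)" if "i \<in> {1..n}" for i
      using assms[OF that] unfolding good_def by (rule conjunct2)
  qed (simp add: finite_Lab)
qed


subsection \<open>The semisimple quotient\<close>

text \<open>The explicit model of the block algebra; \<open>block_algebra_cls\<close> identifies the
  two after carrier and identity have been matched.\<close>

definition blk :: "('f, (nat \<Rightarrow> 'u, 'f) matrix) module" where
  "blk = (matrix_algebra X)\<lparr>carrier := filt 0, one := D\<rparr>"

abbreviation W where "W \<equiv> {1..n} - S - P"

lemma finite_X: "finite X"
  using finite_points finU .

lemma finite_P: "finite P"
  by (rule finite_subset[of _ "{1..n}"]) (auto simp: plus_part_def)

lemma idm_eq:
  assumes "i \<in> {1..n}"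
  shows "idm i = gblock i False False False + gblock i True False True"
  using S_P by (auto simp: idm_def gblock_def block_mat_base[of _ _ False])

lemma idm_span: "i \<in> {1..n} \<Longrightarrow> idm i \<in> mat_space.span (loc i ` Lab i)"
  unfolding idm_eq by (intro mat_space.span_add gblock_span)

lemma idm_idem:
  assumes "i \<in> {1..n}"
  shows "mat_mult (U i) (idm i) (idm i) = idm i"
proof -
  have "mat_mult (U i) (idm i) v = v" if "v \<in> mat_space.span (loc i ` Lab i)" for v
    using that
  proof (induction rule: mat_space.span_induct)
    case base
    then show ?case
      by (simp add: mat_space.subspace_def mat_mult_add_right mat_mult_scale_right)
  qed (use idm_mult_loc[OF assms] in auto)
  then show ?thesis using idm_span[OF assms] by blast
qed

lemma D_filt: "D \<in> filt 0"
  unfolding D_def filt_0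
proof (rule tens_in_span[where K = "\<lambda>i. loc i ` Lab i"])
  fix g assume "\<And>i. i \<in> {1..n} \<Longrightarrow> g i \<in> loc i ` Lab i"
  then have "\<forall>i\<in>{1..n}. \<exists>l. l \<in> Lab i \<and> g i = loc i l" by blast
  then obtain l where l: "\<forall>i\<in>{1..n}. l i \<in> Lab i \<and> g i = loc i (l i)" by metis
  then have "tens n U g = mon (restrict l {1..n})"
    unfolding mon_def by (intro tens_cong) auto
  moreover have "restrict l {1..n} \<in> Labs" using l by (auto simp: Labs_def)
  ultimately show "tens n U g \<in> mat_space.span (mon ` Labs)"
    by (auto intro: mat_space.span_base)
qed (simp_all add: finite_Lab idm_span)

lemma filt_carrier: "filt d \<subseteq> carrier (matrix_algebra X)"
proof
  fix Y assume "Y \<in> filt d"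
  then show "Y \<in> carrier (matrix_algebra X)"
    unfolding filt_def
  proof (induction rule: mat_space.span_induct)
    case base
    show ?case by (auto simp: mat_space.subspace_def matrix_algebra_def mat_scale_def)
  qed (auto simp: mon_def tens_def matrix_algebra_def)
qed

lemma matrix_algebra_minus:
  assumes "Y \<in> carrier (matrix_algebra X)"
  shows "\<ominus>\<^bsub>matrix_algebra X\<^esub> Y = - (Y :: (nat \<Rightarrow> 'u, 'f) matrix)"
proof -
  interpret ring "matrix_algebra X :: ('f, (nat \<Rightarrow> 'u, 'f) matrix) module"
    by (rule ring_matrix_algebra[OF finite_X])
  show ?thesis
    by (rule minus_equality) (use assms in \<open>auto simp: matrix_algebra_def\<close>)
qed

lemma ring_blk: "ring blk"
  unfolding blk_def
proof (rule ring_corner[OF ring_matrix_algebra[OF finite_X] filt_carrier])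
  show "\<ominus>\<^bsub>matrix_algebra X\<^esub> Y \<in> filt 0" if "Y \<in> filt 0" for Y
    using filt_closed(3)[OF that] matrix_algebra_minus[OF subsetD[OF filt_carrier that]] by simp
qed (use filt_closed D_filt filt_mult[of _ 0 _ 0] D_mult in \<open>auto simp: matrix_algebra_def\<close>)

lemma blk_simps:
  "carrier blk = filt 0" "mult blk = mat_mult X" "one blk = D" "zero blk = 0"
  "add blk = (+)" "smult blk = mat_scale"
  by (simp_all add: blk_def matrix_algebra_def)

text \<open>The labels of degree 0: \<open>e\<close> selects one of the 2^{n_+} matrix algebras,
  \<open>a\<close> and \<open>c\<close> are row and column in it. In \<open>P\<close> both indices
  agree, since a passage between base point and complement costs one degree.\<close>

definition labs :: "nat set \<Rightarrow> nat set \<Rightarrow> nat set \<Rightarrow> nat \<Rightarrow> label" where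
  "labs e a c = (\<lambda>i\<in>{1..n}. if i \<in> S then (True, False, True)
    else if i \<in> P then (i \<in> e, False, i \<in> e) else (i \<in> a, False, i \<in> c))"

lemma labs_Labs: "labs e a c \<in> Labs"
  by (auto simp: labs_def Labs_def Lab_def)

lemma deg_labs: "deg (labs e a c) = 0"
  using S_P by (auto simp: deg_def labs_def)

lemma labs_eq_iff:
  assumes "e \<subseteq> P" "e' \<subseteq> P" "a \<subseteq> W" "a' \<subseteq> W" "c \<subseteq> W" "c' \<subseteq> W"
  shows "labs e a c = labs e' a' c' \<longleftrightarrow> e = e' \<and> a = a' \<and> c = c'"
proof
  assume eq: "labs e a c = labs e' a' c'"
  have P: "P \<subseteq> {1..n}" by (auto simp: plus_part_def)
  have "i \<in> e \<longleftrightarrow> i \<in> e'" if "i \<in> P" for i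
    using fun_cong[OF eq, of i] that S_P P by (auto simp: labs_def split: if_splits)
  moreover have "(i \<in> a \<longleftrightarrow> i \<in> a') \<and> (i \<in> c \<longleftrightarrow> i \<in> c')" if "i \<in> W" for i
    using fun_cong[OF eq, of i] that by (auto simp: labs_def)
  ultimately show "e = e' \<and> a = a' \<and> c = c'" using assms by blast
qed simp

lemma gcompat_labs:
  assumes "e \<subseteq> P" "e' \<subseteq> P" "c \<subseteq> W" "c' \<subseteq> W"
  shows "gcompat (labs e a c) (labs e' c' b) \<longleftrightarrow> e = e' \<and> c = c'"
proof
  assume g: "gcompat (labs e a c) (labs e' c' b)"
  have P: "P \<subseteq> {1..n}" by (auto simp: plus_part_def)
  have "i \<in> e \<longleftrightarrow> i \<in> e'" if "i \<in> P" for i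
    using g that S_P P by (auto simp: labs_def gcompat_def split: if_splits dest!: bspec[of _ _ i])
  moreover have "i \<in> c \<longleftrightarrow> i \<in> c'" if "i \<in> W" for i
    using g that by (auto simp: labs_def gcompat_def dest!: bspec[of _ _ i])
  ultimately show "e = e' \<and> c = c'" using assms by blast
qed (use S_P in \<open>auto simp: gcompat_def labs_def\<close>)

lemma gcomp_labs: "gcomp (labs e a c) (labs e c b) = labs e a b"
  using S_P by (auto simp: gcomp_def labs_def fun_eq_iff)

lemma deg_0_labs:
  assumes "l \<in> Labs" "deg l = 0"
  obtains e a c where "e \<subseteq> P" "a \<subseteq> W" "c \<subseteq> W" "l = labs e a c"
proof
  let ?e = "{i \<in> P. fst (l i)}" and ?a = "{i \<in> W. fst (l i)}" and ?c = "{i \<in> W. snd (snd (l i))}"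
  show "l = labs ?e ?a ?c"
  proof (rule Labs_eqI[OF assms(1) labs_Labs])
    fix i assume i: "i \<in> {1..n}"
    have "ldeg i (l i) = 0" using assms(2) i by (simp add: deg_def)
    then show "l i = labs ?e ?a ?c i"
      using LabsD[OF assms(1) i] i S_P
      by (cases "l i") (auto simp: labs_def Lab_def split: if_splits)
  qed
qed auto

section \<open>The map onto the direct power of matrix algebras\<close>

definition QQ :: "nat set" where "QQ = {1..2 ^ n_plus p n U}"
definition NN :: "nat set" where "NN = {1..2 ^ card W}"

text \<open>The target indexes its components and rows by numbers, whereas degree 0 labels are given
  by subsets; fixed enumerations translate.\<close>

definition en :: "nat \<Rightarrow> nat set" where "en = (SOME f. bij_betw f QQ (Pow P))"
definition rw :: "nat \<Rightarrow> nat set" where "rw = (SOME f. bij_betw f NN (Pow W))"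

lemma en: "bij_betw en QQ (Pow P)"
proof -
  have "\<exists>f. bij_betw f QQ (Pow P)"
    using ex_bij_betw_nat_finite_1[of "Pow P"] finite_P by (simp add: card_Pow n_plus_def QQ_def)
  then show ?thesis unfolding en_def by (rule someI_ex)
qed

lemma rw: "bij_betw rw NN (Pow W)"
proof -
  have "\<exists>f. bij_betw f NN (Pow W)"
    using ex_bij_betw_nat_finite_1[of "Pow W"] by (simp add: card_Pow NN_def)
  then show ?thesis unfolding rw_def by (rule someI_ex)
qed

lemma finite_NN: "finite NN" and finite_QQ: "finite QQ"
  by (simp_all add: NN_def QQ_def)

definition lab :: "nat \<Rightarrow> nat \<Rightarrow> nat \<Rightarrow> nat \<Rightarrow> label" where
  "lab q y z = labs (en q) (rw y) (rw z)"

lemma en_sub: "q \<in> QQ \<Longrightarrow> en q \<subseteq> P" and rw_sub: "y \<in> NN \<Longrightarrow> rw y \<subseteq> W"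
  using bij_betw_imp_surj_on[OF en] bij_betw_imp_surj_on[OF rw] by blast+

lemma en_eq: "q \<in> QQ \<Longrightarrow> q' \<in> QQ \<Longrightarrow> en q = en q' \<longleftrightarrow> q = q'"
  using en by (meson bij_betw_def inj_on_eq_iff)

lemma rw_eq: "y \<in> NN \<Longrightarrow> z \<in> NN \<Longrightarrow> rw y = rw z \<longleftrightarrow> y = z"
  using rw by (meson bij_betw_def inj_on_eq_iff)

lemma lab_Labs: "lab q y z \<in> Labs" and deg_lab: "deg (lab q y z) = 0"
  by (simp_all add: lab_def labs_Labs deg_labs)

lemma lab_eq_iff:
  assumes "q \<in> QQ" "q' \<in> QQ" "y \<in> NN" "y' \<in> NN" "z \<in> NN" "z' \<in> NN"
  shows "lab q y z = lab q' y' z' \<longleftrightarrow> q = q' \<and> y = y' \<and> z = z'"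
  unfolding lab_def using assms labs_eq_iff en_sub rw_sub en_eq rw_eq by metis

lemma gcompat_lab:
  assumes "q \<in> QQ" "q' \<in> QQ" "w \<in> NN" "w' \<in> NN"
  shows "gcompat (lab q y w) (lab q' w' z) \<longleftrightarrow> q = q' \<and> w = w'"
  unfolding lab_def using assms gcompat_labs en_sub rw_sub en_eq rw_eq by metis

lemma deg_0_lab:
  assumes "l \<in> Labs" "deg l = 0"
  obtains q y z where "q \<in> QQ" "y \<in> NN" "z \<in> NN" "l = lab q y z"
proof -
  obtain e a c where eac: "e \<subseteq> P" "a \<subseteq> W" "c \<subseteq> W" "l = labs e a c"
    using deg_0_labs[OF assms] .
  have "e \<in> en ` QQ" "a \<in> rw ` NN" "c \<in> rw ` NN"
    using bij_betw_imp_surj_on[OF en] bij_betw_imp_surj_on[OF rw] eac(1-3) by auto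
  then show ?thesis using that eac(4) unfolding lab_def by blast
qed

text \<open>By bilinearity monomials suffice. If one of them has positive degree, so has a nonzero
  product, and both sides vanish; monomials of degree 0 multiply as matrix units, with different
  components annihilating each other.\<close>

lemma coef_lab_mult:
  assumes q: "q \<in> QQ" and yz: "y \<in> NN" "z \<in> NN" and "Y \<in> filt 0" "Z \<in> filt 0"
  shows "coef (lab q y z) (mat_mult X Y Z) =
    (\<Sum>w\<in>NN. coef (lab q y w) Y * coef (lab q w z) Z)"
  using assms(4) unfolding filt_0
proof (induction rule: mat_space.span_induct)
  case base
  then show ?case
    by (simp add: mat_space.subspace_def mat_mult_add_left mat_mult_scale_left coef_add coef_scale
        coef_zero algebra_simps sum.distrib sum_distrib_left)
next
  case (step Y)
  then obtain l where l: "l \<in> Labs" "Y = mon l" by auto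
  show ?case using assms(5) unfolding filt_0
  proof (induction rule: mat_space.span_induct)
    case base
    then show ?case
      by (simp add: mat_space.subspace_def mat_mult_add_right mat_mult_scale_right coef_add coef_scale
          coef_zero algebra_simps sum.distrib sum_distrib_left)
  next
    case (step Z)
    then obtain m where m: "m \<in> Labs" "Z = mon m" by auto
    have 1: "coef (lab q y z) (mat_mult X Y Z) = of_bool (gcompat l m \<and> lab q y z = gcomp l m)"
      using l m by (auto simp: mon_mult coef_mon gcomp_Labs lab_Labs coef_zero)
    have 2: "(\<Sum>w\<in>NN. coef (lab q y w) Y * coef (lab q w z) Z) =
        (\<Sum>w\<in>NN. of_bool (lab q y w = l \<and> lab q w z = m))"
      using l m by (intro sum.cong) (auto simp: coef_mon lab_Labs)
    show ?case
    proof (cases "deg l = 0 \<and> deg m = 0")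
      case False
      then have "lab q y z \<noteq> gcomp l m" if "gcompat l m"
        using deg_gcomp[OF l(1) m(1) that] deg_lab[of q y z] by auto
      moreover have "\<not> (lab q y w = l \<and> lab q w z = m)" for w
        using False deg_lab[of q y w] deg_lab[of q w z] by auto
      ultimately show ?thesis unfolding 1 2 by (auto intro!: sum.neutral)
    next
      case True
      obtain q1 y1 w1 where l1: "q1 \<in> QQ" "y1 \<in> NN" "w1 \<in> NN" "l = lab q1 y1 w1"
        using deg_0_lab l(1) True by blast
      obtain q2 w2 z2 where m1: "q2 \<in> QQ" "w2 \<in> NN" "z2 \<in> NN" "m = lab q2 w2 z2"
        using deg_0_lab m(1) True by blast
      have "gcomp (lab q1 y1 w1) (lab q1 w1 z2) = lab q1 y1 z2"
        unfolding lab_def by (rule gcomp_labs)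
      then have "gcompat l m \<and> lab q y z = gcomp l m \<longleftrightarrow>
          q1 = q2 \<and> w1 = w2 \<and> q = q1 \<and> y = y1 \<and> z = z2"
        unfolding l1(4) m1(4) gcompat_lab[OF l1(1) m1(1) l1(3) m1(2)]
        using lab_eq_iff[OF q l1(1) yz(1) l1(2) yz(2) m1(3)] by auto
      moreover have "(\<Sum>w\<in>NN. of_bool (lab q y w = l \<and> lab q w z = m)) =
          (\<Sum>w\<in>NN. if w = w1 then of_bool (q1 = q2 \<and> w1 = w2 \<and> q = q1 \<and> y = y1 \<and> z = z2) else (0 :: 'f))"
      proof (intro sum.cong refl)
        fix w assume w: "w \<in> NN"
        show "of_bool (lab q y w = l \<and> lab q w z = m) =
          (if w = w1 then of_bool (q1 = q2 \<and> w1 = w2 \<and> q = q1 \<and> y = y1 \<and> z = z2) else (0 :: 'f))"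
          unfolding l1(4) m1(4) lab_eq_iff[OF q l1(1) yz(1) l1(2) w l1(3)]
            lab_eq_iff[OF q m1(1) w m1(2) yz(2) m1(3)] by auto
      qed
      ultimately show ?thesis unfolding 1 2 using l1(3) by (simp add: sum.delta finite_NN)
    qed
  qed
qed

definition rep :: "(nat \<Rightarrow> 'u, 'f) matrix \<Rightarrow> nat \<Rightarrow> (nat, 'f) matrix" where
  "rep Y = (\<lambda>q\<in>QQ. \<lambda>y z. if y \<in> NN \<and> z \<in> NN then coef (lab q y z) Y else 0)"

abbreviation tgt :: "('f, nat \<Rightarrow> (nat, 'f) matrix) module" where
  "tgt \<equiv> direct_power (matrix_algebra NN) (2 ^ n_plus p n U)"

lemmas tgt_unfold = direct_power_def[of _ "2 ^ n_plus p n U", folded QQ_def]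

lemma rep_preimage:
  assumes "\<psi> \<in> carrier tgt"
  shows "\<exists>Y\<in>filt 0. rep Y = \<psi>"
proof
  let ?J = "QQ \<times> NN \<times> NN"
  let ?Y = "\<Sum>(q, y, z)\<in>?J. mat_scale (\<psi> q y z) (mon (lab q y z))"
  show "?Y \<in> filt 0"
    unfolding filt_0
    by (intro mat_space.span_sum) (auto intro!: mat_space.span_scale intro: mat_space.span_base lab_Labs)
  have c: "coef (lab q y z) ?Y = \<psi> q y z" if "q \<in> QQ" "y \<in> NN" "z \<in> NN" for q y z
  proof -
    have "coef (lab q y z) ?Y = (\<Sum>v\<in>?J. if v = (q, y, z) then \<psi> q y z else 0)"
      unfolding coef_sum
    proof (intro sum.cong refl)
      fix v assume v: "v \<in> ?J"
      obtain q' y' z' where v': "v = (q', y', z')" by (cases v)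
      then show "coef (lab q y z) (case v of (q, y, z) \<Rightarrow> mat_scale (\<psi> q y z) (mon (lab q y z))) =
          (if v = (q, y, z) then \<psi> q y z else 0)"
        using v lab_eq_iff[of q q' y y' z z'] that
        by (auto simp: coef_scale coef_mon lab_Labs)
    qed
    then show ?thesis using that by (simp add: sum.delta finite_NN finite_QQ)
  qed
  have \<psi>: "\<psi> q y z = 0" if "q \<in> QQ" "\<not> (y \<in> NN \<and> z \<in> NN)" for q y z
    using assms that by (auto simp: tgt_unfold matrix_algebra_def PiE_def Pi_def)
  show "rep ?Y = \<psi>"
  proof
    fix q
    show "rep ?Y q = \<psi> q"
    proof (cases "q \<in> QQ")
      case True
      then show ?thesis using c \<psi> by (auto simp: rep_def fun_eq_iff)
    next
      case False
      then show ?thesis using assms by (auto simp: rep_def tgt_unfold PiE_def extensional_def)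
    qed
  qed
qed

lemma rep_carrier: "rep Y \<in> carrier tgt"
  by (auto simp: rep_def tgt_unfold matrix_algebra_def)

lemma rep_surj: "rep ` filt 0 = carrier tgt"
  using rep_preimage rep_carrier by blast

lemma rep_mult:
  assumes "Y \<in> filt 0" "Z \<in> filt 0"
  shows "rep (mat_mult X Y Z) = rep Y \<otimes>\<^bsub>tgt\<^esub> rep Z"
proof -
  have "rep (mat_mult X Y Z) q = mat_mult NN (rep Y q) (rep Z q)" if q: "q \<in> QQ" for q
  proof (intro ext)
    fix y z
    show "rep (mat_mult X Y Z) q y z = mat_mult NN (rep Y q) (rep Z q) y z"
    proof (cases "y \<in> NN \<and> z \<in> NN")
      case True
      then show ?thesis
        using q coef_lab_mult[OF q, of y z Y Z] assms by (simp add: rep_def mat_mult_def[of NN])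
    next
      case False
      then show ?thesis using q by (auto simp: rep_def mat_mult_def[of NN])
    qed
  qed
  then show ?thesis
    by (auto simp: rep_def tgt_unfold matrix_algebra_def intro!: restrict_ext)
qed

lemma rep_zero: "rep 0 = \<zero>\<^bsub>tgt\<^esub>"
  by (auto simp: rep_def tgt_unfold matrix_algebra_def fun_eq_iff coef_zero)

text \<open>A preimage \<open>Y\<close> of the identity gives rep D = rep D rep Y = rep (D Y) = rep
  Y, which avoids computing the coefficients of \<open>D\<close>.\<close>

lemma rep_one: "rep D = \<one>\<^bsub>tgt\<^esub>"
proof -
  interpret MN: ring "matrix_algebra NN :: ('f, (nat, 'f) matrix) module"
    by (rule ring_matrix_algebra) (rule finite_NN)
  have one: "\<one>\<^bsub>tgt\<^esub> \<in> carrier tgt" by (auto simp: tgt_unfold MN.one_closed)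
  have r1: "\<psi> \<otimes>\<^bsub>tgt\<^esub> \<one>\<^bsub>tgt\<^esub> = \<psi>" if "\<psi> \<in> carrier tgt" for \<psi>
    using that by (auto simp: tgt_unfold fun_eq_iff PiE_def Pi_def extensional_def)
  obtain Y where Y: "Y \<in> filt 0" "rep Y = \<one>\<^bsub>tgt\<^esub>" using rep_preimage[OF one] by auto
  have "rep D = rep D \<otimes>\<^bsub>tgt\<^esub> rep Y" using r1[OF rep_carrier] Y by simp
  also have "\<dots> = rep Y" using rep_mult[OF D_filt Y(1)] D_mult(1)[OF Y(1)] by simp
  finally show ?thesis using Y by simp
qed

lemma rep_hom: "rep \<in> ring_hom blk tgt"
proof (rule ring_hom_memI)
  fix Y Z
  show "rep (Y \<oplus>\<^bsub>blk\<^esub> Z) = rep Y \<oplus>\<^bsub>tgt\<^esub> rep Z"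
    by (auto simp: blk_simps rep_def tgt_unfold matrix_algebra_def fun_eq_iff coef_add)
qed (use rep_carrier rep_mult rep_one in \<open>auto simp: blk_simps\<close>)

lemma rep_scale: "rep (mat_scale c Y) = c \<odot>\<^bsub>tgt\<^esub> rep Y"
  by (auto simp: rep_def tgt_unfold matrix_algebra_def fun_eq_iff coef_scale mat_scale_apply)

lemma rep_kernel: "a_kernel blk tgt rep = filt 1"
proof -
  have "rep Y = \<zero>\<^bsub>tgt\<^esub> \<longleftrightarrow> Y \<in> filt 1" if Y: "Y \<in> filt 0" for Y
  proof
    assume "Y \<in> filt 1"
    then have e: "Y = (\<Sum>l | l \<in> Labs \<and> deg l \<ge> 1. mat_scale (coef l Y) (mon l))"
      unfolding filt_def by (rule expand) auto
    have "coef (lab q y z) Y = 0" for q y z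
      by (subst e, subst coef_comb) (auto simp: lab_Labs deg_lab)
    then show "rep Y = \<zero>\<^bsub>tgt\<^esub>"
      by (auto simp: rep_def tgt_unfold matrix_algebra_def fun_eq_iff)
  next
    assume 0: "rep Y = \<zero>\<^bsub>tgt\<^esub>"
    have c0: "coef (lab q y z) Y = 0" if "q \<in> QQ" "y \<in> NN" "z \<in> NN" for q y z
      using fun_cong[OF fun_cong[OF fun_cong[OF 0, of q], of y], of z] that
      by (auto simp: rep_def tgt_unfold matrix_algebra_def)
    have e: "Y = (\<Sum>l\<in>Labs. mat_scale (coef l Y) (mon l))"
      using Y unfolding filt_0 by (rule expand) auto
    have "mat_scale (coef l Y) (mon l) \<in> filt 1" if l: "l \<in> Labs" for l
    proof (cases "deg l = 0")
      case True
      then have "coef l Y = 0" using deg_0_lab[OF l] c0 by metis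
      then show ?thesis using filt_closed(1) by simp
    next
      case False
      then show ?thesis unfolding filt_def using l
        by (intro mat_space.span_scale mat_space.span_base) auto
    qed
    then show "Y \<in> filt 1"
      by (subst e) (unfold filt_def, intro mat_space.span_sum, auto)
  qed
  then show ?thesis using filt_mono[of 0 1] by (auto simp: a_kernel_def' blk_simps)
qed

lemma filt_foldr:
  assumes "set xs \<subseteq> filt 1"
  shows "foldr (\<lambda>u v. u \<otimes>\<^bsub>blk\<^esub> v) xs D \<in> filt (length xs)"
  using assms
proof (induction xs)
  case (Cons Y xs)
  then show ?case using filt_mult[of Y 1 _ "length xs"] by (simp add: blk_simps)
qed (simp add: D_filt)

lemma filt_1_vanishes: "product_vanishes blk (filt 1) (2 * n_plus p n U + 1)"
  unfolding product_vanishes_def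
proof (intro allI impI, elim conjE)
  fix xs assume "length xs = 2 * n_plus p n U + 1" "set xs \<subseteq> filt 1"
  then have "foldr (\<lambda>u v. u \<otimes>\<^bsub>blk\<^esub> v) xs \<one>\<^bsub>blk\<^esub> \<in> {0}"
    using filt_foldr[of xs] unfolding filt_top[symmetric] by (simp add: blk_simps)
  then show "foldr (\<lambda>u v. u \<otimes>\<^bsub>blk\<^esub> v) xs \<one>\<^bsub>blk\<^esub> = \<zero>\<^bsub>blk\<^esub>" by (simp add: blk_simps)
qed

lemma jacobson_blk: "jacobson_radical blk = filt 1"
proof -
  have "jacobson_radical blk = a_kernel blk tgt rep"
  proof (rule jacobson_radical_eq_kernel[where t = "2 * n_plus p n U + 1"])
    show "product_vanishes blk (a_kernel blk tgt rep) (2 * n_plus p n U + 1)"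
      unfolding rep_kernel by (rule filt_1_vanishes)
  qed (simp_all only: ring_blk rep_hom blk_simps rep_surj rep_zero finite_NN)
  then show ?thesis unfolding rep_kernel .
qed

lemma blk_iso: "algebra_iso (quotient_algebra blk (filt 1)) tgt \<noteq> {}"
  unfolding rep_kernel[symmetric]
  by (rule quotient_algebra_iso)
    (simp_all only: ring_blk rep_hom blk_simps rep_surj rep_zero rep_scale filt_closed)

lemma filt_1_ideal: "ideal (filt 1) blk"
proof -
  have "ring_hom_ring blk tgt rep"
    by (rule ring_hom_ring_surj[OF ring_blk rep_hom]) (simp_all add: blk_simps rep_surj rep_zero)
  then show ?thesis using ring_hom_ring.kernel_is_ideal rep_kernel by metis
qed


subsection \<open>Nilpotency and dimension\<close>

text \<open>An element of degree 1 concentrated at position \<open>i\<close>: the column of ones for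
  \<open>r\<close> true, the row of ones for \<open>r\<close> false.\<close>

definition raise_el :: "nat \<Rightarrow> bool \<Rightarrow> (nat \<Rightarrow> 'u, 'f) matrix" where
  "raise_el i r = tens n U (\<lambda>j. if j = i then G i r True (\<not> r) else idm j)"

lemma raise_el_filt:
  assumes i: "i \<in> P"
  shows "raise_el i r \<in> filt 1"
  unfolding raise_el_def filt_def
proof (rule tens_in_span[where K = "\<lambda>j. if j = i then {loc i (r, False, \<not> r)} else loc j ` Lab j"])
  have i': "i \<in> {1..n}" "i \<notin> S" using i S_P by (auto simp: plus_part_def)
  show "(if j = i then G i r True (\<not> r) else idm j)
      \<in> mat_space.span (if j = i then {loc i (r, False, \<not> r)} else loc j ` Lab j)"
    if "j \<in> {1..n}" for j
  proof (cases "j = i")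
    case True
    have "G i r True (\<not> r) = loc i (r, False, \<not> r)" using i i'(2) by (cases r) simp_all
    then show ?thesis using True by (simp del: loc.simps add: mat_space.span_base)
  next
    case False
    then show ?thesis using idm_span[OF that] by simp
  qed
  fix g assume g: "\<And>j. j \<in> {1..n} \<Longrightarrow> g j \<in> (if j = i then {loc i (r, False, \<not> r)} else loc j ` Lab j)"
  have "\<forall>j\<in>{1..n}. \<exists>l. l \<in> Lab j \<and> g j = loc j l \<and> (j = i \<longrightarrow> l = (r, False, \<not> r))"
  proof
    fix j assume j: "j \<in> {1..n}"
    show "\<exists>l. l \<in> Lab j \<and> g j = loc j l \<and> (j = i \<longrightarrow> l = (r, False, \<not> r))"
    proof (cases "j = i")
      case True
      then show ?thesis using g[OF j] i i'(2)
        by (intro exI[of _ "(r, False, \<not> r)"]) (simp add: Lab_def)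
    next
      case False
      then have "g j \<in> loc j ` Lab j" using g[OF j] by (simp del: loc.simps)
      then show ?thesis using False by blast
    qed
  qed
  then obtain l where l: "\<forall>j\<in>{1..n}. l j \<in> Lab j \<and> g j = loc j (l j) \<and> (j = i \<longrightarrow> l j = (r, False, \<not> r))"
    by metis
  let ?l = "restrict l {1..n}"
  have "tens n U g = mon ?l"
    unfolding mon_def using l by (intro tens_cong) auto
  moreover have "?l \<in> Labs" using l by (auto simp: Labs_def)
  moreover have "deg ?l \<ge> 1"
  proof -
    have "ldeg i (?l i) = 1" using l i i'(1) by simp
    moreover have "ldeg i (?l i) \<le> deg ?l"
      unfolding deg_def using i'(1) by (intro member_le_sum) auto
    ultimately show ?thesis by linarith
  qed
  ultimately show "tens n U g \<in> mat_space.span (mon ` {l \<in> Labs. 1 \<le> deg l})"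
    by (auto intro!: mat_space.span_base)
qed (simp add: finite_Lab)

text \<open>Column of ones times row of ones is the block of ones, whereas the reverse order gives k
  = 0. In the right order each i in \<open>P\<close> contributes two factors to a product of length
  2 n_+ that survives.\<close>

lemma foldr_raise:
  assumes "distinct is" "set is \<subseteq> P"
  shows "foldr (mat_mult X) (concat (map (\<lambda>i. [raise_el i True, raise_el i False]) is)) D =
    tens n U (\<lambda>j. if j \<in> set is then G j True True True else idm j)"
  using assms
proof (induction "is")
  case Nil
  then show ?case by (simp add: D_def)
next
  case (Cons i "is")
  have i: "i \<in> P" "i \<in> {1..n}" "i \<notin> set is" "i \<notin> S" using Cons.prems S_P by (auto simp: plus_part_def)
  let ?f = "\<lambda>j. if j \<in> set is then G j True True True else idm j"
  have "foldr (mat_mult X) (concat (map (\<lambda>i. [raise_el i True, raise_el i False]) (i # is))) D =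
      mat_mult X (raise_el i True) (mat_mult X (raise_el i False) (tens n U ?f))"
    using Cons by simp
  also have "\<dots> = tens n U (\<lambda>j. mat_mult (U j) (if j = i then G i True True (\<not> True) else idm j)
      (mat_mult (U j) (if j = i then G i False True (\<not> False) else idm j) (?f j)))"
    unfolding raise_el_def tens_mult[OF finU] ..
  also have "\<dots> = tens n U (\<lambda>j. if j \<in> set (i # is) then G j True True True else idm j)"
  proof (rule tens_cong)
    fix j assume j: "j \<in> {1..n}"
    have "mat_mult (U i) (G i True True False) (G i False True True) = G i True True True"
      using block_mat_mult_ones[OF fin[OF i(2)] base[OF i(2)], of True False True]
      by (simp add: mat_scale_def)
    moreover have "mat_mult (U j) (idm j) (G j True True True) = G j True True True" if "j \<in> P"
      using block_idm(2)[OF j, of True True True] that S_P by (auto simp: gblock_def)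
    ultimately show "mat_mult (U j) (if j = i then G i True True (\<not> True) else idm j)
        (mat_mult (U j) (if j = i then G i False True (\<not> False) else idm j) (?f j)) =
      (if j \<in> set (i # is) then G j True True True else idm j)"
      using i Cons.prems idm_idem[OF j] block_idm(1)[OF j, of False True True]
      by (auto simp: gblock_def)
  qed
  finally show ?case .
qed

lemma top_nonzero: "tens n U (\<lambda>j. if j \<in> P then G j True True True else idm j) \<noteq> 0"
proof -
  let ?f = "\<lambda>j. if j \<in> P then G j True True True else idm j"
  \<comment> \<open>On \<open>S\<close> the two points must differ: the off-diagonal entry -1/k of I
    - J/k is never 0, whereas 1 - 1/k may be. On \<open>P\<close> any pair from the complement has
    entry 1, and elsewhere the base point does.\<close>
  define y where "y = (\<lambda>i\<in>{1..n}. if i \<in> S \<or> i \<in> P then pt i True else x i)"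
  define z where "z = (\<lambda>i\<in>{1..n}. if i \<in> S then pt' i else if i \<in> P then pt i True else x i)"
  have "?f i (y i) (z i) \<noteq> 0" if i: "i \<in> {1..n}" for i
  proof -
    note pts = pt[OF i] base[OF i]
    show ?thesis using S_P S_val[of i] i pts
      by (auto simp: y_def z_def idm_def block_mat_apply mat_scale_apply)
  qed
  then have "(\<Prod>i\<in>{1..n}. ?f i (y i) (z i)) \<noteq> 0"
    by (subst prod_zero_iff) auto
  moreover have "y \<in> X" "z \<in> X" using pt base by (auto simp: y_def z_def points_def)
  ultimately have "tens n U ?f y z \<noteq> 0" by (simp add: tens_def)
  then show ?thesis by (auto simp: fun_eq_iff)
qed

lemma filt_1_not_vanishes:
  assumes "s \<le> 2 * n_plus p n U"
  shows "\<not> product_vanishes blk (filt 1) s"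
proof
  assume "product_vanishes blk (filt 1) s"
  then have v: "product_vanishes blk (filt 1) (2 * n_plus p n U)"
    using product_vanishes_mono[OF ring_blk _ _ assms] filt_mono[of 0 1] by (simp add: blk_simps)
  define xs where "xs = concat (map (\<lambda>i. [raise_el i True, raise_el i False]) (sorted_list_of_set P))"
  have "length (concat (map (\<lambda>i. [raise_el i True, raise_el i False]) js)) = 2 * length js" for js
    by (induction js) auto
  then have "length xs = 2 * n_plus p n U"
    by (simp add: xs_def n_plus_def)
  moreover have "set xs \<subseteq> filt 1"
    using raise_el_filt finite_P by (auto simp: xs_def)
  ultimately have "foldr (mat_mult X) xs D = 0"
    using v unfolding product_vanishes_def blk_simps by blast
  moreover have "foldr (mat_mult X) xs D = tens n U (\<lambda>j. if j \<in> P then G j True True True else idm j)"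
    unfolding xs_def using finite_P by (subst foldr_raise) auto
  ultimately show False using top_nonzero by simp
qed

lemma nilpotent_index: "has_nilpotent_index blk (filt 1) (2 * n_plus p n U + 1)"
  using filt_1_ideal filt_1_vanishes filt_1_not_vanishes
  by (auto simp: has_nilpotent_index_def less_Suc_eq_le)

section \<open>Bases of monomials and their number\<close>

lemma scaled_basis:
  fixes sc :: "(nat \<Rightarrow> label) \<Rightarrow> 'f"
  assumes sc: "\<And>l. l \<in> Labs \<Longrightarrow> sc l \<noteq> 0" and J: "J \<subseteq> Labs"
  defines "B \<equiv> (\<lambda>l. mat_scale (sc l) (mon l)) ` J"
  shows "mat_space.independent B" "mat_space.span B = mat_space.span (mon ` J)"
    "mat_space.dim (mat_space.span B) = card J"
proof -
  have fJ: "finite J" using J finite_Labs finite_subset by blast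
  have c: "coef l (mat_scale (sc m) (mon m)) = (if l = m then sc l else 0)" if "l \<in> J" "m \<in> J" for l m
    using that J by (auto simp: coef_scale coef_mon subset_iff)
  have lin: "coef l (\<Sum>j\<in>I. mat_scale (c j) (mat_scale (sc j) (mon j))) =
      (\<Sum>j\<in>I. c j * coef l (mat_scale (sc j) (mon j)))" for l c I
    by (simp only: coef_sum coef_scale)
  have inj: "inj_on (\<lambda>l. mat_scale (sc l) (mon l)) J"
    and ind: "mat_space.independent B"
    unfolding B_def
    by (rule independent_by_functionals[where F = coef, OF fJ lin]; use c sc J in auto)+
  show "mat_space.independent B" by (rule ind)
  show "mat_space.span B = mat_space.span (mon ` J)"
    unfolding mat_space.span_eq
  proof
    show "B \<subseteq> mat_space.span (mon ` J)"
      by (auto simp: B_def intro!: mat_space.span_scale intro: mat_space.span_base)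
    show "mon ` J \<subseteq> mat_space.span B"
    proof clarify
      fix l assume l: "l \<in> J"
      have "mat_scale (inverse (sc l)) (mat_scale (sc l) (mon l)) \<in> mat_space.span B"
        by (intro mat_space.span_scale mat_space.span_base) (use l in \<open>auto simp: B_def\<close>)
      then show "mon l \<in> mat_space.span B" using sc[of l] l J by auto
    qed
  qed
  show "mat_space.dim (mat_space.span B) = card J"
    using mat_space.dim_span_eq_card_independent[OF ind] inj by (simp add: B_def card_image)
qed

lemma card_Lab: "card (Lab i) = (if i \<in> S then 1 else if i \<in> P then 5 else 4)"
proof -
  have "{(r, t, s). t \<longrightarrow> r \<and> s} = {(False, False, False), (False, False, True), (True, False, False),
      (True, False, True), (True, True, True)}" by auto
  moreover have "{(r, t, s). \<not> t} = {(False, False, False), (False, False, True), (True, False, False),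
      (True, False, True)}" by auto
  ultimately show ?thesis by (simp add: Lab_def)
qed

lemma card_Lab_0: "card {l \<in> Lab i. ldeg i l = 0} = (if i \<in> S then 1 else if i \<in> P then 2 else 4)"
proof (cases "i \<in> P")
  case True
  then have "i \<notin> S" using S_P by auto
  with True have "{l \<in> Lab i. ldeg i l = 0} = {(False, False, False), (True, False, True)}"
    by (auto simp: Lab_def split: if_splits)
  then show ?thesis using True \<open>i \<notin> S\<close> by simp
next
  case False
  then have "{l \<in> Lab i. ldeg i l = 0} = Lab i" by auto
  then show ?thesis using False card_Lab[of i] by simp
qed

lemma prod_parts:
  "(\<Prod>i\<in>{1..n}. if i \<in> S then 1 else if i \<in> P then a else b) = a ^ n_plus p n U * b ^ card W"
  for a b :: nat
proof -
  have pw: "(\<Prod>i\<in>{1..n}. if i \<in> V then c else 1) = c ^ card ({1..n} \<inter> V)" for V and c :: nat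
    by (simp add: prod.If_cases Collect_mem_eq)
  have "(\<Prod>i\<in>{1..n}. if i \<in> S then 1 else if i \<in> P then a else b) =
      (\<Prod>i\<in>{1..n}. (if i \<in> P then a else 1) * (if i \<in> W then b else 1))"
    using S_P by (intro prod.cong) auto
  also have "\<dots> = a ^ card ({1..n} \<inter> P) * b ^ card ({1..n} \<inter> W)"
    unfolding prod.distrib pw ..
  also have "{1..n} \<inter> P = P" by (auto simp: plus_part_def)
  also have "{1..n} \<inter> W = W" by auto
  finally show ?thesis by (simp add: n_plus_def)
qed

text \<open>All labels minus those of degree 0; per coordinate the two counts are 1 and 1 on
  \<open>S\<close>, 5 and 2 on \<open>P\<close>, 4 and 4 on \<open>W\<close>.\<close>

lemma card_deg_ge_1:
  "int (card {l \<in> Labs. deg l \<ge> 1}) = 4 ^ card W * 5 ^ n_plus p n U - 4 ^ card W * 2 ^ n_plus p n U"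
proof -
  have "{l \<in> Labs. deg l = 0} = PiE {1..n} (\<lambda>i. {l \<in> Lab i. ldeg i l = 0})"
    by (auto simp: Labs_def deg_def PiE_def Pi_def)
  then have 0: "card {l \<in> Labs. deg l = 0} = 2 ^ n_plus p n U * 4 ^ card W"
    by (simp only: card_PiE[OF finite_atLeastAtMost] card_Lab_0 prod_parts)
  have 1: "card Labs = 5 ^ n_plus p n U * 4 ^ card W"
    unfolding Labs_def by (simp only: card_PiE[OF finite_atLeastAtMost] card_Lab prod_parts)
  have "card Labs = card {l \<in> Labs. deg l = 0} + card {l \<in> Labs. deg l \<ge> 1}"
    by (subst card_Un_disjoint[symmetric]) (auto simp: finite_Labs intro!: arg_cong[of _ _ card])
  then have "card {l \<in> Labs. deg l = 0} + card {l \<in> Labs. deg l \<ge> 1} = card Labs" ..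
  then have "int (card {l \<in> Labs. deg l = 0}) + int (card {l \<in> Labs. deg l \<ge> 1}) = int (card Labs)"
    by linarith
  then show ?thesis unfolding 0 1 by (simp add: mult.commute del: One_nat_def)
qed

lemma card_W: "card W = n - n_plus p n U - card S"
proof -
  have "card ({1..n} - S) = n - card S"
    using S_sub by (simp add: card_Diff_subset finite_subset[OF S_sub])
  moreover have "card ({1..n} - S - P) = card ({1..n} - S) - card P"
    using S_P finite_P by (intro card_Diff_subset) (auto simp: plus_part_def)
  ultimately show ?thesis by (simp add: n_plus_def)
qed

lemma parts_le: "n_plus p n U + card S \<le> n"
proof -
  have "card (P \<union> S) \<le> card {1..n}"
    using S_sub by (intro card_mono) (auto simp: plus_part_def)
  moreover have "card (P \<union> S) = card P + card S"
    using S_P finite_P finite_subset[OF S_sub] by (intro card_Un_disjoint) auto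
  ultimately show ?thesis by (simp add: n_plus_def)
qed

text \<open>The exponent of 2 equals 2 |W| + n_+, as |W| = n - n_+ - |S|; \<open>parts_le\<close>
  guards the truncated subtractions.\<close>

lemma dim_eq:
  "int (card {l \<in> Labs. deg l \<ge> 1}) = 4 ^ (n - n_plus p n U - card S) * 5 ^ n_plus p n U
    - 2 ^ (2 * n - n_plus p n U - 2 * card S)"
proof -
  have "2 * n - n_plus p n U - 2 * card S = 2 * card W + n_plus p n U"
    using card_W parts_le by linarith
  then have "(2::int) ^ (2 * n - n_plus p n U - 2 * card S) = 4 ^ card W * 2 ^ n_plus p n U"
    by (simp add: power_add power_mult)
  then show ?thesis unfolding card_deg_ge_1 by (simp only: card_W)
qed


subsection \<open>The Terwilliger algebra\<close>

abbreviation T :: "(nat \<Rightarrow> 'u, 'f) matrix set" where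
  "T \<equiv> terwilliger_algebra n U x"

lemma prod_of_bool: "finite A \<Longrightarrow> (\<Prod>i\<in>A. of_bool (Q i)) = (of_bool (\<forall>i\<in>A. Q i) :: 'f)"
  by (induction A rule: finite_induct) auto

lemma points_eq_iff: "y \<in> X \<Longrightarrow> z \<in> X \<Longrightarrow> y = z \<longleftrightarrow> (\<forall>i\<in>{1..n}. y i = z i)"
  using PiE_ext[of y "{1..n}" U z] unfolding points_def by blast

lemma pointsD: "y \<in> X \<Longrightarrow> i \<in> {1..n} \<Longrightarrow> y i \<in> U i"
  by (auto simp: points_def)

lemma tens_of_bool:
  assumes "\<And>i y z. i \<in> {1..n} \<Longrightarrow> f i y z = of_bool (R i y z)"
  shows "tens n U f = (\<lambda>y z. of_bool (y \<in> X \<and> z \<in> X \<and> (\<forall>i\<in>{1..n}. R i (y i) (z i))) :: 'f)"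
proof (intro ext)
  fix y z
  have "(\<Prod>i\<in>{1..n}. f i (y i) (z i)) = (\<Prod>i\<in>{1..n}. of_bool (R i (y i) (z i)))"
    using assms by (intro prod.cong) auto
  then show "tens n U f y z = of_bool (y \<in> X \<and> z \<in> X \<and> (\<forall>i\<in>{1..n}. R i (y i) (z i)))"
    by (simp only: tens_def prod_of_bool[OF finite_atLeastAtMost]) auto
qed

lemma dual_idem_tens: "dual_idem n U x h = tens n U (\<lambda>i. G i (i \<in> h) False (i \<in> h))"
proof -
  have "dual_idem n U x h = (\<lambda>y z. of_bool (y \<in> X \<and> z \<in> X \<and> (\<forall>i\<in>{1..n}.
      y i \<in> U i \<and> z i \<in> U i \<and> (y i \<noteq> x i \<longleftrightarrow> i \<in> h) \<and> (z i \<noteq> x i \<longleftrightarrow> i \<in> h) \<and> (False \<or> y i = z i))) :: 'f)"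
    (is "_ = (\<lambda>y z. of_bool (?R y z))")
  proof (intro ext)
    fix y z
    have "y = z \<and> (x, y) \<in> rel n U h \<longleftrightarrow> y \<in> X \<and> z \<in> X \<and> (\<forall>i\<in>{1..n}.
      y i \<in> U i \<and> z i \<in> U i \<and> (y i \<noteq> x i \<longleftrightarrow> i \<in> h) \<and> (z i \<noteq> x i \<longleftrightarrow> i \<in> h) \<and> (False \<or> y i = z i))"
    proof
      assume *: "y = z \<and> (x, y) \<in> rel n U h"
      then have "y \<in> X" "\<forall>i\<in>{1..n}. x i \<noteq> y i \<longleftrightarrow> i \<in> h" by (auto simp: rel_def)
      with * pointsD show "?R y z" by metis
    next
      assume *: "?R y z"
      then have "y = z" using points_eq_iff[of y z] by blast
      moreover have "(x, y) \<in> rel n U h" using * x unfolding rel_def by force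
      ultimately show "y = z \<and> (x, y) \<in> rel n U h" by blast
    qed
    then show "dual_idem n U x h y z = (of_bool (y \<in> X \<and> z \<in> X \<and> (\<forall>i\<in>{1..n}.
      y i \<in> U i \<and> z i \<in> U i \<and> (y i \<noteq> x i \<longleftrightarrow> i \<in> h) \<and> (z i \<noteq> x i \<longleftrightarrow> i \<in> h) \<and> (False \<or> y i = z i))) :: 'f)"
      by (simp only: dual_idem_def)
  qed
  also have "\<dots> = tens n U (\<lambda>i. G i (i \<in> h) False (i \<in> h))"
    by (rule tens_of_bool[symmetric]) (simp only: block_mat_apply)
  finally show ?thesis .
qed

text \<open>The matrix J - I on U_i for i in \<open>h\<close> and I otherwise, written in blocks so
  that \<open>good_block\<close> applies. In J - I the entry at the base point cancels.\<close>

definition aloc :: "nat set \<Rightarrow> nat \<Rightarrow> ('u, 'f) matrix" where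
  "aloc h i = (if i \<in> h
    then G i False True True + G i True True False + G i True True True - G i True False True
    else G i False False False + G i True False True)"

lemma aloc_apply: "aloc h i y z = of_bool (y \<in> U i \<and> z \<in> U i \<and> (y \<noteq> z \<longleftrightarrow> i \<in> h))"
  by (cases "y = x i"; cases "z = x i"; cases "i \<in> h"; simp add: aloc_def block_mat_apply; blast?)

lemma good_aloc: "i \<in> {1..n} \<Longrightarrow> good i (aloc h i)"
  unfolding aloc_def by (auto intro!: good_add good_diff good_block)

lemma adj_tens: "adj n U h = tens n U (aloc h)"
proof -
  have "adj n U h = (\<lambda>y z. of_bool (y \<in> X \<and> z \<in> X \<and> (\<forall>i\<in>{1..n}.
      y i \<in> U i \<and> z i \<in> U i \<and> (y i \<noteq> z i \<longleftrightarrow> i \<in> h))) :: 'f)"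
    unfolding adj_def rel_def using pointsD by (auto simp: fun_eq_iff)
  also have "\<dots> = tens n U (aloc h)"
    by (rule tens_of_bool[symmetric]) (rule aloc_apply)
  finally show ?thesis .
qed

lemma subalgebra_T:
  fixes M N :: "(nat \<Rightarrow> 'u, 'f) matrix"
  shows "h \<in> EE n \<Longrightarrow> adj n U h \<in> T"
    and "h \<in> EE n \<Longrightarrow> dual_idem n U x h \<in> T"
    and "M \<in> T \<Longrightarrow> N \<in> T \<Longrightarrow> mat_mult X M N \<in> T"
    and "M \<in> T \<Longrightarrow> N \<in> T \<Longrightarrow> M + N \<in> T"
    and "0 \<in> T"
    and "M \<in> T \<Longrightarrow> mat_scale c M \<in> T"
proof -
  let ?A = "matrix_algebra X :: ('f, (nat \<Rightarrow> 'u, 'f) matrix) module"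
  let ?I = "{V. is_subalgebra V ?A \<and> adj n U ` EE n \<union> dual_idem n U x ` EE n \<subseteq> V}"
  have T: "T = \<Inter>?I" by (simp only: terwilliger_algebra_def generated_subalgebra_def)
  have sub: "mat_mult X M N \<in> V" "M + N \<in> V" "mat_scale c M \<in> V"
    if "V \<in> ?I" "M \<in> V" "N \<in> V" for V M N c
    using that subringE(6,7)[of V ?A M N] by (auto simp: is_subalgebra_def matrix_algebra_def)
  have zero: "0 \<in> V" if "V \<in> ?I" for V
    using that subringE(2)[of V ?A] by (auto simp: is_subalgebra_def matrix_algebra_def)
  have gen: "V \<in> ?I \<Longrightarrow> adj n U ` EE n \<union> dual_idem n U x ` EE n \<subseteq> V" for V by simp
  show "adj n U h \<in> T" if "h \<in> EE n" unfolding T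
    by (rule InterI, drule gen) (use that in blast)
  show "dual_idem n U x h \<in> T" if "h \<in> EE n" unfolding T
    by (rule InterI, drule gen) (use that in blast)
  show "mat_mult X M N \<in> T" if "M \<in> T" "N \<in> T"
    using that unfolding T by (intro InterI sub(1)) (assumption | erule InterD)+
  show "M + N \<in> T" if "M \<in> T" "N \<in> T"
    using that unfolding T by (intro InterI sub(2)) (assumption | erule InterD)+
  show "0 \<in> T" unfolding T by (intro InterI zero)
  show "mat_scale c M \<in> T" if "M \<in> T"
    using that unfolding T by (intro InterI sub(3)) (assumption | erule InterD)+
qed

lemma sum_T: "(\<And>i. i \<in> I \<Longrightarrow> M i \<in> T) \<Longrightarrow> (\<Sum>i\<in>I. M i) \<in> T"
proof (induction I rule: infinite_finite_induct)
  case (insert i I)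
  then show ?case using subalgebra_T(4)[of "M i" "sum M I"] by (metis insert_iff sum.insert)
next
  case (infinite I)
  then show ?case using subalgebra_T(5) by (metis sum.infinite)
qed (simp only: sum.empty subalgebra_T(5))

text \<open>The matrices that commute with \<open>D\<close> and are sent by it into
  \<open>filt 0\<close> form a subalgebra. It contains the generators, which are tensor products of
  good local factors, and hence all of \<open>T\<close>.\<close>

lemma T_D:
  assumes "M \<in> T"
  shows "mat_mult X M D \<in> filt 0"
proof -
  let ?A = "matrix_algebra X :: ('f, (nat \<Rightarrow> 'u, 'f) matrix) module"
  interpret ring ?A by (rule ring_matrix_algebra[OF finite_X])
  let ?S = "{M \<in> carrier ?A. mat_mult X M D = mat_mult X D M \<and> mat_mult X M D \<in> filt 0}"
  have simps: "mult ?A = mat_mult X" "add ?A = (+)" "smult ?A = mat_scale"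
    by (simp_all add: matrix_algebra_def)
  have "subring ?S ?A"
  proof (rule subringI)
    have "D \<in> carrier ?A" using D_filt filt_carrier by blast
    then have "mat_mult X \<one>\<^bsub>?A\<^esub> D = D" "mat_mult X D \<one>\<^bsub>?A\<^esub> = D"
      using l_one r_one unfolding simps by auto
    then show "\<one>\<^bsub>?A\<^esub> \<in> ?S" using D_filt one_closed by auto
  next
    fix M assume M: "M \<in> ?S"
    then have "\<ominus>\<^bsub>?A\<^esub> M = - M" using matrix_algebra_minus by blast
    moreover have "\<ominus>\<^bsub>?A\<^esub> M \<in> carrier ?A" using M by blast
    ultimately show "\<ominus>\<^bsub>?A\<^esub> M \<in> ?S"
      using M by (auto simp: mat_mult_uminus_left mat_mult_uminus_right filt_closed)
  next
    fix M N assume M: "M \<in> ?S" and N: "N \<in> ?S"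
    \<comment> \<open>\<open>D\<close> is the identity on \<open>filt 0\<close>, so it may be
      inserted between \<open>M\<close> and the product of \<open>N\<close> with
      \<open>D\<close>.\<close>
    have 1: "mat_mult X (mat_mult X M N) D = mat_mult X (mat_mult X M D) (mat_mult X N D)"
    proof -
      have "mat_mult X (mat_mult X M D) (mat_mult X N D) = mat_mult X M (mat_mult X D (mat_mult X N D))"
        by (simp only: mat_mult_assoc)
      also have "mat_mult X D (mat_mult X N D) = mat_mult X N D"
        using N by (intro D_mult) auto
      finally show ?thesis by (simp only: mat_mult_assoc)
    qed
    have 2: "mat_mult X (mat_mult X M N) D = mat_mult X D (mat_mult X M N)"
    proof -
      have "mat_mult X (mat_mult X M N) D = mat_mult X M (mat_mult X D N)"
        using N by (simp only: mat_mult_assoc) auto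
      also have "\<dots> = mat_mult X (mat_mult X D M) N"
        using M by (simp only: mat_mult_assoc[symmetric]) auto
      finally show ?thesis by (simp only: mat_mult_assoc)
    qed
    have "M \<otimes>\<^bsub>?A\<^esub> N \<in> carrier ?A" using M N by blast
    moreover have "mat_mult X (mat_mult X M N) D \<in> filt 0"
      unfolding 1 using M N filt_mult[of _ 0 _ 0] by auto
    ultimately show "M \<otimes>\<^bsub>?A\<^esub> N \<in> ?S" using 2 unfolding simps by blast
    have "M \<oplus>\<^bsub>?A\<^esub> N \<in> carrier ?A" using M N by blast
    then show "M \<oplus>\<^bsub>?A\<^esub> N \<in> ?S"
      using M N unfolding simps
      by (auto simp: mat_mult_add_left mat_mult_add_right filt_closed)
  qed auto
  moreover have "c \<odot>\<^bsub>?A\<^esub> M \<in> ?S" if M: "M \<in> ?S" for c M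
  proof -
    have "mat_scale c M \<in> carrier ?A" using M by (auto simp: matrix_algebra_def mat_scale_def)
    then show ?thesis using M unfolding simps
      by (auto simp: mat_mult_scale_left mat_mult_scale_right filt_closed)
  qed
  ultimately have sub: "is_subalgebra ?S ?A" unfolding is_subalgebra_def by blast
  have tens: "tens n U f \<in> ?S" if "\<And>i. i \<in> {1..n} \<Longrightarrow> good i (f i)" for f
    using good_tens[OF that] by (auto simp: matrix_algebra_def tens_def)
  have "adj n U ` EE n \<union> dual_idem n U x ` EE n \<subseteq> ?S"
    unfolding adj_tens dual_idem_tens by (intro Un_least image_subsetI tens good_aloc good_block)
  then have "M \<in> ?S"
    using assms sub unfolding terwilliger_algebra_def generated_subalgebra_def by blast
  then show ?thesis by blast
qed

lemma BB_T: "a \<in> EE n \<Longrightarrow> b \<in> EE n \<Longrightarrow> c \<in> EE n \<Longrightarrow> BB n U x a b c \<in> T"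
  unfolding BB_def by (rule sum_T, rule subalgebra_T(3), rule subalgebra_T(3))
    (use subalgebra_T(1,2) in \<open>auto simp: EE_def\<close>)

text \<open>The sum over all \<open>j\<close> between the symmetric difference and \<open>b\<close>
  decouples: a coordinate in \<open>b\<close> may agree or differ, one outside \<open>b\<close> must
  agree.\<close>

lemma BB_tens:
  assumes a: "a \<in> EE n" and b: "b \<in> EE n" and c: "c \<in> EE n" and sub: "sdiff a c \<subseteq> b"
  shows "BB n U x a b c = tens n U (\<lambda>i. G i (i \<in> a) (i \<in> b) (i \<in> c))"
proof -
  let ?J = "{j. sdiff a c \<subseteq> j \<and> j \<subseteq> b}"
  have fb: "finite b" using b finite_subset by (auto simp: EE_def)
  have fJ: "finite ?J" by (rule finite_subset[of _ "Pow b"]) (use fb in auto)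
  have loc: "mat_mult (U i) (mat_mult (U i) (G i r False r) (aloc j i)) (G i s False s) y z =
      of_bool (y \<in> U i \<and> z \<in> U i \<and> (y \<noteq> x i \<longleftrightarrow> r) \<and> (z \<noteq> x i \<longleftrightarrow> s) \<and> (y \<noteq> z \<longleftrightarrow> i \<in> j))"
    if i: "i \<in> {1..n}" for i r s j y z
  proof -
    have l: "mat_mult (U i) (G i r False r) M y z = of_bool (y \<in> U i \<and> (y \<noteq> x i \<longleftrightarrow> r)) * M y z" for M y z
    proof -
      have "mat_mult (U i) (G i r False r) M y z =
          (\<Sum>w\<in>U i. if w = y then of_bool (y \<in> U i \<and> (y \<noteq> x i \<longleftrightarrow> r)) * M y z else 0)"
        unfolding mat_mult_def by (intro sum.cong) (auto simp: block_mat_apply)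
      then show ?thesis using fin[OF i] by (auto simp: sum.delta)
    qed
    have r: "mat_mult (U i) M (G i s False s) y z = of_bool (z \<in> U i \<and> (z \<noteq> x i \<longleftrightarrow> s)) * M y z" for M y z
    proof -
      have "mat_mult (U i) M (G i s False s) y z =
          (\<Sum>w\<in>U i. if w = z then of_bool (z \<in> U i \<and> (z \<noteq> x i \<longleftrightarrow> s)) * M y z else 0)"
        unfolding mat_mult_def by (intro sum.cong) (auto simp: block_mat_apply)
      then show ?thesis using fin[OF i] by (auto simp: sum.delta)
    qed
    show ?thesis unfolding l r aloc_apply by auto
  qed
  have trm: "mat_mult X (mat_mult X (dual_idem n U x a) (adj n U j)) (dual_idem n U x c) =
    (\<lambda>y z. of_bool (y \<in> X \<and> z \<in> X \<and> (\<forall>i\<in>{1..n}. y i \<in> U i \<and> z i \<in> U i \<and> (y i \<noteq> x i \<longleftrightarrow> i \<in> a) \<and>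
      (z i \<noteq> x i \<longleftrightarrow> i \<in> c) \<and> (y i \<noteq> z i \<longleftrightarrow> i \<in> j))) :: 'f)" for j
    unfolding dual_idem_tens adj_tens tens_mult[OF finU] by (rule tens_of_bool) (rule loc)
  have "BB n U x a b c = (\<lambda>y z. of_bool (y \<in> X \<and> z \<in> X \<and> (\<forall>i\<in>{1..n}. y i \<in> U i \<and> z i \<in> U i \<and>
      (y i \<noteq> x i \<longleftrightarrow> i \<in> a) \<and> (z i \<noteq> x i \<longleftrightarrow> i \<in> c) \<and> (i \<in> b \<or> y i = z i))) :: 'f)"
    (is "_ = (\<lambda>y z. of_bool (?Q y z))")
  proof (intro ext)
    fix y z :: "nat \<Rightarrow> 'u"
    \<comment> \<open>A pair (y, z) lies in one relation only, so the single contributing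
      \<open>j\<close> is this set.\<close>
    let ?d = "{i \<in> {1..n}. y i \<noteq> z i}"
    let ?R = "\<lambda>j. y \<in> X \<and> z \<in> X \<and> (\<forall>i\<in>{1..n}. y i \<in> U i \<and> z i \<in> U i \<and> (y i \<noteq> x i \<longleftrightarrow> i \<in> a) \<and>
      (z i \<noteq> x i \<longleftrightarrow> i \<in> c) \<and> (y i \<noteq> z i \<longleftrightarrow> i \<in> j))"
    have J: "?R j \<longleftrightarrow> j = ?d \<and> ?Q y z" if "j \<in> ?J" for j
      using that b unfolding EE_def by blast
    have d: "?d \<in> ?J" if "?Q y z"
      using that a c unfolding EE_def sdiff_def by (auto; metis)
    have "BB n U x a b c y z = (\<Sum>j\<in>?J. of_bool (?R j) :: 'f)"
      unfolding BB_def trm sum_matrix_apply ..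
    also have "\<dots> = (\<Sum>j\<in>?J. if j = ?d then of_bool (?Q y z) else 0 :: 'f)"
      using J by (intro sum.cong) auto
    also have "\<dots> = of_bool (?Q y z)" using d fJ by (auto simp: sum.delta)
    finally show "BB n U x a b c y z = (of_bool (?Q y z) :: 'f)" .
  qed
  also have "\<dots> = tens n U (\<lambda>i. G i (i \<in> a) (i \<in> b) (i \<in> c))"
    by (rule tens_of_bool[symmetric]) (simp only: block_mat_apply)
  finally show ?thesis .
qed


subsection \<open>Block idempotents and the basis\<close>

lemma dvd_iff: "p dvd m \<longleftrightarrow> of_nat m = (0 :: 'f)"
  by (simp add: p of_nat_eq_0_iff_char_dvd)

lemma of_nat_kk: "of_nat (kk U q) = (\<Prod>i\<in>q. val i)"
  by (simp add: kk_def val_def of_nat_prod)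

lemma dvd_kk: "finite q \<Longrightarrow> p dvd kk U q \<longleftrightarrow> (\<exists>i\<in>q. val i = 0)"
  by (simp add: dvd_iff of_nat_kk)

lemma minus_part_iff: "i \<in> minus_part p U a \<longleftrightarrow> i \<in> a \<and> card (U i) \<noteq> 2 \<and> val i \<noteq> 0"
  by (simp add: minus_part_def val_eq_0_iff)

text \<open>The complement of the base point is one point, so I and J coincide. This reconciles i in
  a but not in b, where B has the factor I, with the factor J/k of the block idempotent.\<close>

lemma card_2:
  assumes i: "i \<in> {1..n}" and 2: "card (U i) = 2"
  shows "val i = 1" "G i True False True = G i True True True"
proof -
  show "val i = 1" using 2 by (simp add: val_def)
  have "card (U i - {x i}) = 1" using 2 fin[OF i] base[OF i] by simp
  then obtain s where "U i - {x i} = {s}" by (auto simp: card_1_singleton_iff)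
  then have "y = s" if "y \<in> U i" "y \<noteq> x i" for y
    using that by (metis DiffI singletonD)
  then have "y = z" if "y \<in> U i" "z \<in> U i" "y \<noteq> x i" "z \<noteq> x i" for y z
    using that by metis
  then show "G i True False True = G i True True True"
    by (intro ext) (auto simp: block_mat_apply)
qed

definition cls :: "(nat set \<times> nat set \<times> nat set) set" where
  "cls = {(a, b, c). (a, b, c) \<in> diag_triples p n U \<and> minus_part p U a - b = S}"

text \<open>As p does not divide k_b and b avoids two-point coordinates, b lies in a^-; then a^- - b
  = S determines b from a. The class is indexed by the sets a containing \<open>S\<close>.\<close>

lemma cls_iff:
  "(a, b, c) \<in> cls \<longleftrightarrow> c = a \<and> S \<subseteq> a \<and> a \<subseteq> {1..n} \<and> b = minus_part p U a - S"
proof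
  assume "(a, b, c) \<in> cls"
  then have ab: "c = a" "a \<subseteq> {1..n}" "b \<subseteq> circ_part U a" "\<not> p dvd kk U b" "minus_part p U a - b = S"
    by (auto simp: cls_def diag_triples_def PP_def EE_def sdiff_def)
  have "b \<subseteq> a" using ab(3) by (auto simp: circ_part_def)
  then have "finite b" using ab(2) finite_subset by (meson finite_atLeastAtMost)
  then have "\<forall>i\<in>b. val i \<noteq> 0" using ab(4) dvd_kk by blast
  then have "b \<subseteq> minus_part p U a"
    using ab(3) by (auto simp: minus_part_iff circ_part_def)
  then show "c = a \<and> S \<subseteq> a \<and> a \<subseteq> {1..n} \<and> b = minus_part p U a - S"
    using ab by (auto simp: minus_part_iff)
next
  assume ab: "c = a \<and> S \<subseteq> a \<and> a \<subseteq> {1..n} \<and> b = minus_part p U a - S"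
  then have "b \<subseteq> {1..n}" by (auto simp: minus_part_iff)
  then have "finite b" using finite_subset by blast
  moreover have "\<forall>i\<in>b. val i \<noteq> 0" using ab by (auto simp: minus_part_iff)
  ultimately have "\<not> p dvd kk U b" using dvd_kk by blast
  moreover have "minus_part p U a - b = S"
    using ab S_val S_card by (auto simp: minus_part_iff)
  ultimately show "(a, b, c) \<in> cls"
    using ab by (auto simp: cls_def diag_triples_def PP_def EE_def sdiff_def circ_part_def minus_part_iff)
qed

text \<open>The admissible q are b \<union> Q with Q inside \<open>S\<close>. A coordinate of
  \<open>S\<close> contributes I outside Q and -J/k inside, which sum to I - J/k; one in b
  contributes J/k. The remaining coordinates of a keep I: there either k = 0 in the field, or |U_i|
  = 2 and I = J/k.\<close>

lemma DD_diag:
  assumes a: "S \<subseteq> a" "a \<subseteq> {1..n}" and b: "b = minus_part p U a - S"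
  shows "DD p n U x a b a = tens n U (\<lambda>i. if i \<in> S then idm i else
    if i \<in> a then if i \<in> P then G i True False True else mat_scale (inverse (val i)) (G i True True True)
    else G i False True False)" (is "_ = tens n U (\<lambda>i. if i \<in> S then idm i else ?h i)")
proof -
  have b_sub: "b \<subseteq> {1..n}" "b \<subseteq> a" "b \<inter> S = {}" using a b by (auto simp: minus_part_iff)
  have fb: "finite b" and fS: "finite S"
    using b_sub(1) S_sub finite_subset by (meson finite_atLeastAtMost)+
  have idx: "{q. q \<in> EE n \<and> b \<subseteq> q \<and> q \<subseteq> sdiff a a \<union> circ_part U (a \<inter> a) \<and> \<not> p dvd kk U q} =
      (\<lambda>Q. b \<union> Q) ` Pow S" (is "?L = ?R")
  proof (intro equalityI subsetI)
    fix q assume q: "q \<in> ?L"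
    then have "finite q" using finite_subset[of q "{1..n}"] by (auto simp: EE_def)
    then have "\<forall>i\<in>q. val i \<noteq> 0" using q dvd_kk by blast
    then have "q \<subseteq> minus_part p U a"
      using q by (auto simp: minus_part_iff sdiff_def circ_part_def)
    then have "q = b \<union> (q \<inter> S)" using q b by auto
    then show "q \<in> ?R" by blast
  next
    fix q assume "q \<in> ?R"
    then obtain Q where Q: "Q \<subseteq> S" "q = b \<union> Q" by auto
    have "\<forall>i\<in>q. val i \<noteq> 0" using Q b S_val by (auto simp: minus_part_iff)
    moreover have "finite q" using Q fb fS finite_subset by auto
    ultimately have "\<not> p dvd kk U q" using dvd_kk by blast
    then show "q \<in> ?L"
      using Q a b S_card by (auto simp: EE_def circ_part_def minus_part_iff)
  qed
  have inj: "inj_on (\<lambda>Q. b \<union> Q) (Pow S)" using b_sub(3) by (intro inj_onI) blast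
  have trm: "mat_scale ((- 1) ^ card ((b \<union> Q) - b) * inverse (of_nat (kk U (a \<inter> (b \<union> Q)))))
      (BB n U x a (b \<union> Q) a) =
    tens n U (\<lambda>i. if i \<in> S then if i \<in> Q then mat_scale (- inverse (val i)) (G i True True True)
      else G i True False True else ?h i)" if Q: "Q \<in> Pow S" for Q
  proof -
    have Q': "Q \<subseteq> S" "Q \<inter> b = {}" "(b \<union> Q) - b = Q" "a \<inter> (b \<union> Q) = b \<union> Q" "Q \<subseteq> {1..n}"
      using Q b_sub a by auto
    have fQ: "finite Q" using Q'(1) fS finite_subset by blast
    \<comment> \<open>The sign and the inverse of k_{b \<union> Q}, distributed over the
      coordinates.\<close>
    let ?c = "\<lambda>i. if i \<in> Q then - inverse (val i) else if i \<in> b then inverse (val i) else 1"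
    have "(\<Prod>i\<in>{1..n}. ?c i) = (\<Prod>i\<in>b \<union> Q. ?c i)"
      using b_sub(1) Q'(5) by (intro prod.mono_neutral_right) auto
    also have "\<dots> = (\<Prod>i\<in>b. ?c i) * (\<Prod>i\<in>Q. ?c i)"
      using fb fQ Q'(2) by (intro prod.union_disjoint) auto
    also have "(\<Prod>i\<in>b. ?c i) = (\<Prod>i\<in>b. inverse (val i))"
      using Q'(2) by (intro prod.cong) auto
    also have "(\<Prod>i\<in>Q. ?c i) = (\<Prod>i\<in>Q. (- 1) * inverse (val i))"
      by (intro prod.cong) auto
    also have "\<dots> = (- 1) ^ card Q * (\<Prod>i\<in>Q. inverse (val i))"
      by (simp only: prod.distrib prod_constant)
    finally have "(\<Prod>i\<in>{1..n}. ?c i) = (- 1) ^ card Q * inverse (of_nat (kk U (b \<union> Q)))"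
      using fb fQ Q'(2) by (simp add: of_nat_kk prod.union_disjoint Int_commute prod_inversef[unfolded o_def] mult_ac)
    then have s: "(- 1) ^ card ((b \<union> Q) - b) * inverse (of_nat (kk U (a \<inter> (b \<union> Q)))) = (\<Prod>i\<in>{1..n}. ?c i)"
      unfolding Q'(3,4) by simp
    have B: "BB n U x a (b \<union> Q) a = tens n U (\<lambda>i. G i (i \<in> a) (i \<in> b \<union> Q) (i \<in> a))"
      using a b_sub(1) Q'(5) by (intro BB_tens) (auto simp: EE_def sdiff_def)
    show ?thesis
      unfolding s B tens_scale
    proof (rule tens_cong)
      fix i assume i: "i \<in> {1..n}"
      have one: "mat_scale 1 M = M" for M :: "('u, 'f) matrix" by (simp add: mat_scale_def)
      consider "i \<in> S" | "i \<notin> a" | "i \<notin> S" "i \<in> a" "i \<in> P" | "i \<notin> S" "i \<in> a" "i \<notin> P" "i \<in> b"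
        | "i \<notin> S" "i \<in> a" "i \<notin> P" "i \<notin> b" by blast
      then show "mat_scale (?c i) (G i (i \<in> a) (i \<in> b \<union> Q) (i \<in> a)) =
        (if i \<in> S then if i \<in> Q then mat_scale (- inverse (val i)) (G i True True True)
          else G i True False True else ?h i)"
      proof cases
        case 1
        then have "i \<in> a" "i \<notin> b" using a b_sub by auto
        then show ?thesis using 1 one by auto
      next
        case 2
        then have "i \<notin> S" "i \<notin> b" "i \<notin> Q" using a b_sub Q' by auto
        then show ?thesis using 2 one by (simp add: block_mat_base[of _ _ False])
      next
        case 3
        then have "i \<notin> b" "i \<notin> Q" using b Q' P_iff by (auto simp: minus_part_iff)
        then show ?thesis using 3 one by simp
      next
        case 4
        then have "i \<notin> Q" using Q' by auto
        then show ?thesis using 4 by simp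
      next
        case 5
        then have "i \<notin> Q" "card (U i) = 2" using Q' i b P_iff by (auto simp: minus_part_iff)
        then show ?thesis using 5 one card_2[OF i] by simp
      qed
    qed
  qed
  have "DD p n U x a b a = (\<Sum>Q\<in>Pow S. tens n U (\<lambda>i. if i \<in> S
      then if i \<in> Q then mat_scale (- inverse (val i)) (G i True True True) else G i True False True else ?h i))"
    unfolding DD_def idx sum.reindex[OF inj] o_def using trm by (rule sum.cong[OF refl])
  also have "\<dots> = tens n U (\<lambda>i. if i \<in> S
      then mat_scale (- inverse (val i)) (G i True True True) + G i True False True else ?h i)"
    by (rule tens_add_Pow[OF S_sub, symmetric])
  also have "\<dots> = tens n U (\<lambda>i. if i \<in> S then idm i else ?h i)"
    by (rule tens_cong) (auto simp: idm_def mat_scale_def fun_eq_iff)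
  finally show ?thesis .
qed

text \<open>With a = S \<union> Q each coordinate outside \<open>S\<close> lies in a or not,
  independently. Summing over Q adds the base point idempotent to the factor on the complement,
  which gives \<open>idm\<close>.\<close>

lemma block_idem_cls: "block_idem p n U x cls = D"
proof -
  let ?V = "{1..n} - S"
  let ?f = "\<lambda>i. if i \<in> P then G i True False True else mat_scale (inverse (val i)) (G i True True True)"
  let ?g = "\<lambda>i. G i False True False"
  have cls: "cls = (\<lambda>Q. (S \<union> Q, minus_part p U (S \<union> Q) - S, S \<union> Q)) ` Pow ?V"
  proof (intro equalityI subsetI)
    fix v assume "v \<in> cls"
    then obtain a b c where v: "v = (a, b, c)" and "(a, b, c) \<in> cls" by (cases v) simp
    then have "c = a \<and> S \<subseteq> a \<and> a \<subseteq> {1..n} \<and> b = minus_part p U a - S"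
      by (simp only: cls_iff)
    then have "S \<subseteq> a" "a \<subseteq> {1..n}" "b = minus_part p U a - S" "c = a" by simp_all
    moreover have "S \<union> (a - S) = a" using \<open>S \<subseteq> a\<close> by blast
    ultimately show "v \<in> (\<lambda>Q. (S \<union> Q, minus_part p U (S \<union> Q) - S, S \<union> Q)) ` Pow ?V"
      unfolding v by (intro image_eqI[of _ _ "a - S"]) auto
  qed (use S_sub in \<open>auto simp: cls_iff\<close>)
  have inj: "inj_on (\<lambda>Q. (S \<union> Q, minus_part p U (S \<union> Q) - S, S \<union> Q)) (Pow ?V)"
    by (intro inj_onI) blast
  have "block_idem p n U x cls = (\<Sum>Q\<in>Pow ?V. DD p n U x (S \<union> Q) (minus_part p U (S \<union> Q) - S) (S \<union> Q))"
    unfolding block_idem_def cls sum.reindex[OF inj] by (simp add: o_def)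
  also have "\<dots> = (\<Sum>Q\<in>Pow ?V. tens n U (\<lambda>i. if i \<in> ?V then if i \<in> Q then ?f i else ?g i else idm i))"
  proof (intro sum.cong refl)
    fix Q assume Q: "Q \<in> Pow ?V"
    then have "DD p n U x (S \<union> Q) (minus_part p U (S \<union> Q) - S) (S \<union> Q) =
      tens n U (\<lambda>i. if i \<in> S then idm i else if i \<in> S \<union> Q then ?f i else ?g i)"
      using S_sub by (intro DD_diag) auto
    also have "\<dots> = tens n U (\<lambda>i. if i \<in> ?V then if i \<in> Q then ?f i else ?g i else idm i)"
      by (rule tens_cong) auto
    finally show "DD p n U x (S \<union> Q) (minus_part p U (S \<union> Q) - S) (S \<union> Q) =
      tens n U (\<lambda>i. if i \<in> ?V then if i \<in> Q then ?f i else ?g i else idm i)" .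
  qed
  also have "\<dots> = tens n U (\<lambda>i. if i \<in> ?V then ?f i + ?g i else idm i)"
    by (rule tens_add_Pow[symmetric]) auto
  also have "\<dots> = D"
    unfolding D_def by (rule tens_cong) (auto simp: idm_def add.commute)
  finally show ?thesis .
qed

text \<open>On \<open>W\<close> the matrix B has the row of ones where \<open>loc\<close> has it
  divided by k. If row and column both avoid the base point, the block of B is I, which the
  idempotent turns into J/k, and no correction arises.\<close>

definition scal :: "(nat \<Rightarrow> label) \<Rightarrow> 'f" where
  "scal l = (\<Prod>i\<in>{1..n}. if i \<in> W \<and> \<not> fst (l i) \<and> snd (snd (l i)) then val i else 1)"

lemma scal_nonzero: "scal l \<noteq> 0"
  unfolding scal_def using P_iff by (subst prod_zero_iff) auto

definition labt :: "nat set \<Rightarrow> nat set \<Rightarrow> nat set \<Rightarrow> nat \<Rightarrow> label" where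
  "labt a b c = (\<lambda>i\<in>{1..n}. (i \<in> a, i \<in> b, i \<in> c))"

text \<open>The bridge from the matrices of the theorem to the monomials, checked one coordinate at
  a time with \<open>block_idm\<close>.\<close>

lemma BB_D:
  assumes a: "S \<subseteq> a" "a \<subseteq> {1..n}" and c: "S \<subseteq> c" "c \<subseteq> {1..n}" and b: "b \<subseteq> a \<inter> c \<inter> P"
  shows "mat_mult X (BB n U x a (sdiff a c \<union> b) c) D = mat_scale (scal (labt a b c)) (mon (labt a b c))"
proof -
  have "BB n U x a (sdiff a c \<union> b) c = tens n U (\<lambda>i. G i (i \<in> a) (i \<in> sdiff a c \<union> b) (i \<in> c))"
    using a c b by (intro BB_tens) (auto simp: EE_def sdiff_def)
  then have "mat_mult X (BB n U x a (sdiff a c \<union> b) c) D =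
      tens n U (\<lambda>i. mat_mult (U i) (G i (i \<in> a) (i \<in> sdiff a c \<union> b) (i \<in> c)) (idm i))"
    unfolding D_def by (simp only: tens_mult[OF finU])
  also have "\<dots> = mat_scale (scal (labt a b c)) (mon (labt a b c))"
    unfolding scal_def mon_def tens_scale
  proof (rule tens_cong)
    fix i assume i: "i \<in> {1..n}"
    have l: "labt a b c i = (i \<in> a, i \<in> b, i \<in> c)" using i by (simp add: labt_def)
    have one: "mat_scale 1 M = M" for M :: "('u, 'f) matrix" by (simp add: mat_scale_def)
    consider "i \<in> S" "i \<notin> P" | "i \<in> P" "i \<notin> S" | "i \<in> W" using i S_P by blast
    then show "mat_mult (U i) (G i (i \<in> a) (i \<in> sdiff a c \<union> b) (i \<in> c)) (idm i) =
      mat_scale (if i \<in> W \<and> \<not> fst (labt a b c i) \<and> snd (snd (labt a b c i)) then val i else 1)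
        (loc i (labt a b c i))"
      unfolding block_idm(1)[OF i] l
    proof cases
      case 1
      then have "i \<in> a" "i \<in> c" "i \<notin> b" "i \<notin> sdiff a c" using a c b by (auto simp: sdiff_def)
      then show "gblock i (i \<in> a) (i \<in> sdiff a c \<union> b) (i \<in> c) =
        mat_scale (if i \<in> W \<and> \<not> fst (i \<in> a, i \<in> b, i \<in> c) \<and> snd (snd (i \<in> a, i \<in> b, i \<in> c)) then val i else 1)
          (loc i (i \<in> a, i \<in> b, i \<in> c))"
        using 1 one by (simp add: gblock_def)
    next
      case 2
      then show "gblock i (i \<in> a) (i \<in> sdiff a c \<union> b) (i \<in> c) =
        mat_scale (if i \<in> W \<and> \<not> fst (i \<in> a, i \<in> b, i \<in> c) \<and> snd (snd (i \<in> a, i \<in> b, i \<in> c)) then val i else 1)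
          (loc i (i \<in> a, i \<in> b, i \<in> c))"
        using one by (simp add: gblock_def sdiff_def) (rule arg_cong[of _ _ "\<lambda>t. G i _ t _"], blast)
    next
      case 3
      then have "i \<notin> S" "i \<notin> P" "val i \<noteq> 0" "i \<notin> b" using P_iff b by auto
      then show "gblock i (i \<in> a) (i \<in> sdiff a c \<union> b) (i \<in> c) =
        mat_scale (if i \<in> W \<and> \<not> fst (i \<in> a, i \<in> b, i \<in> c) \<and> snd (snd (i \<in> a, i \<in> b, i \<in> c)) then val i else 1)
          (loc i (i \<in> a, i \<in> b, i \<in> c))"
        using 3 i one by (cases "i \<in> a"; cases "i \<in> c")
          (simp_all add: gblock_def sdiff_def block_mat_base[of _ _ False])
    qed
  qed
  finally show ?thesis .
qed

lemma Labs_labt: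
  assumes "l \<in> Labs"
  obtains a b c where "S \<subseteq> a" "a \<subseteq> {1..n}" "S \<subseteq> c" "c \<subseteq> {1..n}" "b \<subseteq> a \<inter> c \<inter> P" "l = labt a b c"
proof
  let ?a = "{i \<in> {1..n}. fst (l i)}" and ?b = "{i \<in> {1..n}. fst (snd (l i))}"
    and ?c = "{i \<in> {1..n}. snd (snd (l i))}"
  have L: "l i \<in> Lab i" if "i \<in> {1..n}" for i using LabsD[OF assms that] .
  have LS: "l i = (True, False, True)" if "i \<in> S" for i
    using L[of i] that S_sub by (auto simp: Lab_def)
  show "S \<subseteq> ?a" "S \<subseteq> ?c" using LS S_sub by auto
  have "i \<in> ?a \<and> i \<in> ?c \<and> i \<in> P" if "i \<in> ?b" for i
    using L[of i] that by (cases "l i") (auto simp: Lab_def split: if_splits)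
  then show "?b \<subseteq> ?a \<inter> ?c \<inter> P" by blast
  show "l = labt ?a ?b ?c"
  proof
    fix i
    show "l i = labt ?a ?b ?c i"
      using assms by (cases "i \<in> {1..n}") (auto simp: labt_def Labs_def PiE_def extensional_def)
  qed
qed auto

lemma labt_Labs:
  assumes "S \<subseteq> a" "S \<subseteq> c" "b \<subseteq> a \<inter> c \<inter> P"
  shows "labt a b c \<in> Labs"
  using assms S_P by (auto simp: labt_def Labs_def Lab_def)

text \<open>The right-hand side says that the symmetric difference of a and c together with b meets
  \<open>P\<close>, that is, p divides its k. This is the source of the divisibility condition in
  the basis.\<close>

lemma deg_labt: "deg (labt a b c) \<ge> 1 \<longleftrightarrow> (\<exists>i\<in>P. i \<in> b \<or> (i \<in> a \<longleftrightarrow> i \<notin> c))"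
proof -
  have "deg (labt a b c) = 0 \<longleftrightarrow> (\<forall>i\<in>{1..n}. ldeg i (labt a b c i) = 0)"
    by (simp add: deg_def)
  also have "\<dots> \<longleftrightarrow> (\<forall>i\<in>P. \<not> (i \<in> b \<or> (i \<in> a \<longleftrightarrow> i \<notin> c)))"
    using P_iff by (auto simp: labt_def)
  finally have "deg (labt a b c) = 0 \<longleftrightarrow> \<not> (\<exists>i\<in>P. i \<in> b \<or> (i \<in> a \<longleftrightarrow> i \<notin> c))" by blast
  then show ?thesis by linarith
qed

text \<open>One inclusion is \<open>T_D\<close>. For the other, \<open>BB_D\<close> exhibits every
  monomial as a rescaled B D with B in \<open>T\<close>.\<close>

lemma block_carrier: "{mat_mult X M D |M. M \<in> T} = filt 0"
proof (intro equalityI subsetI)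
  fix Y assume "Y \<in> {mat_mult X M D |M. M \<in> T}"
  then show "Y \<in> filt 0" using T_D by auto
next
  fix Y assume "Y \<in> filt 0"
  then have "Y = (\<Sum>l\<in>Labs. mat_scale (coef l Y) (mon l))"
    unfolding filt_0 by (rule expand) auto
  moreover have "\<exists>M. M \<in> T \<and> mat_mult X M D = mon l" if "l \<in> Labs" for l
  proof -
    obtain a b c where abc: "S \<subseteq> a" "a \<subseteq> {1..n}" "S \<subseteq> c" "c \<subseteq> {1..n}" "b \<subseteq> a \<inter> c \<inter> P" "l = labt a b c"
      using Labs_labt[OF \<open>l \<in> Labs\<close>] .
    let ?M = "mat_scale (inverse (scal l)) (BB n U x a (sdiff a c \<union> b) c)"
    have "?M \<in> T" using abc by (intro subalgebra_T(6) BB_T) (auto simp: EE_def sdiff_def)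
    moreover have "mat_mult X ?M D = mon l"
      using BB_D[OF abc(1-5)] scal_nonzero[of l] abc(6)
      by (simp add: mat_mult_scale_left)
    ultimately show ?thesis by blast
  qed
  then obtain M where M: "\<And>l. l \<in> Labs \<Longrightarrow> M l \<in> T \<and> mat_mult X (M l) D = mon l" by metis
  ultimately have "Y = mat_mult X (\<Sum>l\<in>Labs. mat_scale (coef l Y) (M l)) D"
    unfolding mat_mult_sum_left mat_mult_scale_left by simp
  moreover have "(\<Sum>l\<in>Labs. mat_scale (coef l Y) (M l)) \<in> T"
    using M by (intro sum_T subalgebra_T(6)) auto
  ultimately show "Y \<in> {mat_mult X M D |M. M \<in> T}" by blast
qed

lemma block_algebra_cls: "block_algebra p n U x cls = blk"
  unfolding block_algebra_def block_idem_cls block_carrier blk_def ..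

text \<open>Membership in the class gives c^- - d = S, and the vanishing count puts c^- inside a
  \<union> d, so \<open>S\<close> lies in a. Conversely d = c^- - S is the only candidate, and it
  works.\<close>

lemma class_condition:
  assumes "a \<subseteq> {1..n}" "c \<subseteq> {1..n}"
  shows "(\<exists>d\<in>EE n. (c, d, c) \<in> cls \<and> n_triple p U c (a \<union> d) c = 0) \<longleftrightarrow> S \<subseteq> a \<and> S \<subseteq> c"
proof
  assume "\<exists>d\<in>EE n. (c, d, c) \<in> cls \<and> n_triple p U c (a \<union> d) c = 0"
  then obtain d where d: "(c, d, c) \<in> cls" "n_triple p U c (a \<union> d) c = 0" by blast
  have "finite (minus_part p U c)"
    using assms(2) by (intro finite_subset[of "minus_part p U c" "{1..n}"]) (auto simp: minus_part_def)
  then have "minus_part p U c \<subseteq> a \<union> d" using d(2) by (simp add: n_triple_def)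
  moreover have "minus_part p U c - d = S" using d(1) by (simp add: cls_def)
  ultimately show "S \<subseteq> a \<and> S \<subseteq> c" by (auto simp: minus_part_def)
next
  assume ac: "S \<subseteq> a \<and> S \<subseteq> c"
  let ?d = "minus_part p U c - S"
  have "minus_part p U c - (a \<union> ?d) = {}" using ac by auto
  then have "n_triple p U c (a \<union> ?d) c = 0" unfolding n_triple_def Int_absorb by (simp only: card.empty)
  moreover have "(c, ?d, c) \<in> cls" using ac assms by (simp add: cls_iff)
  moreover have "?d \<in> EE n" using assms by (auto simp: EE_def minus_part_def)
  ultimately show "\<exists>d\<in>EE n. (c, d, c) \<in> cls \<and> n_triple p U c (a \<union> d) c = 0" by blast
qed

lemma basis_eq:
  "{mat_mult X (BB n U x a (sdiff a c \<union> b) c) D |a b c.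
      a \<in> EE n \<and> b \<in> EE n \<and> c \<in> EE n \<and> b \<subseteq> plus_part p U (a \<inter> c) \<and>
      (\<exists>d\<in>EE n. (c, d, c) \<in> cls \<and> n_triple p U c (a \<union> d) c = 0) \<and>
      p dvd kk U (sdiff a c \<union> b)} =
    (\<lambda>l. mat_scale (scal l) (mon l)) ` {l \<in> Labs. deg l \<ge> 1}" (is "?L = ?R")
proof -
  have dvd: "p dvd kk U (sdiff a c \<union> b) \<longleftrightarrow> deg (labt a b c) \<ge> 1"
    if "a \<subseteq> {1..n}" "c \<subseteq> {1..n}" "b \<subseteq> {1..n}" for a b c
  proof -
    have s: "sdiff a c \<union> b \<subseteq> {1..n}" using that by (auto simp: sdiff_def)
    then have "p dvd kk U (sdiff a c \<union> b) \<longleftrightarrow> (\<exists>i\<in>sdiff a c \<union> b. val i = 0)"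
      using dvd_kk finite_subset[OF s] by simp
    also have "\<dots> \<longleftrightarrow> (\<exists>i\<in>P. i \<in> sdiff a c \<union> b)" using s P_iff by blast
    also have "\<dots> \<longleftrightarrow> deg (labt a b c) \<ge> 1" unfolding deg_labt by (auto simp: sdiff_def)
    finally show ?thesis .
  qed
  have plus: "b \<subseteq> plus_part p U (a \<inter> c) \<longleftrightarrow> b \<subseteq> a \<inter> c \<inter> P" if "a \<subseteq> {1..n}" for a b c
    using that by (auto simp: plus_part_def)
  show ?thesis
  proof (intro equalityI subsetI)
    fix Y assume "Y \<in> ?L"
    then obtain a b c where Y: "Y = mat_mult X (BB n U x a (sdiff a c \<union> b) c) D"
      and E: "a \<in> EE n" "b \<in> EE n" "c \<in> EE n" and b: "b \<subseteq> plus_part p U (a \<inter> c)"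
      and cl: "\<exists>d\<in>EE n. (c, d, c) \<in> cls \<and> n_triple p U c (a \<union> d) c = 0"
      and dv: "p dvd kk U (sdiff a c \<union> b)"
      by blast
    have sub: "a \<subseteq> {1..n}" "b \<subseteq> {1..n}" "c \<subseteq> {1..n}" using E by (simp_all only: EE_def Pow_iff)
    have abc: "b \<subseteq> a \<inter> c \<inter> P" "S \<subseteq> a" "S \<subseteq> c" "deg (labt a b c) \<ge> 1"
      using b cl dv plus[OF sub(1)] class_condition[OF sub(1,3)] dvd[OF sub(1,3,2)] by blast+
    show "Y \<in> ?R"
      using BB_D[of a c b] labt_Labs[of a c b] abc sub unfolding Y by blast
  next
    fix Y assume "Y \<in> ?R"
    then obtain l where l: "l \<in> Labs" "deg l \<ge> 1" "Y = mat_scale (scal l) (mon l)" by blast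
    obtain a b c where abc: "S \<subseteq> a" "a \<subseteq> {1..n}" "S \<subseteq> c" "c \<subseteq> {1..n}" "b \<subseteq> a \<inter> c \<inter> P" "l = labt a b c"
      using Labs_labt[OF l(1)] .
    have b: "b \<subseteq> {1..n}" using abc by blast
    have "Y = mat_mult X (BB n U x a (sdiff a c \<union> b) c) D"
      using BB_D[OF abc(1-5)] l(3) abc(6) by simp
    moreover have "b \<subseteq> plus_part p U (a \<inter> c)" using plus abc(2,5) by blast
    moreover have "\<exists>d\<in>EE n. (c, d, c) \<in> cls \<and> n_triple p U c (a \<union> d) c = 0"
      using class_condition[OF abc(2,4)] abc(1,3) by blast
    moreover have "p dvd kk U (sdiff a c \<union> b)" using dvd[OF abc(2,4) b] l(2) abc(6) by simp
    moreover have "a \<in> EE n" "b \<in> EE n" "c \<in> EE n" using abc b by (auto simp: EE_def)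
    ultimately show "Y \<in> ?L" by blast
  qed
qed

lemma n_triple_cls: "(k, l, k) \<in> cls \<Longrightarrow> n_triple p U k l k = card S"
  by (simp add: cls_def n_triple_def)

end

theorem theorem6p8:
  fixes p n g :: nat
    and U :: "nat \<Rightarrow> 'u set"
    and x :: "nat \<Rightarrow> 'u"
    and C :: "nat \<Rightarrow> (nat set \<times> nat set \<times> nat set) set"
  assumes "p = CHAR('f::field)"
    and "n \<ge> 1"
    and "\<forall>a\<in>{1..n}. finite (U a) \<and> card (U a) \<ge> 2"
    and "x \<in> points n U"
    and "bij_betw C {1..2 ^ n_minus p n U} (approx_classes p n U)"
    and "g \<in> {1..2 ^ n_minus p n U}"
  shows "(\<forall>h\<in>EE n. \<forall>i\<in>EE n. \<forall>j\<in>EE n. i \<subseteq> plus_part p U (h \<inter> j) \<longrightarrow>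
           (h, sdiff h j \<union> i, j) \<in> PP n U) \<and>
         (let TDg = block_algebra p n U x (C g) :: ('f, (nat \<Rightarrow> 'u, 'f) matrix) module;
             Dg = block_idem p n U x (C g);
             Rad = jacobson_radical TDg;
             basis = {mat_mult (points n U) (BB n U x a (sdiff a c \<union> b) c) Dg |a b c.
                        a \<in> EE n \<and> b \<in> EE n \<and> c \<in> EE n \<and> b \<subseteq> plus_part p U (a \<inter> c) \<and>
                        (\<exists>d\<in>EE n. (c, d, c) \<in> C g \<and> n_triple p U c (a \<union> d) c = 0) \<and>
                        p dvd kk U (sdiff a c \<union> b)}
         in mat_space.independent basis \<and> mat_space.span basis = Rad \<and>
            has_nilpotent_index TDg Rad (2 * n_plus p n U + 1) \<and>
            (\<forall>k l. (k, l, k) \<in> C g \<longrightarrow>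
               (\<forall>k' l'. (k', l', k') \<in> C g \<longrightarrow> n_triple p U k' l' k' = n_triple p U k l k) \<and>
               algebra_iso (quotient_algebra TDg Rad)
                 (direct_power
                    (matrix_algebra {1..(2::nat) ^ (n - n_plus p n U - n_triple p U k l k)})
                    (2 ^ n_plus p n U)) \<noteq> {} \<and>
               int (mat_space.dim Rad) =
                 4 ^ (n - n_plus p n U - n_triple p U k l k) * 5 ^ n_plus p n U
                 - 2 ^ (2 * n - n_plus p n U - 2 * n_triple p U k l k)))"
proof -
  \<comment> \<open>Every class comes from a subset \<open>S\<close> of [n]^-, so the rest depends
    on \<open>C g\<close> through \<open>S\<close> alone.\<close>
  obtain S where S: "S \<subseteq> minus_part p U {1..n}"
    and Cg: "C g = {(a, b, c). (a, b, c) \<in> diag_triples p n U \<and> minus_part p U a - b = S}"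
  proof -
    have "C g \<in> approx_classes p n U" using assms(5,6) by (auto simp: bij_betw_def)
    moreover have "p \<noteq> 1" using assms(1) by simp
    ultimately have "C g \<in> (\<lambda>S. {(a, b, c). (a, b, c) \<in> diag_triples p n U \<and> minus_part p U a - b = S})
        ` Pow (minus_part p U {1..n})"
      using bij_betw_approx_classes[of p n U] by (simp add: bij_betw_def)
    then show ?thesis using that by blast
  qed
  interpret factorial_block "TYPE('f)" p n U x S
    by unfold_locales (use assms S in auto)
  have cls: "C g = cls" using Cg by (simp add: cls_def)
  \<comment> \<open>|U_i| = 2 together with p dvd |U_i| - 1 would give p = 1. This inclusion is what
    membership in \<open>PP\<close> asks of \<open>i\<close>.\<close>
  have circ: "plus_part p U V \<subseteq> circ_part U V" for V
    using p_ne_1 by (auto simp: plus_part_def circ_part_def)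
  let ?B = "(\<lambda>l. mat_scale (scal l) (mon l)) ` {l \<in> Labs. deg l \<ge> 1}"
  have basis: "mat_space.independent ?B" "mat_space.span ?B = filt 1"
    "mat_space.dim (filt 1) = card {l \<in> Labs. deg l \<ge> 1}"
    using scaled_basis[of scal "{l \<in> Labs. deg l \<ge> 1}"] scal_nonzero by (auto simp: filt_def)
  have iso: "algebra_iso (quotient_algebra blk (filt 1))
      (direct_power (matrix_algebra {1..(2::nat) ^ (n - n_plus p n U - card S)}) (2 ^ n_plus p n U)) \<noteq> {}"
    using blk_iso unfolding NN_def card_W .
  show ?thesis
    unfolding Let_def cls block_algebra_cls block_idem_cls jacobson_blk basis_eq
  proof (intro conjI ballI allI impI)
    fix h i j assume "h \<in> EE n" "i \<in> EE n" "j \<in> EE n" "i \<subseteq> plus_part p U (h \<inter> j)"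
    then show "(h, sdiff h j \<union> i, j) \<in> PP n U"
      using circ[of "h \<inter> j"] by (auto simp: PP_def EE_def sdiff_def)
  next
    fix k l k' l' assume "(k, l, k) \<in> cls" "(k', l', k') \<in> cls"
    then show "n_triple p U k' l' k' = n_triple p U k l k" by (simp only: n_triple_cls)
  next
    fix k l assume kl: "(k, l, k) \<in> cls"
    show "algebra_iso (quotient_algebra blk (filt 1))
        (direct_power (matrix_algebra {1..(2::nat) ^ (n - n_plus p n U - n_triple p U k l k)})
          (2 ^ n_plus p n U)) \<noteq> {}"
      unfolding n_triple_cls[OF kl] by (rule iso)
    show "int (mat_space.dim (filt 1)) =
        4 ^ (n - n_plus p n U - n_triple p U k l k) * 5 ^ n_plus p n U
        - 2 ^ (2 * n - n_plus p n U - 2 * n_triple p U k l k)"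
      unfolding n_triple_cls[OF kl] basis(3) by (rule dim_eq)
  qed (use basis nilpotent_index in simp_all)
qed

end
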